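(* Let $X$ be a Banach space with a shrinking unconditional basis $(e_j)_{j=1}^\infty$. Assume that every spreading model of a block basic sequence of $(e_j)_{j=1}^\infty$ is isomorphic to $c_0$. Then every twisted spreading model of $Z(X)$ is isomorphic to the Kalton-Peck space $Z_2$.
   Context: Spaces are infinite-dimensional Banach spaces over $\mathbb C$. $\omega$ is the space of all complex sequences with pointwise convergence; $c_{00}$ is the space of finitely supported sequences. Consecutive blocks are finitely supported vectors $u_1,u_2,\dots$ with $\max\operatorname{supp}u_j<\min\operatorname{supp}u_{j+1}$. A space $X$ with an unconditional basis $(e_j)$ is regarded as a sequence space in $\omega$ through its basis (renormed, if necessary, so that the basis is 1-unconditional), and $X^*$ as a sequence space through $x^*\mapsto (x^*(e_j))_j$. Spreading model: let $(x_j)$ be a bounded sequence in a Banach space $Y$ without convergent subsequences. By Brunel and Sucheston there is a subsequence $(x'_j)$ such that for all $n$ and scalars $a_1,\dots,a_n$ there is a number $L(a_1,\dots,a_n)$ with: for every $\varepsilon>0$ there is $\nu$ with $\big|\,\|\sum_{j=1}^n a_jx'_{k_j}\|-L(a_1,\dots,a_n)\big|<\varepsilon$ whenever $\nu\le k_1<\dots<k_n$. The completion of $c_{00}$ under the norm $\|\sum_{j=1}^n a_je_j\|:=L(a_1,\dots,a_n)$ is a spreading model generated by $(x_j)$. The space $Z(X)$. Let $\mathbb S=\{z\in\mathbb C:0\le \operatorname{Re}z\le 1\}$. $\mathcal F_\infty(X,X^* )$ is the space of functions $F:\mathbb S\to\omega$, bounded and continuous on $\mathbb S$, analytic in its interior,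 such that $t\mapsto F(it)\in X$ and $t\mapsto F(1+it)\in X^*$ are bounded and continuous, with norm $\max(\sup_t\|F(it)\|_X,\sup_t\|F(1+it)\|_{X^*})$. The interpolation space $(X,X^* )_{1/2}=\{F(1/2):F\in\mathcal F_\infty(X,X^* )\}$ with the quotient norm equals $\ell_2$ up to an equivalent norm. Fix a homogeneous selection $x\in\ell_2\mapsto B(x)\in\mathcal F_\infty(X,X^* )$ with $B(x)(1/2)=x$ and $\|B(x)\|\le C\|x\|_2$, and put $\Omega(x)=B(x)'(1/2)\in\omega$. Then $Z(X)=\{(x,y)\in\omega\times\omega: y\in\ell_2,\ x-\Omega(y)\in\ell_2\}$ with the quasi-norm $\|(x,y)\|=\|x-\Omega(y)\|_2+\|y\|_2$ (which is equivalent to a norm). The selection used on finitely supported $u$ with $\|u\|_2=1$ is the following: write $|u|^2=|v|\,|w|$ with $\|v\|_X,\|w\|_{X^*}\le1$ and $\operatorname{supp}u=\operatorname{supp}v=\operatorname{supp}w$ (Lozanovskii factorization) and take $B(u)(z)=u|v|^{1/2-z}|w|^{z-1/2}$ coordinatewise on $\operatorname{supp}u$, extended homogeneously. Kalton-Peck space: $Z_2=\{(x,y)\in\omega\times\omega:\ y\in\ell_2,\ x-\mathcal K(y)\in\ell_2\}$ with $\|(x,y)\|_{Z_2}=\|x-\mathcal K(y)\|_2+\|y\|_2$, where $\mathcal K(y)=\sum_j y_j\log|y_j|\,e_j$ for $\|y\|_2=1$ (with $0\log 0=0$), extended homogeneously. Twisted spreading model of $Z(X)$ (with centralizer $\Omega$):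 let $(u_j)$ be a sequence of normalized consecutive blocks in $\ell_2$ such that (after passing to a subsequence; this is always possible) for every $n$ and all scalars $a_1,\dots,a_n,b_1,\dots,b_n$ the limit $$\lim_{\nu\to\infty,\ \nu<k_1<\dots<k_n}\Big(\Big\|\sum_{j=1}^n a_ju_{k_j}+\sum_{j=1}^n b_j\Omega(u_{k_j})-\Omega\Big(\sum_{j=1}^n b_ju_{k_j}\Big)\Big\|_2+\Big\|\sum_{j=1}^n b_ju_{k_j}\Big\|_2\Big)$$ exists. The completion of $c_{00}\times c_{00}$ under the quasi-norm $\|(a,b)\|$ given by this limit is a twisted spreading model of $Z(X)$. *)

theory Defs
  imports "HOL-Analysis.Analysis"
begin

section \<open>Complex Banach spaces with a basis\<close>

class complex_banach = banach +
  fixes scaleC :: "complex \<Rightarrow> 'a \<Rightarrow> 'a"  (infixr "*\<^sub>C" 75)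
  assumes scaleC_add_right: "c *\<^sub>C (x + y) = c *\<^sub>C x + c *\<^sub>C y"
    and scaleC_add_left: "(c + d) *\<^sub>C x = c *\<^sub>C x + d *\<^sub>C x"
    and scaleC_scaleC: "c *\<^sub>C d *\<^sub>C x = (c * d) *\<^sub>C x"
    and scaleR_scaleC: "r *\<^sub>R x = complex_of_real r *\<^sub>C x"
    and norm_scaleC: "norm (c *\<^sub>C x) = cmod c * norm x"

definition bounded_clinear :: "('a::complex_banach \<Rightarrow> complex) \<Rightarrow> bool" where
  "bounded_clinear f \<longleftrightarrow> bounded_linear f \<and> (\<forall>c x. f (c *\<^sub>C x) = c * f x)"

definition schauder_basis :: "(nat \<Rightarrow> 'a::complex_banach) \<Rightarrow> bool" where
  "schauder_basis e \<longleftrightarrow> (\<forall>x. \<exists>!a. (\<lambda>j. a j *\<^sub>C e j) sums x)"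

definition coord :: "(nat \<Rightarrow> 'a::complex_banach) \<Rightarrow> 'a \<Rightarrow> nat \<Rightarrow> complex" where
  "coord e x = (THE a. (\<lambda>j. a j *\<^sub>C e j) sums x)"

text \<open>\<^const>\<open>has_sum\<close> is convergence of the net of finite partial sums, that is,
  unconditional convergence of the series.\<close>

definition unconditional_basis :: "(nat \<Rightarrow> 'a::complex_banach) \<Rightarrow> bool" where
  "unconditional_basis e \<longleftrightarrow>
     schauder_basis e \<and> (\<forall>x. ((\<lambda>j. coord e x j *\<^sub>C e j) has_sum x) UNIV)"

text \<open>The norm of the restriction of each functional to the closed span of
  \<open>e n, e (n+1), \<dots>\<close> tends to \<open>0\<close>.\<close>

definition shrinking_basis :: "(nat \<Rightarrow> 'a::complex_banach) \<Rightarrow> bool" where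
  "shrinking_basis e \<longleftrightarrow> schauder_basis e \<and>
     (\<forall>f. bounded_clinear f \<longrightarrow>
        (\<forall>\<epsilon>>0. \<exists>n. \<forall>x. (\<forall>j<n. coord e x j = 0) \<longrightarrow> cmod (f x) \<le> \<epsilon> * norm x))"

text \<open>Equivalent norms \<open>N\<close> that make the basis \<open>1\<close>-unconditional.\<close>

definition unconditional_renorming ::
    "(nat \<Rightarrow> 'a::complex_banach) \<Rightarrow> ('a \<Rightarrow> real) \<Rightarrow> bool" where
  "unconditional_renorming e N \<longleftrightarrow>
     (\<forall>x y. N (x + y) \<le> N x + N y) \<and>
     (\<forall>c x. N (c *\<^sub>C x) = cmod c * N x) \<and>
     (\<exists>c>0. \<exists>C>0. \<forall>x. c * norm x \<le> N x \<and> N x \<le> C * norm x) \<and>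
     (\<forall>x y. (\<forall>j. cmod (coord e x j) \<le> cmod (coord e y j)) \<longrightarrow> N x \<le> N y)"


section \<open>Quasi-normed spaces, completion and isomorphism\<close>

record 'v qspace =
  vecs :: "'v set"
  vadd :: "'v \<Rightarrow> 'v \<Rightarrow> 'v"
  vscale :: "complex \<Rightarrow> 'v \<Rightarrow> 'v"
  vnorm :: "'v \<Rightarrow> real"

definition isomorphic :: "'v qspace \<Rightarrow> 'w qspace \<Rightarrow> bool" where
  "isomorphic E F \<longleftrightarrow> (\<exists>T. bij_betw T (vecs E) (vecs F) \<and>
     (\<forall>x\<in>vecs E. \<forall>y\<in>vecs E. T (vadd E x y) = vadd F (T x) (T y)) \<and>
     (\<forall>c. \<forall>x\<in>vecs E. T (vscale E c x) = vscale F c (T x)) \<and>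
     (\<exists>c>0. \<exists>C>0. \<forall>x\<in>vecs E.
        c * vnorm E x \<le> vnorm F (T x) \<and> vnorm F (T x) \<le> C * vnorm E x))"

definition vdist :: "'v qspace \<Rightarrow> 'v \<Rightarrow> 'v \<Rightarrow> real" where
  "vdist E x y = vnorm E (vadd E x (vscale E (-1) y))"

definition cauchy_seqs :: "'v qspace \<Rightarrow> (nat \<Rightarrow> 'v) set" where
  "cauchy_seqs E = {s. (\<forall>n. s n \<in> vecs E) \<and>
     (\<forall>\<epsilon>>0. \<exists>M. \<forall>m\<ge>M. \<forall>n\<ge>M. vdist E (s m) (s n) < \<epsilon>)}"

definition null_rel :: "'v qspace \<Rightarrow> ((nat \<Rightarrow> 'v) \<times> (nat \<Rightarrow> 'v)) set" where
  "null_rel E = {(s, t). s \<in> cauchy_seqs E \<and> t \<in> cauchy_seqs E \<and>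
     (\<lambda>n. vdist E (s n) (t n)) \<longlonglongrightarrow> 0}"

text \<open>A quasi-norm need not be continuous, so \<open>vnorm E (s n)\<close> need not converge along a
  Cauchy sequence \<open>s\<close>. The quasi-norm of a class is therefore the infimum of
  \<open>limsup vnorm E (s n)\<close> over its representatives \<open>s\<close>; if \<open>vnorm E\<close> is a norm, this is
  the limit along any representative.\<close>

definition completion :: "'v qspace \<Rightarrow> (nat \<Rightarrow> 'v) set qspace" where
  "completion E = \<lparr>
     vecs = cauchy_seqs E // null_rel E,
     vadd = (\<lambda>A B. \<Union>s\<in>A. \<Union>t\<in>B. null_rel E `` {\<lambda>n. vadd E (s n) (t n)}),
     vscale = (\<lambda>c A. \<Union>s\<in>A. null_rel E `` {\<lambda>n. vscale E c (s n)}),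
     vnorm = (\<lambda>A. Inf {r. \<exists>s\<in>A. \<forall>\<^sub>F n in sequentially. vnorm E (s n) \<le> r})\<rparr>"


section \<open>Sequence spaces\<close>

definition seq_space ::
    "(nat \<Rightarrow> complex) set \<Rightarrow> ((nat \<Rightarrow> complex) \<Rightarrow> real) \<Rightarrow> (nat \<Rightarrow> complex) qspace" where
  "seq_space S N = \<lparr>vecs = S, vadd = (\<lambda>x y j. x j + y j), vscale = (\<lambda>c x j. c * x j), vnorm = N\<rparr>"

definition seq_pair_space ::
    "((nat \<Rightarrow> complex) \<times> (nat \<Rightarrow> complex)) set \<Rightarrow>
     ((nat \<Rightarrow> complex) \<times> (nat \<Rightarrow> complex) \<Rightarrow> real) \<Rightarrow>
     ((nat \<Rightarrow> complex) \<times> (nat \<Rightarrow> complex)) qspace" where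
  "seq_pair_space S N = \<lparr>
     vecs = S,
     vadd = (\<lambda>(x, y) (x', y'). (\<lambda>j. x j + x' j, \<lambda>j. y j + y' j)),
     vscale = (\<lambda>c (x, y). (\<lambda>j. c * x j, \<lambda>j. c * y j)),
     vnorm = N\<rparr>"

definition supp :: "(nat \<Rightarrow> complex) \<Rightarrow> nat set" where
  "supp a = {j. a j \<noteq> 0}"

definition c00 :: "(nat \<Rightarrow> complex) set" where
  "c00 = {a. finite (supp a)}"

definition c0_space :: "(nat \<Rightarrow> complex) qspace" where
  "c0_space = seq_space {a. a \<longlonglongrightarrow> 0} (\<lambda>a. SUP j. cmod (a j))"

definition ell2 :: "(nat \<Rightarrow> complex) set" where
  "ell2 = {x. summable (\<lambda>j. (cmod (x j))\<^sup>2)}"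

definition norm2 :: "(nat \<Rightarrow> complex) \<Rightarrow> real" where
  "norm2 x = sqrt (\<Sum>j. (cmod (x j))\<^sup>2)"

definition consecutive_blocks :: "(nat \<Rightarrow> nat \<Rightarrow> complex) \<Rightarrow> bool" where
  "consecutive_blocks u \<longleftrightarrow>
     (\<forall>j. finite (supp (u j)) \<and> supp (u j) \<noteq> {} \<and> Max (supp (u j)) < Min (supp (u (Suc j))))"

text \<open>The space with basis \<open>e\<close> and norm \<open>N\<close>, and its dual, as sequence spaces.\<close>

definition basis_seq_space ::
    "(nat \<Rightarrow> 'a::complex_banach) \<Rightarrow> ('a \<Rightarrow> real) \<Rightarrow> (nat \<Rightarrow> complex) qspace" where
  "basis_seq_space e N = seq_space (range (coord e)) (\<lambda>a. N (\<Sum>j. a j *\<^sub>C e j))"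

definition dual_seq_space ::
    "(nat \<Rightarrow> 'a::complex_banach) \<Rightarrow> ('a \<Rightarrow> real) \<Rightarrow> (nat \<Rightarrow> complex) qspace" where
  "dual_seq_space e N = seq_space
     {\<lambda>j. f (e j) |f. bounded_clinear f}
     (\<lambda>b. Sup {cmod (f x) |f x. bounded_clinear f \<and> (\<forall>j. f (e j) = b j) \<and> N x \<le> 1})"


section \<open>Spreading models\<close>

definition block_basic_sequence ::
    "(nat \<Rightarrow> 'a::complex_banach) \<Rightarrow> (nat \<Rightarrow> 'a) \<Rightarrow> bool" where
  "block_basic_sequence e x \<longleftrightarrow> consecutive_blocks (\<lambda>j. coord e (x j))"

text \<open>\<open>L a\<close> is the limit of \<open>\<Phi> n k a\<close> over indices \<open>\<nu> \<le> k 0 < \<dots> < k (n - 1)\<close>,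
  for every \<open>n\<close> with \<open>a\<close> supported in \<open>{..<n}\<close>.\<close>

definition spreading_limit ::
    "(nat \<Rightarrow> (nat \<Rightarrow> nat) \<Rightarrow> 'v \<Rightarrow> real) \<Rightarrow> (nat \<Rightarrow> 'v set) \<Rightarrow> ('v \<Rightarrow> real) \<Rightarrow> bool" where
  "spreading_limit \<Phi> V L \<longleftrightarrow>
     (\<forall>n. \<forall>a\<in>V n. \<forall>\<epsilon>>0. \<exists>\<nu>. \<forall>k. strict_mono_on {..<n} k \<and> (\<forall>j<n. \<nu> \<le> k j) \<longrightarrow>
        \<bar>\<Phi> n k a - L a\<bar> < \<epsilon>)"

definition spreading_models ::
    "(nat \<Rightarrow> 'a::complex_banach) \<Rightarrow> (nat \<Rightarrow> nat \<Rightarrow> complex) set qspace set" where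
  "spreading_models x = {completion (seq_space c00 L) |L.
     bounded (range x) \<and>
     (\<forall>r. strict_mono r \<longrightarrow> \<not> convergent (x \<circ> r)) \<and>
     (\<exists>r::nat\<Rightarrow>nat. strict_mono r \<and>
        spreading_limit (\<lambda>n k a. norm (\<Sum>j<n. a j *\<^sub>C x (r (k j)))) (\<lambda>n. {a. supp a \<subseteq> {..<n}}) L)}"


section \<open>Interpolation and the derivation\<close>

definition strip :: "complex set" where
  "strip = {z. 0 \<le> Re z \<and> Re z \<le> 1}"

definition bounded_continuous_path :: "(nat \<Rightarrow> complex) qspace \<Rightarrow> (real \<Rightarrow> nat \<Rightarrow> complex) \<Rightarrow> bool" where
  "bounded_continuous_path E g \<longleftrightarrow>
     range g \<subseteq> vecs E \<and> bdd_above (range (\<lambda>t. vnorm E (g t))) \<and>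
     (\<forall>t. ((\<lambda>s. vdist E (g s) (g t)) \<longlongrightarrow> 0) (at t))"

text \<open>Sequences carry the product topology, in which boundedness and analyticity are
  coordinatewise. Only the values of \<open>F\<close> on the strip matter.\<close>

definition F_infty ::
    "(nat \<Rightarrow> complex) qspace \<Rightarrow> (nat \<Rightarrow> complex) qspace \<Rightarrow> (complex \<Rightarrow> nat \<Rightarrow> complex) set" where
  "F_infty E E' = {F. continuous_on strip F \<and>
     (\<forall>j. bounded ((\<lambda>z. F z j) ` strip)) \<and>
     (\<forall>j. (\<lambda>z. F z j) holomorphic_on interior strip) \<and>
     bounded_continuous_path E (\<lambda>t. F (\<i> * of_real t)) \<and>
     bounded_continuous_path E' (\<lambda>t. F (1 + \<i> * of_real t))}"

definition F_norm ::
    "(nat \<Rightarrow> complex) qspace \<Rightarrow> (nat \<Rightarrow> complex) qspace \<Rightarrow> (complex \<Rightarrow> nat \<Rightarrow> complex) \<Rightarrow> real" where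
  "F_norm E E' F = max (SUP t. vnorm E (F (\<i> * of_real t))) (SUP t. vnorm E' (F (1 + \<i> * of_real t)))"

text \<open>On finitely supported unit vectors the selection is given by a Lozanovskii
  factorization. Off the support of \<open>u\<close> the formula below vanishes.\<close>

definition lozanovskii_selection ::
    "(nat \<Rightarrow> complex) qspace \<Rightarrow> (nat \<Rightarrow> complex) qspace \<Rightarrow>
     ((nat \<Rightarrow> complex) \<Rightarrow> complex \<Rightarrow> nat \<Rightarrow> complex) \<Rightarrow> bool" where
  "lozanovskii_selection E E' B \<longleftrightarrow>
     (\<forall>x\<in>ell2. B x \<in> F_infty E E' \<and> B x (1/2) = x) \<and>
     (\<forall>c. \<forall>x\<in>ell2. \<forall>z\<in>strip. B (\<lambda>j. c * x j) z = (\<lambda>j. c * B x z j)) \<and>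
     (\<exists>C. \<forall>x\<in>ell2. F_norm E E' (B x) \<le> C * norm2 x) \<and>
     (\<forall>u\<in>c00. norm2 u = 1 \<longrightarrow>
        (\<exists>v\<in>vecs E. \<exists>w\<in>vecs E'. vnorm E v \<le> 1 \<and> vnorm E' w \<le> 1 \<and>
           supp v = supp u \<and> supp w = supp u \<and>
           (\<forall>j. (cmod (u j))\<^sup>2 = cmod (v j) * cmod (w j)) \<and>
           (\<forall>z\<in>strip. \<forall>j. B u z j =
              u j * of_real (cmod (v j)) powr (1/2 - z) * of_real (cmod (w j)) powr (z - 1/2))))"

definition derivation ::
    "((nat \<Rightarrow> complex) \<Rightarrow> complex \<Rightarrow> nat \<Rightarrow> complex) \<Rightarrow> (nat \<Rightarrow> complex) \<Rightarrow> nat \<Rightarrow> complex" where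
  "derivation B x = (\<lambda>j. deriv (\<lambda>z. B x z j) (1/2))"


section \<open>Twisted sums and twisted spreading models\<close>

text \<open>With \<open>\<Omega> = derivation B\<close> this is the space \<open>Z(X)\<close>.\<close>

definition twisted_sum ::
    "((nat \<Rightarrow> complex) \<Rightarrow> nat \<Rightarrow> complex) \<Rightarrow> ((nat \<Rightarrow> complex) \<times> (nat \<Rightarrow> complex)) qspace" where
  "twisted_sum \<Omega> = seq_pair_space
     {(x, y). y \<in> ell2 \<and> (\<lambda>j. x j - \<Omega> y j) \<in> ell2}
     (\<lambda>(x, y). norm2 (\<lambda>j. x j - \<Omega> y j) + norm2 y)"

text \<open>The homogeneous extension of \<open>y \<mapsto> (y j * ln \<bar>y j\<bar>)\<^sub>j\<close> from the unit sphere.\<close>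

definition kalton_peck_map :: "(nat \<Rightarrow> complex) \<Rightarrow> nat \<Rightarrow> complex" where
  "kalton_peck_map y = (\<lambda>j. y j * of_real (ln (cmod (y j) / norm2 y)))"

definition Z2 :: "((nat \<Rightarrow> complex) \<times> (nat \<Rightarrow> complex)) qspace" where
  "Z2 = twisted_sum kalton_peck_map"

definition twisted_spreading_models ::
    "((nat \<Rightarrow> complex) \<Rightarrow> nat \<Rightarrow> complex) \<Rightarrow>
     (nat \<Rightarrow> (nat \<Rightarrow> complex) \<times> (nat \<Rightarrow> complex)) set qspace set" where
  "twisted_spreading_models \<Omega> = {completion (seq_pair_space (c00 \<times> c00) Q) |Q.
     \<exists>u. consecutive_blocks u \<and> (\<forall>j. norm2 (u j) = 1) \<and>
       spreading_limit
         (\<lambda>n k (a, b). vnorm (twisted_sum \<Omega>)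
            (\<lambda>i. (\<Sum>j<n. a j * u (k j) i) + (\<Sum>j<n. b j * \<Omega> (u (k j)) i),
             \<lambda>i. \<Sum>j<n. b j * u (k j) i))
         (\<lambda>n. {a. supp a \<subseteq> {..<n}} \<times> {b. supp b \<subseteq> {..<n}}) Q}"

end

theory Submission
  imports Defs "HOL-Library.Function_Algebras" "HOL-Library.Ramsey"
    "HOL-Library.Diagonal_Subsequence" "HOL-Complex_Analysis.Great_Picard"
begin

text \<open>Write \<open>\<bar>u\<^sub>j\<bar>\<^sup>2 = \<bar>v\<^sub>j\<bar> \<bar>w\<^sub>j\<bar>\<close> for the Lozanovskii factorizations of the blocks. The \<open>v\<^sub>j\<close> are normalized
  blocks of \<open>X\<close>, so some subsequence has a spreading model, which is isomorphic to \<open>c\<^sub>0\<close>; along it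
  \<open>\<parallel>v\<^bsub>k(1)\<^esub> + \<dots> + v\<^bsub>k(n)\<^esub>\<parallel> \<le> K\<close> for late indices. For a unit vector \<open>b\<close> the vectors \<open>\<Sum> v\<^bsub>k(j)\<^esub>\<close> and
  \<open>\<Sum> \<bar>b\<^sub>j\<bar>\<^sup>2 w\<^bsub>k(j)\<^esub>\<close> then factor \<open>\<bar>\<Sum> b\<^sub>j u\<^bsub>k(j)\<^esub>\<bar>\<^sup>2\<close> up to the constant \<open>K\<close>, and the derivation that this
  factorization would define differs from \<open>\<Sum> b\<^sub>j \<Omega>(u\<^bsub>k(j)\<^esub>)\<close> by twice the Kalton-Peck map of \<open>b\<close>. Two
  factorizations of the same vector give derivations at bounded distance in \<open>\<ell>\<^sub>2\<close>; since
  \<open>(ln s)\<^sup>2 \<le> 4 (s + 1/s)\<close>, this needs only the duality of \<open>X\<close> and \<open>X\<^sup>*\<close> and no interpolation theory.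
  Hence the twisted spreading norm is equivalent to
  \<open>\<parallel>a - 2 \<K>(b)\<parallel>\<^sub>2 + \<parallel>b\<parallel>\<^sub>2\<close>, the quasi-norm of \<open>Z\<^sub>2\<close> up to scaling the first coordinate.\<close>

text \<open>The hypothesis supplies only an abstract isomorphism of a spreading model with
  \<open>c0_space\<close>; nothing says where it sends the unit vectors. What can be extracted is
  one-sided: sums of late terms stay bounded. This suffices because the dual side is convex: for a
  unit vector b the weights |b_j|^2 make \<Sum> |b_j|^2 w_j a convex combination of elements of the
  dual unit ball. The sums on the side of X are flat, so the whole weight |b_j|^2 sits on the dual
  factor, and its logarithm is the origin of the 2 in front of the Kalton-Peck map.

  A second obstacle is that quasi-norms need not be continuous, and that the limit quasi-norm is
  known only up to equivalence. Completions are therefore compared through a linear map into Z_2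
  that is bounded above and below, with constants allowed in the triangle inequality, in homogeneity
  and in the symmetry of the distance.\<close>

section \<open>Completions of quasi-normed spaces\<close>

text \<open>Addition is that of the ambient type on all its elements, so differences can be formed
  without closure conditions. Homogeneity carries the constant \<open>\<kappa>\<close> because a
  quasi-norm that is merely equivalent to a homogeneous one satisfies no more. Nonzero vectors may
  have quasi-norm 0; \<open>null_rel\<close> identifies them with 0.\<close>

locale quasi_normed =
  fixes E :: "'v::ab_group_add qspace" and \<kappa> :: real
  assumes vadd_eq: "vadd E x y = x + y"
    and vscale_minus_one: "vscale E (-1) x = - x"
    and vscale_add: "vscale E c (x + y) = vscale E c x + vscale E c y"
    and add_closed: "x \<in> vecs E \<Longrightarrow> y \<in> vecs E \<Longrightarrow> x + y \<in> vecs E"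
    and scale_closed: "x \<in> vecs E \<Longrightarrow> vscale E c x \<in> vecs E"
    and vnorm_nonneg: "x \<in> vecs E \<Longrightarrow> 0 \<le> vnorm E x"
    and vnorm_zero: "vnorm E 0 = 0"
    and vnorm_add: "x \<in> vecs E \<Longrightarrow> y \<in> vecs E \<Longrightarrow> vnorm E (x + y) \<le> \<kappa> * (vnorm E x + vnorm E y)"
    and vnorm_scale: "x \<in> vecs E \<Longrightarrow> vnorm E (vscale E c x) \<le> \<kappa> * (cmod c * vnorm E x)"
    and kappa_ge_1: "1 \<le> \<kappa>"
begin

lemma kappa_pos: "0 < \<kappa>"
  using kappa_ge_1 by simp

lemma minus_closed: "x \<in> vecs E \<Longrightarrow> - x \<in> vecs E"
  using scale_closed[of x "-1"] by (simp add: vscale_minus_one)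

lemma diff_closed: "x \<in> vecs E \<Longrightarrow> y \<in> vecs E \<Longrightarrow> x - y \<in> vecs E"
  using add_closed[of x "-y"] minus_closed by simp

lemma vdist_eq: "vdist E x y = vnorm E (x - y)"
  by (simp add: vdist_def vadd_eq vscale_minus_one)

lemma vscale_diff: "vscale E c (x - y) = vscale E c x - vscale E c y"
  using vscale_add[of c "x - y" y] by (simp add: algebra_simps)

text \<open>The factor is the price of approximate homogeneity at the scalar -1.\<close>

lemma vdist_commute:
  assumes "x \<in> vecs E" "y \<in> vecs E"
  shows "vdist E x y \<le> \<kappa> * vdist E y x"
  using vnorm_scale[OF diff_closed[OF assms(2,1)], of "-1"] by (simp add: vdist_eq vscale_minus_one)

lemma vdist_triangle:
  assumes "x \<in> vecs E" "y \<in> vecs E" "z \<in> vecs E"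
  shows "vdist E x z \<le> \<kappa> * (vdist E x y + vdist E y z)"
  using vnorm_add[OF diff_closed[OF assms(1,2)] diff_closed[OF assms(2,3)]] by (simp add: vdist_eq)

lemma vdist_add:
  assumes "x \<in> vecs E" "y \<in> vecs E" "x' \<in> vecs E" "y' \<in> vecs E"
  shows "vdist E (x + y) (x' + y') \<le> \<kappa> * (vdist E x x' + vdist E y y')"
  using vnorm_add[OF diff_closed[OF assms(1,3)] diff_closed[OF assms(2,4)]]
  by (simp add: vdist_eq algebra_simps)

lemma vdist_scale:
  assumes "x \<in> vecs E" "y \<in> vecs E"
  shows "vdist E (vscale E c x) (vscale E c y) \<le> \<kappa> * (cmod c * vdist E x y)"
  using vnorm_scale[OF diff_closed[OF assms], of c] by (simp add: vdist_eq vscale_diff)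

lemma vnorm_le_vdist:
  assumes "x \<in> vecs E" "y \<in> vecs E"
  shows "vnorm E x \<le> \<kappa> * (vdist E x y + vnorm E y)"
  using vnorm_add[OF diff_closed[OF assms] assms(2)] by (simp add: vdist_eq)

lemma vdist_nonneg: "x \<in> vecs E \<Longrightarrow> y \<in> vecs E \<Longrightarrow> 0 \<le> vdist E x y"
  by (simp add: vdist_eq vnorm_nonneg diff_closed)

lemma vdist_squeeze:
  assumes "f \<longlonglongrightarrow> 0" "\<And>n. s n \<in> vecs E" "\<And>n. t n \<in> vecs E"
    and "\<And>n. vdist E (s n) (t n) \<le> f n"
  shows "(\<lambda>n. vdist E (s n) (t n)) \<longlonglongrightarrow> 0"
  by (rule tendsto_sandwich[OF _ _ tendsto_const assms(1)])
    (simp_all add: vdist_nonneg assms)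

lemma cauchy_seqsD: "s \<in> cauchy_seqs E \<Longrightarrow> s n \<in> vecs E"
  by (simp add: cauchy_seqs_def)

lemma const_cauchy: "x \<in> vecs E \<Longrightarrow> (\<lambda>n. x) \<in> cauchy_seqs E"
  by (simp add: cauchy_seqs_def vdist_eq vnorm_zero)

lemma add_cauchy:
  assumes "s \<in> cauchy_seqs E" "t \<in> cauchy_seqs E"
  shows "(\<lambda>n. vadd E (s n) (t n)) \<in> cauchy_seqs E"
proof -
  have "\<exists>M. \<forall>m\<ge>M. \<forall>n\<ge>M. vdist E (s m + t m) (s n + t n) < \<epsilon>" if "\<epsilon> > 0" for \<epsilon>
  proof -
    have *: "\<epsilon> / (2 * \<kappa>) > 0" using that kappa_pos by simp
    obtain M1 where M1: "\<forall>m\<ge>M1. \<forall>n\<ge>M1. vdist E (s m) (s n) < \<epsilon> / (2 * \<kappa>)"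
      using assms(1) * unfolding cauchy_seqs_def by blast
    obtain M2 where M2: "\<forall>m\<ge>M2. \<forall>n\<ge>M2. vdist E (t m) (t n) < \<epsilon> / (2 * \<kappa>)"
      using assms(2) * unfolding cauchy_seqs_def by blast
    have "vdist E (s m + t m) (s n + t n) < \<epsilon>" if "m \<ge> max M1 M2" "n \<ge> max M1 M2" for m n
    proof -
      have "vdist E (s m + t m) (s n + t n) \<le> \<kappa> * (vdist E (s m) (s n) + vdist E (t m) (t n))"
        by (intro vdist_add cauchy_seqsD assms)
      also have "\<dots> < \<kappa> * (\<epsilon> / (2 * \<kappa>) + \<epsilon> / (2 * \<kappa>))"
        using M1 M2 that kappa_pos by (intro mult_strict_left_mono add_strict_mono) auto
      also have "\<dots> = \<epsilon>" using kappa_pos by (simp add: field_simps)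
      finally show ?thesis .
    qed
    then show ?thesis by blast
  qed
  then show ?thesis using assms by (auto simp: cauchy_seqs_def vadd_eq add_closed)
qed

lemma scale_cauchy:
  assumes "s \<in> cauchy_seqs E"
  shows "(\<lambda>n. vscale E c (s n)) \<in> cauchy_seqs E"
proof -
  have "\<exists>M. \<forall>m\<ge>M. \<forall>n\<ge>M. vdist E (vscale E c (s m)) (vscale E c (s n)) < \<epsilon>" if "\<epsilon> > 0" for \<epsilon>
  proof -
    \<comment> \<open>The summand 1 keeps the denominator positive when c = 0.\<close>
    define d where "d = \<epsilon> / (\<kappa> * (cmod c + 1))"
    have d: "d > 0" using that kappa_pos by (auto simp: d_def intro!: divide_pos_pos mult_pos_pos add_nonneg_pos)
    obtain M where M: "\<forall>m\<ge>M. \<forall>n\<ge>M. vdist E (s m) (s n) < d"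
      using assms d unfolding cauchy_seqs_def by blast
    have "vdist E (vscale E c (s m)) (vscale E c (s n)) < \<epsilon>" if "m \<ge> M" "n \<ge> M" for m n
    proof -
      have "vdist E (vscale E c (s m)) (vscale E c (s n)) \<le> \<kappa> * (cmod c * vdist E (s m) (s n))"
        by (intro vdist_scale cauchy_seqsD assms)
      also have "\<dots> \<le> \<kappa> * (cmod c * d)"
        using M that kappa_pos by (intro mult_left_mono) (auto simp: less_imp_le)
      also have "\<dots> < \<kappa> * ((cmod c + 1) * d)"
        using d kappa_pos by simp
      also have "\<dots> = \<epsilon>"
      proof -
        have "\<kappa> * (cmod c + 1) \<noteq> 0" using kappa_pos norm_ge_zero[of c] by (auto simp: add_nonneg_eq_0_iff)
        then show ?thesis unfolding d_def by (simp add: field_simps)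
      qed
      finally show ?thesis .
    qed
    then show ?thesis by blast
  qed
  then show ?thesis using assms by (auto simp: cauchy_seqs_def scale_closed)
qed

lemma null_rel_add:
  assumes "(s, s') \<in> null_rel E" "(t, t') \<in> null_rel E"
  shows "((\<lambda>n. vadd E (s n) (t n)), (\<lambda>n. vadd E (s' n) (t' n))) \<in> null_rel E"
proof -
  have c: "s \<in> cauchy_seqs E" "s' \<in> cauchy_seqs E" "t \<in> cauchy_seqs E" "t' \<in> cauchy_seqs E"
    and l: "(\<lambda>n. vdist E (s n) (s' n)) \<longlonglongrightarrow> 0" "(\<lambda>n. vdist E (t n) (t' n)) \<longlonglongrightarrow> 0"
    using assms by (auto simp: null_rel_def)
  have "(\<lambda>n. \<kappa> * (vdist E (s n) (s' n) + vdist E (t n) (t' n))) \<longlonglongrightarrow> 0"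
    by (intro tendsto_mult_right_zero tendsto_add_zero l)
  then have "(\<lambda>n. vdist E (s n + t n) (s' n + t' n)) \<longlonglongrightarrow> 0"
    by (rule vdist_squeeze) (intro vdist_add add_closed scale_closed cauchy_seqsD c)+
  then show ?thesis using c add_cauchy by (simp add: null_rel_def) (simp add: vadd_eq)
qed

lemma null_rel_scale:
  assumes "(s, s') \<in> null_rel E"
  shows "((\<lambda>n. vscale E c (s n)), (\<lambda>n. vscale E c (s' n))) \<in> null_rel E"
proof -
  have c: "s \<in> cauchy_seqs E" "s' \<in> cauchy_seqs E"
    and l: "(\<lambda>n. vdist E (s n) (s' n)) \<longlonglongrightarrow> 0"
    using assms by (auto simp: null_rel_def)
  have "(\<lambda>n. \<kappa> * (cmod c * vdist E (s n) (s' n))) \<longlonglongrightarrow> 0"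
    by (intro tendsto_mult_right_zero tendsto_add_zero l)
  then have "(\<lambda>n. vdist E (vscale E c (s n)) (vscale E c (s' n))) \<longlonglongrightarrow> 0"
    by (rule vdist_squeeze) (intro vdist_scale add_closed scale_closed cauchy_seqsD c)+
  then show ?thesis using c scale_cauchy by (simp add: null_rel_def)
qed

lemma null_rel_refl: "s \<in> cauchy_seqs E \<Longrightarrow> (s, s) \<in> null_rel E"
  by (simp add: null_rel_def vdist_eq vnorm_zero)

lemma null_rel_sym:
  assumes "(s, t) \<in> null_rel E" shows "(t, s) \<in> null_rel E"
proof -
  have c: "s \<in> cauchy_seqs E" "t \<in> cauchy_seqs E" and l: "(\<lambda>n. vdist E (s n) (t n)) \<longlonglongrightarrow> 0"
    using assms by (auto simp: null_rel_def)
  have "(\<lambda>n. \<kappa> * vdist E (s n) (t n)) \<longlonglongrightarrow> 0"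
    by (intro tendsto_mult_right_zero tendsto_add_zero l)
  then have "(\<lambda>n. vdist E (t n) (s n)) \<longlonglongrightarrow> 0"
    by (rule vdist_squeeze) (intro vdist_commute add_closed scale_closed cauchy_seqsD c)+
  then show ?thesis using c by (simp add: null_rel_def)
qed

lemma null_rel_trans:
  assumes "(s, t) \<in> null_rel E" "(t, u) \<in> null_rel E" shows "(s, u) \<in> null_rel E"
proof -
  have c: "s \<in> cauchy_seqs E" "t \<in> cauchy_seqs E" "u \<in> cauchy_seqs E"
    and l: "(\<lambda>n. vdist E (s n) (t n)) \<longlonglongrightarrow> 0" "(\<lambda>n. vdist E (t n) (u n)) \<longlonglongrightarrow> 0"
    using assms by (auto simp: null_rel_def)
  have "(\<lambda>n. \<kappa> * (vdist E (s n) (t n) + vdist E (t n) (u n))) \<longlonglongrightarrow> 0"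
    by (intro tendsto_mult_right_zero tendsto_add_zero l)
  then have "(\<lambda>n. vdist E (s n) (u n)) \<longlonglongrightarrow> 0"
    by (rule vdist_squeeze) (intro vdist_triangle add_closed scale_closed cauchy_seqsD c)+
  then show ?thesis using c by (simp add: null_rel_def)
qed

lemma equiv_null_rel: "equiv (cauchy_seqs E) (null_rel E)"
proof (rule equivI)
  show "null_rel E \<subseteq> cauchy_seqs E \<times> cauchy_seqs E" by (auto simp: null_rel_def)
  show "refl_on (cauchy_seqs E) (null_rel E)" by (auto simp: refl_on_def null_rel_refl)
  show "sym (null_rel E)" by (auto simp: sym_def null_rel_sym)
  show "trans (null_rel E)" by (auto simp: trans_def intro: null_rel_trans)
qed

section \<open>Classes of Cauchy sequences: operations and quasi-norm\<close>

abbreviation cls :: "(nat \<Rightarrow> 'v) \<Rightarrow> (nat \<Rightarrow> 'v) set" where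
  "cls s \<equiv> null_rel E `` {s}"

lemma cls_in_completion: "s \<in> cauchy_seqs E \<Longrightarrow> cls s \<in> vecs (completion E)"
  by (simp add: completion_def quotientI)

lemma completionE:
  assumes "A \<in> vecs (completion E)"
  obtains s where "s \<in> cauchy_seqs E" "A = cls s"
  using assms by (auto simp: completion_def elim: quotientE)

lemma cls_eq_iff:
  "s \<in> cauchy_seqs E \<Longrightarrow> t \<in> cauchy_seqs E \<Longrightarrow> cls s = cls t \<longleftrightarrow> (s, t) \<in> null_rel E"
  using eq_equiv_class_iff[OF equiv_null_rel] by blast

text \<open>\<open>completion\<close> adds classes by a union over all representatives. By
  compatibility with \<open>null_rel\<close> every member of the union is the same class, and the
  index sets are nonempty, so the union collapses.\<close>

lemma vadd_cls:
  assumes "s \<in> cauchy_seqs E" "t \<in> cauchy_seqs E"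
  shows "vadd (completion E) (cls s) (cls t) = cls (\<lambda>n. vadd E (s n) (t n))"
proof -
  have "cls (\<lambda>n. vadd E (s' n) (t' n)) = cls (\<lambda>n. vadd E (s n) (t n))"
    if "(s, s') \<in> null_rel E" "(t, t') \<in> null_rel E" for s' t'
    using equiv_class_eq[OF equiv_null_rel null_rel_add[OF that]] by simp
  then have "(\<Union>s'\<in>cls s. \<Union>t'\<in>cls t. cls (\<lambda>n. vadd E (s' n) (t' n))) = (\<Union>s'\<in>cls s. \<Union>t'\<in>cls t. cls (\<lambda>n. vadd E (s n) (t n)))"
    by auto
  also have "\<dots> = cls (\<lambda>n. vadd E (s n) (t n))"
    using null_rel_refl[OF assms(1)] null_rel_refl[OF assms(2)] by auto
  finally show ?thesis by (simp add: completion_def)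
qed

lemma vscale_cls:
  assumes "s \<in> cauchy_seqs E"
  shows "vscale (completion E) c (cls s) = cls (\<lambda>n. vscale E c (s n))"
proof -
  have "cls (\<lambda>n. vscale E c (s' n)) = cls (\<lambda>n. vscale E c (s n))"
    if "(s, s') \<in> null_rel E" for s'
    using equiv_class_eq[OF equiv_null_rel null_rel_scale[OF that]] by simp
  then have "(\<Union>s'\<in>cls s. cls (\<lambda>n. vscale E c (s' n))) = (\<Union>s'\<in>cls s. cls (\<lambda>n. vscale E c (s n)))"
    by auto
  also have "\<dots> = cls (\<lambda>n. vscale E c (s n))"
    using null_rel_refl[OF assms(1)] by auto
  finally show ?thesis by (simp add: completion_def)
qed

lemma vnorm_completion:
  "vnorm (completion E) A = Inf {r. \<exists>s\<in>A. \<forall>\<^sub>F n in sequentially. vnorm E (s n) \<le> r}"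
  by (simp add: completion_def)

text \<open>An infimum of reals is a lower bound only for a set bounded below; 0 serves, since every
  admissible r dominates an actual value of the quasi-norm.\<close>

lemma vnorm_completion_le:
  assumes "A \<in> vecs (completion E)" "s \<in> A" "\<forall>\<^sub>F n in sequentially. vnorm E (s n) \<le> r"
  shows "vnorm (completion E) A \<le> r"
  unfolding vnorm_completion
proof (rule cInf_lower)
  show "bdd_below {r. \<exists>s\<in>A. \<forall>\<^sub>F n in sequentially. vnorm E (s n) \<le> r}"
  proof (rule bdd_belowI[of _ 0])
    fix r assume "r \<in> {r. \<exists>s\<in>A. \<forall>\<^sub>F n in sequentially. vnorm E (s n) \<le> r}"
    then obtain t where t: "t \<in> A" "\<forall>\<^sub>F n in sequentially. vnorm E (t n) \<le> r" by blast
    obtain u where "A = cls u" using completionE[OF assms(1)] by blast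
    then have tc: "t \<in> cauchy_seqs E" using t(1) by (auto simp: null_rel_def)
    obtain n where "vnorm E (t n) \<le> r" using t(2) by (meson eventually_happens' sequentially_bot)
    then show "0 \<le> r" using vnorm_nonneg[OF cauchy_seqsD[OF tc]] order_trans by blast
  qed
qed (use assms in blast)

text \<open>The pair \<open>s0\<close>, \<open>r0\<close> shows that the set of admissible bounds is
  nonempty, without which its infimum would say nothing.\<close>

lemma vnorm_completion_ge:
  assumes "s0 \<in> A" "\<forall>\<^sub>F n in sequentially. vnorm E (s0 n) \<le> r0"
    and "\<And>s r. s \<in> A \<Longrightarrow> \<forall>\<^sub>F n in sequentially. vnorm E (s n) \<le> r \<Longrightarrow> b \<le> r"
  shows "b \<le> vnorm (completion E) A"
  unfolding vnorm_completion by (rule cInf_greatest) (use assms in auto)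

lemma cauchy_bounded:
  assumes "s \<in> cauchy_seqs E"
  shows "\<exists>r. \<forall>\<^sub>F n in sequentially. vnorm E (s n) \<le> r"
proof -
  obtain M where M: "\<forall>m\<ge>M. \<forall>n\<ge>M. vdist E (s m) (s n) < 1"
    using assms unfolding cauchy_seqs_def using zero_less_one by blast
  have "vnorm E (s n) \<le> \<kappa> * (1 + vnorm E (s M))" if "n \<ge> M" for n
  proof -
    have "vnorm E (s n) \<le> \<kappa> * (vdist E (s n) (s M) + vnorm E (s M))"
      by (intro vnorm_le_vdist cauchy_seqsD assms)
    also have "\<dots> \<le> \<kappa> * (1 + vnorm E (s M))"
      using M that kappa_pos by (intro mult_left_mono) (auto simp: less_imp_le)
    finally show ?thesis .
  qed
  then show ?thesis by (auto simp: eventually_sequentially)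
qed

lemma vnorm_cls_const_le:
  assumes "x \<in> vecs E"
  shows "vnorm (completion E) (cls (\<lambda>n. x)) \<le> vnorm E x"
  using null_rel_refl[OF const_cauchy[OF assms]] by (intro vnorm_completion_le[of _ "\<lambda>n. x"] cls_in_completion const_cauchy assms) auto

text \<open>Another representative of the class approaches x, but returning from its quasi-norm to
  that of x costs one quasi-triangle inequality. For \<open>\<kappa>\<close> = 1 nothing is
  lost.\<close>

lemma vnorm_cls_const_ge:
  assumes "x \<in> vecs E"
  shows "vnorm E x \<le> \<kappa> * vnorm (completion E) (cls (\<lambda>n. x))"
proof -
  have "vnorm E x / \<kappa> \<le> vnorm (completion E) (cls (\<lambda>n. x))"
  proof (rule vnorm_completion_ge[of "\<lambda>n. x"])
    fix s r assume s: "s \<in> cls (\<lambda>n. x)" and r: "\<forall>\<^sub>F n in sequentially. vnorm E (s n) \<le> r"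
    have l: "(\<lambda>n. vdist E x (s n)) \<longlonglongrightarrow> 0" and c: "s \<in> cauchy_seqs E"
      using s by (auto simp: null_rel_def)
    have "(\<lambda>n. \<kappa> * (vdist E x (s n) + r)) \<longlonglongrightarrow> \<kappa> * (0 + r)"
      by (intro tendsto_intros l)
    moreover have "\<forall>\<^sub>F n in sequentially. vnorm E x \<le> \<kappa> * (vdist E x (s n) + r)"
      using r
    proof eventually_elim
      case (elim n)
      have "vnorm E x \<le> \<kappa> * (vdist E x (s n) + vnorm E (s n))"
        by (intro vnorm_le_vdist cauchy_seqsD assms c)
      also have "\<dots> \<le> \<kappa> * (vdist E x (s n) + r)"
        using elim kappa_pos by (intro mult_left_mono) auto
      finally show ?case .
    qed
    ultimately have "vnorm E x \<le> \<kappa> * (0 + r)"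
      by (rule tendsto_lowerbound) simp
    then show "vnorm E x / \<kappa> \<le> r" using kappa_pos by (simp add: field_simps)
  next
    show "(\<lambda>n. x) \<in> cls (\<lambda>n. x)" using null_rel_refl[OF const_cauchy[OF assms]] by auto
    show "\<forall>\<^sub>F n in sequentially. vnorm E x \<le> vnorm E x" by simp
  qed
  then show ?thesis using kappa_pos by (simp add: field_simps)
qed

end

section \<open>Convergent sequences and uniqueness of limits\<close>

context quasi_normed begin

text \<open>Both distances on the right point towards z, the form in which convergence to a limit is
  given; reversing one of them accounts for the second factor \<open>\<kappa>\<close>.\<close>

lemma vdist_triangle_mid:
  assumes "x \<in> vecs E" "y \<in> vecs E" "z \<in> vecs E"
  shows "vdist E x y \<le> \<kappa>\<^sup>2 * (vdist E x z + vdist E y z)"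
proof -
  have "vdist E x y \<le> \<kappa> * (vdist E x z + vdist E z y)"
    by (rule vdist_triangle) (use assms in auto)
  also have "\<dots> \<le> \<kappa> * (\<kappa> * vdist E x z + \<kappa> * vdist E y z)"
    using kappa_pos vdist_commute[OF assms(3,2)] mult_right_mono[OF kappa_ge_1 vdist_nonneg[OF assms(1,3)]]
    by (intro mult_left_mono add_mono) auto
  finally show ?thesis by (simp add: power2_eq_square algebra_simps)
qed

lemma convergent_imp_cauchy:
  assumes "\<And>n. s n \<in> vecs E" "y \<in> vecs E" "(\<lambda>n. vdist E (s n) y) \<longlonglongrightarrow> 0"
  shows "s \<in> cauchy_seqs E"
proof -
  have "\<exists>M. \<forall>m\<ge>M. \<forall>n\<ge>M. vdist E (s m) (s n) < \<epsilon>" if "\<epsilon> > 0" for \<epsilon>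
  proof -
    define d where "d = \<epsilon> / (2 * \<kappa>\<^sup>2)"
    have "d > 0" using that kappa_pos by (simp add: d_def)
    then obtain M where M: "\<And>n. n \<ge> M \<Longrightarrow> vdist E (s n) y < d"
      using order_tendstoD(2)[OF assms(3)] by (auto simp: eventually_sequentially)
    have "vdist E (s m) (s n) < \<epsilon>" if "m \<ge> M" "n \<ge> M" for m n
    proof -
      have "vdist E (s m) (s n) \<le> \<kappa>\<^sup>2 * (vdist E (s m) y + vdist E (s n) y)"
        by (intro vdist_triangle_mid assms)
      also have "\<dots> < \<kappa>\<^sup>2 * (d + d)"
        using M that kappa_pos by (intro mult_strict_left_mono add_strict_mono) auto
      also have "\<dots> = \<epsilon>" using kappa_pos by (simp add: d_def field_simps)
      finally show ?thesis .
    qed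
    then show ?thesis by blast
  qed
  then show ?thesis using assms(1) by (auto simp: cauchy_seqs_def)
qed

lemma vdist_same_limit:
  assumes "\<And>n. s n \<in> vecs E" "\<And>n. t n \<in> vecs E" "y \<in> vecs E"
    and "(\<lambda>n. vdist E (s n) y) \<longlonglongrightarrow> 0" "(\<lambda>n. vdist E (t n) y) \<longlonglongrightarrow> 0"
  shows "(\<lambda>n. vdist E (s n) (t n)) \<longlonglongrightarrow> 0"
  by (rule vdist_squeeze[where f = "\<lambda>n. \<kappa>\<^sup>2 * (vdist E (s n) y + vdist E (t n) y)"])
    (intro vdist_triangle_mid tendsto_mult_right_zero tendsto_add_zero assms)+

lemma vdist_limits:
  assumes "\<And>n. s n \<in> vecs E" "\<And>n. t n \<in> vecs E" "y \<in> vecs E" "z \<in> vecs E"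
    and "(\<lambda>n. vdist E (s n) y) \<longlonglongrightarrow> 0" "(\<lambda>n. vdist E (t n) z) \<longlonglongrightarrow> 0"
    and "(\<lambda>n. vdist E (s n) (t n)) \<longlonglongrightarrow> 0"
  shows "vdist E y z = 0"
proof -
  have "(\<lambda>n. \<kappa> * (\<kappa> * vdist E (s n) y + \<kappa> * (vdist E (s n) (t n) + vdist E (t n) z))) \<longlonglongrightarrow> 0"
    by (intro tendsto_mult_right_zero tendsto_add_zero assms(5-7))
  moreover have "vdist E y z \<le> \<kappa> * (\<kappa> * vdist E (s n) y + \<kappa> * (vdist E (s n) (t n) + vdist E (t n) z))" for n
  proof -
    have "vdist E y z \<le> \<kappa> * (vdist E y (s n) + vdist E (s n) z)"
      by (intro vdist_triangle assms)
    also have "\<dots> \<le> \<kappa> * (\<kappa> * vdist E (s n) y + \<kappa> * (vdist E (s n) (t n) + vdist E (t n) z))"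
      using kappa_pos by (intro mult_left_mono add_mono vdist_commute vdist_triangle assms) auto
    finally show ?thesis .
  qed
  ultimately have "vdist E y z \<le> 0"
    by (rule tendsto_lowerbound[OF _ always_eventually[OF allI]]) simp
  then show ?thesis using vdist_nonneg[OF assms(3,4)] by simp
qed

end

text \<open>A linear map with dense range in a complete space, bounded above and below, extends to
  the completion: a class goes to the limit of the images of any representative. Each bound loses a
  factor \<open>\<mu>\<close>, since \<open>vnorm F\<close> can jump at a limit.\<close>

theorem completion_isomorphic:
  fixes J :: "'v::ab_group_add \<Rightarrow> 'w::ab_group_add"
  assumes "quasi_normed E \<kappa>" "quasi_normed F \<mu>"
    and J_in: "\<And>x. x \<in> vecs E \<Longrightarrow> J x \<in> vecs F"
    and J_add: "\<And>x y. x \<in> vecs E \<Longrightarrow> y \<in> vecs E \<Longrightarrow> J (x + y) = J x + J y"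
    and J_scale: "\<And>c x. x \<in> vecs E \<Longrightarrow> J (vscale E c x) = vscale F c (J x)"
    and "0 < m" and lower: "\<And>x. x \<in> vecs E \<Longrightarrow> m * vnorm E x \<le> vnorm F (J x)"
    and "0 < M" and upper: "\<And>x. x \<in> vecs E \<Longrightarrow> vnorm F (J x) \<le> M * vnorm E x"
    and dense: "\<And>y \<epsilon>. y \<in> vecs F \<Longrightarrow> \<epsilon> > 0 \<Longrightarrow> \<exists>x\<in>vecs E. vdist F (J x) y < \<epsilon>"
    and complete: "\<And>s. s \<in> cauchy_seqs F \<Longrightarrow> \<exists>y\<in>vecs F. (\<lambda>n. vdist F (s n) y) \<longlonglongrightarrow> 0"
    and definite: "\<And>y. y \<in> vecs F \<Longrightarrow> vnorm F y = 0 \<Longrightarrow> y = 0"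
  shows "isomorphic (completion E) F"
proof -
  interpret E: quasi_normed E \<kappa> by fact
  interpret F: quasi_normed F \<mu> by fact
  have J_diff: "J (x - y) = J x - J y" if "x \<in> vecs E" "y \<in> vecs E" for x y
    using J_add[OF E.diff_closed[OF that] that(2)] by simp
  have dlower: "vdist E x y \<le> vdist F (J x) (J y) / m" if "x \<in> vecs E" "y \<in> vecs E" for x y
    using lower[OF E.diff_closed[OF that]] \<open>0 < m\<close> J_diff[OF that]
    by (simp add: E.vdist_eq F.vdist_eq field_simps)
  have dupper: "vdist F (J x) (J y) \<le> M * vdist E x y" if "x \<in> vecs E" "y \<in> vecs E" for x y
    using upper[OF E.diff_closed[OF that]] J_diff[OF that] by (simp add: E.vdist_eq F.vdist_eq)
  \<comment> \<open>The extension is treated as a relation between a Cauchy sequence and the limit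
    of its images; existence, uniqueness and compatibility with \<open>null_rel\<close> turn it into
    a map on classes.\<close>
  define lm where "lm s y \<longleftrightarrow> s \<in> cauchy_seqs E \<and> y \<in> vecs F \<and> (\<lambda>n. vdist F (J (s n)) y) \<longlonglongrightarrow> 0" for s y
  have lmD: "s n \<in> vecs E" "J (s n) \<in> vecs F" "y \<in> vecs F" "s \<in> cauchy_seqs E" "(\<lambda>n. vdist F (J (s n)) y) \<longlonglongrightarrow> 0"
    if "lm s y" for s y n using that E.cauchy_seqsD J_in by (auto simp: lm_def)
  have ex_lm: "\<exists>y. lm s y" if s: "s \<in> cauchy_seqs E" for s
  proof -
    have "(\<lambda>n. J (s n)) \<in> cauchy_seqs F"
    proof -
      have "\<exists>K. \<forall>p\<ge>K. \<forall>q\<ge>K. vdist F (J (s p)) (J (s q)) < \<epsilon>" if "\<epsilon> > 0" for \<epsilon>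
      proof -
        have "\<epsilon> / M > 0" using that \<open>0 < M\<close> by simp
        then obtain K where K: "\<forall>p\<ge>K. \<forall>q\<ge>K. vdist E (s p) (s q) < \<epsilon> / M"
          using s unfolding cauchy_seqs_def by blast
        have "vdist F (J (s p)) (J (s q)) < \<epsilon>" if "p \<ge> K" "q \<ge> K" for p q
        proof -
          have "vdist F (J (s p)) (J (s q)) \<le> M * vdist E (s p) (s q)"
            by (intro dupper E.cauchy_seqsD s)
          also have "\<dots> < M * (\<epsilon> / M)"
            using K that \<open>0 < M\<close> by (intro mult_strict_left_mono) auto
          finally show ?thesis using \<open>0 < M\<close> by simp
        qed
        then show ?thesis by blast
      qed
      then show ?thesis using E.cauchy_seqsD[OF s] J_in by (auto simp: cauchy_seqs_def)
    qed
    from complete[OF this] show ?thesis using s by (auto simp: lm_def)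
  qed
  have lm_null: "(s, t) \<in> null_rel E \<longleftrightarrow> y = z" if s: "lm s y" and t: "lm t z" for s t y z
  proof
    assume "(s, t) \<in> null_rel E"
    then have "(\<lambda>n. M * vdist E (s n) (t n)) \<longlonglongrightarrow> 0"
      by (intro tendsto_mult_right_zero) (simp add: null_rel_def)
    then have "(\<lambda>n. vdist F (J (s n)) (J (t n))) \<longlonglongrightarrow> 0"
      by (rule F.vdist_squeeze[OF _ lmD(2)[OF s] lmD(2)[OF t] dupper[OF lmD(1)[OF s] lmD(1)[OF t]]])
    then have "vdist F y z = 0"
      by (rule F.vdist_limits[OF lmD(2)[OF s] lmD(2)[OF t] lmD(3)[OF s] lmD(3)[OF t] lmD(5)[OF s] lmD(5)[OF t]])
    then have "vnorm F (y - z) = 0" by (simp add: F.vdist_eq)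
    then have "y - z = 0" by (intro definite F.diff_closed lmD[OF s] lmD[OF t])
    then show "y = z" by simp
  next
    assume "y = z"
    then have t': "lm t y" using t by simp
    have "(\<lambda>n. vdist F (J (s n)) (J (t n))) \<longlonglongrightarrow> 0"
      by (rule F.vdist_same_limit[OF lmD(2)[OF s] lmD(2)[OF t] lmD(3)[OF s] lmD(5)[OF s] lmD(5)[OF t']])
    then have "(\<lambda>n. vdist F (J (s n)) (J (t n)) / m) \<longlonglongrightarrow> 0"
      by (rule tendsto_divide_zero)
    then have "(\<lambda>n. vdist E (s n) (t n)) \<longlonglongrightarrow> 0"
      by (rule E.vdist_squeeze[OF _ lmD(1)[OF s] lmD(1)[OF t] dlower[OF lmD(1)[OF s] lmD(1)[OF t]]])
    then show "(s, t) \<in> null_rel E" using lmD[OF s] lmD[OF t] by (simp add: null_rel_def)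
  qed
  \<comment> \<open>The choice is harmless: by \<open>lm_null\<close> all representatives of a class
    have the same limit.\<close>
  define T where "T A = (SOME y. \<exists>s\<in>A. lm s y)" for A
  have T_eq: "T (E.cls s) = y" if s: "lm s y" for s y
  proof -
    have "\<exists>s'\<in>E.cls s. lm s' y" using s E.null_rel_refl[OF lmD(4)[OF s]] by blast
    then have "\<exists>s'\<in>E.cls s. lm s' (T (E.cls s))" unfolding T_def by (rule someI)
    then obtain s' where "(s, s') \<in> null_rel E" "lm s' (T (E.cls s))" by blast
    then show ?thesis using lm_null[OF s] by blast
  qed
  have lm_T: "lm s (T (E.cls s))" if "s \<in> cauchy_seqs E" for s
    using ex_lm[OF that] T_eq by blast
  have bij: "bij_betw T (vecs (completion E)) (vecs F)"
  proof (rule bij_betw_imageI)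
    show "inj_on T (vecs (completion E))"
    proof (rule inj_onI)
      fix A B assume A: "A \<in> vecs (completion E)" and B: "B \<in> vecs (completion E)" and eq: "T A = T B"
      obtain s where s: "s \<in> cauchy_seqs E" "A = E.cls s" using A by (rule E.completionE)
      obtain t where t: "t \<in> cauchy_seqs E" "B = E.cls t" using B by (rule E.completionE)
      show "A = B"
        using lm_null[OF lm_T[OF s(1)] lm_T[OF t(1)]] eq s t E.cls_eq_iff by simp
    qed
    show "T ` vecs (completion E) = vecs F"
    proof (intro equalityI subsetI)
      fix y assume "y \<in> T ` vecs (completion E)"
      then obtain A where A: "A \<in> vecs (completion E)" "y = T A" by blast
      obtain s where s: "s \<in> cauchy_seqs E" "A = E.cls s" using A(1) by (rule E.completionE)
      show "y \<in> vecs F" using lmD(3)[OF lm_T[OF s(1)]] A s by simp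
    next
      fix y assume y: "y \<in> vecs F"
      \<comment> \<open>Surjectivity: density gives approximants of y. Their images converge, hence
        are Cauchy, and the lower bound m pulls the Cauchy property back to E.\<close>
      have "\<exists>x. x \<in> vecs E \<and> vdist F (J x) y < inverse (real (Suc n))" for n
        using dense[OF y, of "inverse (real (Suc n))"] by auto
      then obtain s where s: "\<And>n. s n \<in> vecs E" "\<And>n. vdist F (J (s n)) y < inverse (real (Suc n))"
        by metis
      have lim: "(\<lambda>n. vdist F (J (s n)) y) \<longlonglongrightarrow> 0"
        by (rule F.vdist_squeeze[OF LIMSEQ_inverse_real_of_nat]) (intro less_imp_le s J_in y)+
      have Jc: "(\<lambda>n. J (s n)) \<in> cauchy_seqs F"
        by (rule F.convergent_imp_cauchy[OF _ y lim]) (intro J_in s)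
      have "\<exists>K. \<forall>p\<ge>K. \<forall>q\<ge>K. vdist E (s p) (s q) < \<epsilon>" if "\<epsilon> > 0" for \<epsilon>
      proof -
        have "\<epsilon> * m > 0" using that \<open>0 < m\<close> by simp
        then obtain K where K: "\<forall>p\<ge>K. \<forall>q\<ge>K. vdist F (J (s p)) (J (s q)) < \<epsilon> * m"
          using Jc unfolding cauchy_seqs_def by blast
        have "vdist E (s p) (s q) < \<epsilon>" if "p \<ge> K" "q \<ge> K" for p q
        proof -
          have "vdist E (s p) (s q) \<le> vdist F (J (s p)) (J (s q)) / m"
            by (intro dlower s)
          also have "\<dots> < \<epsilon> * m / m"
            using K that \<open>0 < m\<close> by (intro divide_strict_right_mono) auto
          finally show ?thesis using \<open>0 < m\<close> by simp
        qed
        then show ?thesis by blast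
      qed
      then have "s \<in> cauchy_seqs E" using s by (simp add: cauchy_seqs_def)
      then have "lm s y" using y lim by (simp add: lm_def)
      then show "y \<in> T ` vecs (completion E)"
        using T_eq E.cls_in_completion[OF \<open>s \<in> cauchy_seqs E\<close>] by force
    qed
  qed
  have add: "T (vadd (completion E) A B) = vadd F (T A) (T B)"
    if A: "A \<in> vecs (completion E)" and B: "B \<in> vecs (completion E)" for A B
  proof -
    obtain s where s: "s \<in> cauchy_seqs E" "A = E.cls s" using A by (rule E.completionE)
    obtain t where t: "t \<in> cauchy_seqs E" "B = E.cls t" using B by (rule E.completionE)
    note ls = lm_T[OF s(1)] and lt = lm_T[OF t(1)]
    have "(\<lambda>n. vdist F (J (vadd E (s n) (t n))) (T A + T B)) \<longlonglongrightarrow> 0"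
    proof (rule F.vdist_squeeze)
      show "(\<lambda>n. \<mu> * (vdist F (J (s n)) (T A) + vdist F (J (t n)) (T B))) \<longlonglongrightarrow> 0"
        unfolding s t by (intro tendsto_mult_right_zero tendsto_add_zero lmD(5)[OF ls] lmD(5)[OF lt])
      show "vdist F (J (vadd E (s n) (t n))) (T A + T B) \<le> \<mu> * (vdist F (J (s n)) (T A) + vdist F (J (t n)) (T B))" for n
        unfolding s t E.vadd_eq J_add[OF lmD(1)[OF ls] lmD(1)[OF lt]]
        by (intro F.vdist_add lmD[OF ls] lmD[OF lt])
      show "J (vadd E (s n) (t n)) \<in> vecs F" for n
        unfolding E.vadd_eq by (intro J_in E.add_closed lmD(1)[OF ls] lmD(1)[OF lt])
      show "T A + T B \<in> vecs F"
        unfolding s t by (intro F.add_closed lmD(3)[OF ls] lmD(3)[OF lt])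
    qed
    then have "lm (\<lambda>n. vadd E (s n) (t n)) (T A + T B)"
      using E.add_cauchy[OF s(1) t(1)] lmD(3)[OF ls] lmD(3)[OF lt] by (simp add: lm_def s t F.add_closed)
    from T_eq[OF this] show ?thesis by (simp add: s t E.vadd_cls F.vadd_eq)
  qed
  have scale: "T (vscale (completion E) c A) = vscale F c (T A)"
    if A: "A \<in> vecs (completion E)" for A c
  proof -
    obtain s where s: "s \<in> cauchy_seqs E" "A = E.cls s" using A by (rule E.completionE)
    note ls = lm_T[OF s(1)]
    have "(\<lambda>n. vdist F (J (vscale E c (s n))) (vscale F c (T A))) \<longlonglongrightarrow> 0"
    proof (rule F.vdist_squeeze)
      show "(\<lambda>n. \<mu> * (cmod c * vdist F (J (s n)) (T A))) \<longlonglongrightarrow> 0"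
        unfolding s by (intro tendsto_mult_right_zero lmD(5)[OF ls])
      show "vdist F (J (vscale E c (s n))) (vscale F c (T A)) \<le> \<mu> * (cmod c * vdist F (J (s n)) (T A))" for n
        unfolding s J_scale[OF lmD(1)[OF ls]] by (intro F.vdist_scale lmD[OF ls])
      show "J (vscale E c (s n)) \<in> vecs F" for n
        by (intro J_in E.scale_closed lmD(1)[OF ls])
      show "vscale F c (T A) \<in> vecs F"
        unfolding s by (intro F.scale_closed lmD(3)[OF ls])
    qed
    then have "lm (\<lambda>n. vscale E c (s n)) (vscale F c (T A))"
      using E.scale_cauchy[OF s(1)] lmD(3)[OF ls] by (simp add: lm_def s F.scale_closed)
    from T_eq[OF this] show ?thesis by (simp add: s E.vscale_cls)
  qed
  have norm_lower: "vnorm F (T A) \<le> \<mu> * M * vnorm (completion E) A"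
    if A: "A \<in> vecs (completion E)" for A
  proof -
    obtain s where s: "s \<in> cauchy_seqs E" "A = E.cls s" using A by (rule E.completionE)
    obtain r0 where r0: "\<forall>\<^sub>F n in sequentially. vnorm E (s n) \<le> r0"
      using E.cauchy_bounded[OF s(1)] by blast
    \<comment> \<open>The quasi-norm of A is an infimum over representatives and over their eventual
      bounds, so the estimate is proved for every such pair t, r.\<close>
    have "vnorm F (T A) / (\<mu> * M) \<le> vnorm (completion E) A"
    proof (rule E.vnorm_completion_ge[OF _ r0])
      show "s \<in> A" using s E.null_rel_refl by blast
      fix t r assume t: "t \<in> A" and r: "\<forall>\<^sub>F n in sequentially. vnorm E (t n) \<le> r"
      have "(s, t) \<in> null_rel E" using t s by simp
      then have tc: "t \<in> cauchy_seqs E" and "A = E.cls t"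
        using s E.cls_eq_iff by (auto simp: null_rel_def)
      then have lt: "lm t (T A)" using lm_T by simp
      have "(\<lambda>n. \<mu> * (\<mu> * vdist F (J (t n)) (T A) + M * r)) \<longlonglongrightarrow> \<mu> * (\<mu> * 0 + M * r)"
        by (intro tendsto_intros lmD[OF lt])
      moreover have "\<forall>\<^sub>F n in sequentially. vnorm F (T A) \<le> \<mu> * (\<mu> * vdist F (J (t n)) (T A) + M * r)"
        using r
      proof eventually_elim
        case (elim n)
        have "vnorm F (T A) \<le> \<mu> * (vdist F (T A) (J (t n)) + vnorm F (J (t n)))"
          by (intro F.vnorm_le_vdist lmD[OF lt])
        also have "vnorm F (J (t n)) \<le> M * vnorm E (t n)" by (intro upper lmD[OF lt])
        also have "\<dots> \<le> M * r" using elim \<open>0 < M\<close> by simp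
        also have "vdist F (T A) (J (t n)) \<le> \<mu> * vdist F (J (t n)) (T A)"
          by (intro F.vdist_commute lmD[OF lt])
        finally show ?case using F.kappa_pos by simp
      qed
      ultimately have "vnorm F (T A) \<le> \<mu> * (\<mu> * 0 + M * r)"
        by (rule tendsto_lowerbound) simp
      then show "vnorm F (T A) / (\<mu> * M) \<le> r"
        using F.kappa_pos \<open>0 < M\<close> by (simp add: field_simps)
    qed
    then show ?thesis using F.kappa_pos \<open>0 < M\<close> by (simp add: field_simps)
  qed
  have norm_upper: "(m / \<mu>) * vnorm (completion E) A \<le> vnorm F (T A)"
    if A: "A \<in> vecs (completion E)" for A
  proof -
    obtain s where s: "s \<in> cauchy_seqs E" "A = E.cls s" using A by (rule E.completionE)
    note ls = lm_T[OF s(1), folded s(2)]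
    \<comment> \<open>The slack \<open>\<epsilon>\<close> absorbs the distance from
      \<open>J (s n)\<close> to its limit, which becomes small only eventually.\<close>
    have "vnorm (completion E) A \<le> \<mu> / m * vnorm F (T A) + \<epsilon>" if "\<epsilon> > 0" for \<epsilon>
    proof (rule E.vnorm_completion_le[OF A])
      show "s \<in> A" using s E.null_rel_refl by blast
      have "(\<lambda>n. \<mu> / m * vdist F (J (s n)) (T A)) \<longlonglongrightarrow> 0"
        by (intro tendsto_mult_right_zero lmD[OF ls])
      from order_tendstoD(2)[OF this that]
      show "\<forall>\<^sub>F n in sequentially. vnorm E (s n) \<le> \<mu> / m * vnorm F (T A) + \<epsilon>"
      proof eventually_elim
        case (elim n)
        have "m * vnorm E (s n) \<le> vnorm F (J (s n))" by (intro lower lmD[OF ls])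
        also have "\<dots> \<le> \<mu> * (vdist F (J (s n)) (T A) + vnorm F (T A))"
          by (intro F.vnorm_le_vdist lmD[OF ls])
        finally have "vnorm E (s n) \<le> \<mu> / m * vdist F (J (s n)) (T A) + \<mu> / m * vnorm F (T A)"
          using \<open>0 < m\<close> by (simp add: field_simps)
        then show ?case using elim by simp
      qed
    qed
    then have "vnorm (completion E) A \<le> \<mu> / m * vnorm F (T A)" by (rule field_le_epsilon)
    then show ?thesis using F.kappa_pos \<open>0 < m\<close> by (simp add: field_simps)
  qed
  show ?thesis unfolding isomorphic_def
  proof (intro exI conjI ballI allI)
    show "0 < m / \<mu>" using F.kappa_pos \<open>0 < m\<close> by simp
    show "0 < \<mu> * M" using F.kappa_pos \<open>0 < M\<close> by simp
  qed (use bij add scale norm_lower norm_upper in auto)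
qed

section \<open>The Kalton-Peck space\<close>

lemma ell2I:
  assumes "\<And>n. L2_set (\<lambda>j. cmod (x j)) {..<n} \<le> C"
  shows "x \<in> ell2" "norm2 x \<le> C"
proof -
  have C: "0 \<le> C" using assms[of 0] by simp
  have b: "(\<Sum>j<n. (cmod (x j))\<^sup>2) \<le> C\<^sup>2" for n
    using assms[of n] unfolding L2_set_def by (rule sqrt_le_D)
  have s: "summable (\<lambda>j. (cmod (x j))\<^sup>2)"
    by (rule summableI_nonneg_bounded[of _ "C\<^sup>2"]) (use b in auto)
  then show "x \<in> ell2" by (simp add: ell2_def)
  have "(\<Sum>j. (cmod (x j))\<^sup>2) \<le> C\<^sup>2"
    by (rule suminf_le_const[OF s b])
  then show "norm2 x \<le> C" unfolding norm2_def using C by (simp add: real_le_lsqrt)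
qed

lemma L2_set_le_norm2:
  assumes "x \<in> ell2" "finite A"
  shows "L2_set (\<lambda>j. cmod (x j)) A \<le> norm2 x"
  using assms unfolding norm2_def L2_set_def ell2_def
  by (auto intro!: sum_le_suminf)

lemma norm2_nonneg: "x \<in> ell2 \<Longrightarrow> 0 \<le> norm2 x"
  using L2_set_le_norm2[of x "{}"] by simp

lemma cmod_le_norm2: "x \<in> ell2 \<Longrightarrow> cmod (x j) \<le> norm2 x"
  using L2_set_le_norm2[of x "{j}"] by simp

lemma norm2_pos: "x \<in> ell2 \<Longrightarrow> x j \<noteq> 0 \<Longrightarrow> 0 < norm2 x"
  using cmod_le_norm2[of x j] less_le_trans[of 0 "cmod (x j)"] by simp

lemma norm2_eq_0_iff: "x \<in> ell2 \<Longrightarrow> norm2 x = 0 \<longleftrightarrow> x = 0"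
  using cmod_le_norm2[of x] by (auto simp: norm2_def)

lemma norm2_zero [simp]: "norm2 0 = 0"
  by (simp add: norm2_def)

lemma zero_in_ell2 [simp]: "0 \<in> ell2"
  by (simp add: ell2_def)

lemma norm2_mono:
  assumes "y \<in> ell2" "\<And>j. cmod (x j) \<le> C * cmod (y j)" "0 \<le> C"
  shows "x \<in> ell2" "norm2 x \<le> C * norm2 y"
proof -
  have "L2_set (\<lambda>j. cmod (x j)) {..<n} \<le> C * norm2 y" for n
  proof -
    have "L2_set (\<lambda>j. cmod (x j)) {..<n} \<le> L2_set (\<lambda>j. C * cmod (y j)) {..<n}"
      by (intro L2_set_mono assms) auto
    also have "\<dots> = C * L2_set (\<lambda>j. cmod (y j)) {..<n}"
      by (simp add: L2_set_right_distrib assms)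
    also have "\<dots> \<le> C * norm2 y"
      using assms by (intro mult_left_mono L2_set_le_norm2) auto
    finally show ?thesis .
  qed
  from ell2I[OF this] show "x \<in> ell2" "norm2 x \<le> C * norm2 y" .
qed

lemma norm2_add:
  assumes "x \<in> ell2" "y \<in> ell2"
  shows "x + y \<in> ell2" "norm2 (x + y) \<le> norm2 x + norm2 y"
proof -
  have "L2_set (\<lambda>j. cmod ((x + y) j)) {..<n} \<le> norm2 x + norm2 y" for n
  proof -
    have "L2_set (\<lambda>j. cmod ((x + y) j)) {..<n} \<le> L2_set (\<lambda>j. cmod (x j) + cmod (y j)) {..<n}"
      by (intro L2_set_mono) (auto simp: norm_triangle_ineq)
    also have "\<dots> \<le> L2_set (\<lambda>j. cmod (x j)) {..<n} + L2_set (\<lambda>j. cmod (y j)) {..<n}"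
      by (rule L2_set_triangle_ineq)
    also have "\<dots> \<le> norm2 x + norm2 y"
      using assms by (intro add_mono L2_set_le_norm2) auto
    finally show ?thesis .
  qed
  from ell2I[OF this] show "x + y \<in> ell2" "norm2 (x + y) \<le> norm2 x + norm2 y" .
qed

lemma norm2_scale:
  assumes "x \<in> ell2"
  shows "(\<lambda>j. c * x j) \<in> ell2" "norm2 (\<lambda>j. c * x j) = cmod c * norm2 x"
  using assms unfolding ell2_def norm2_def
  by (auto simp: norm_mult power_mult_distrib suminf_mult real_sqrt_mult)

lemma norm2_minus:
  assumes "x \<in> ell2"
  shows "- x \<in> ell2" "norm2 (- x) = norm2 x"
  using assms by (auto simp: ell2_def norm2_def)

lemma norm2_diff:
  assumes "x \<in> ell2" "y \<in> ell2"
  shows "x - y \<in> ell2" "norm2 (x - y) \<le> norm2 x + norm2 y"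
  using norm2_add[OF assms(1) norm2_minus(1)[OF assms(2)]] norm2_minus(2)[OF assms(2)] by auto

lemma norm2_finite_supp:
  assumes "finite A" "supp x \<subseteq> A"
  shows "x \<in> ell2" "norm2 x = L2_set (\<lambda>j. cmod (x j)) A"
proof -
  have z: "j \<notin> A \<Longrightarrow> (cmod (x j))\<^sup>2 = 0" for j using assms by (auto simp: supp_def)
  show "x \<in> ell2" unfolding ell2_def using summable_finite[OF assms(1) z] by simp
  show "norm2 x = L2_set (\<lambda>j. cmod (x j)) A"
    unfolding norm2_def L2_set_def using suminf_finite[OF assms(1) z] by simp
qed

lemma c00_subset_ell2: "c00 \<subseteq> ell2"
  using norm2_finite_supp(1) by (auto simp: c00_def)

text \<open>Fatou's lemma: each finite section of the norm is continuous under coordinatewise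
  convergence, so a uniform bound passes to the limit although convergence in norm is
  unknown.\<close>

lemma norm2_fatou:
  assumes "\<And>j. (\<lambda>m. z m j) \<longlonglongrightarrow> x j"
    and "\<forall>\<^sub>F m in sequentially. z m \<in> ell2 \<and> norm2 (z m) \<le> C"
  shows "x \<in> ell2" "norm2 x \<le> C"
proof -
  have "L2_set (\<lambda>j. cmod (x j)) {..<n} \<le> C" for n
  proof (rule tendsto_upperbound)
    show "(\<lambda>m. L2_set (\<lambda>j. cmod (z m j)) {..<n}) \<longlonglongrightarrow> L2_set (\<lambda>j. cmod (x j)) {..<n}"
      unfolding L2_set_def by (intro tendsto_intros assms)
    show "\<forall>\<^sub>F m in sequentially. L2_set (\<lambda>j. cmod (z m j)) {..<n} \<le> C"
      using assms(2) by eventually_elim (blast intro: order_trans[OF L2_set_le_norm2[OF _ finite_lessThan]])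
  qed simp
  from ell2I[OF this] show "x \<in> ell2" "norm2 x \<le> C" .
qed

lemma norm2_tail_tendsto_0:
  assumes "x \<in> ell2"
  shows "(\<lambda>n. norm2 (\<lambda>j. if j < n then 0 else x j)) \<longlonglongrightarrow> 0"
proof -
  have s: "summable (\<lambda>j. (cmod (x j))\<^sup>2)" using assms by (simp add: ell2_def)
  have "(\<lambda>n. sqrt (\<Sum>j. (cmod (x (j + n)))\<^sup>2)) \<longlonglongrightarrow> sqrt 0"
    by (intro tendsto_real_sqrt suminf_exist_split2 s)
  moreover have "(\<Sum>j. (cmod (x (j + n)))\<^sup>2) = (\<Sum>j. (cmod (if j < n then 0 else x j))\<^sup>2)" for n
  proof -
    have "summable (\<lambda>j. (cmod (if j < n then 0 else x j))\<^sup>2)"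
      by (rule summable_comparison_test'[OF s, of 0]) auto
    from suminf_split_initial_segment[OF this, of n] show ?thesis by simp
  qed
  ultimately show ?thesis by (simp add: norm2_def)
qed

section \<open>The Kalton-Peck map: near additivity and continuity of coordinates\<close>

lemma abs_ln_scaled_le:
  fixes a M :: real
  assumes "0 \<le> a" "a \<le> M"
  shows "a * \<bar>ln (a / M)\<bar> \<le> M"
proof (cases "a = 0")
  case False
  then have p: "0 < a" "0 < M" using assms by auto
  have "ln (a / M) \<le> 0" using p assms by simp
  then have "\<bar>ln (a / M)\<bar> = ln (M / a)" using p by (simp add: ln_div)
  also have "\<dots> \<le> M / a - 1" using p by (intro ln_le_minus_one) simp
  finally have "a * \<bar>ln (a / M)\<bar> \<le> a * (M / a - 1)" using p by (intro mult_left_mono) auto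
  also have "\<dots> \<le> M" using p by (simp add: algebra_simps)
  finally show ?thesis .
qed (use assms in simp)

text \<open>The map z \<mapsto> z ln m is linear, so dividing every argument of ln by m = |s| + |t|
  leaves the expression unchanged. Each of the three terms is then z ln(|z| / m) with |z| \<le> m,
  of modulus at most m.\<close>

lemma xlnx_quasi_additive:
  fixes s t :: complex
  shows "cmod ((s + t) * ln (cmod (s + t)) - s * ln (cmod s) - t * ln (cmod t)) \<le> 3 * (cmod s + cmod t)"
proof (cases "cmod s + cmod t = 0")
  case True
  then have "s = 0" "t = 0" by (auto simp: add_nonneg_eq_0_iff)
  then show ?thesis by simp
next
  case False
  define m where "m = cmod s + cmod t"
  have m: "m > 0" using False by (simp add: m_def add_nonneg_pos less_le)
  have e: "z * ln (cmod z) = z * ln (cmod z / m) + z * ln m" for z :: complex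
    using m by (cases "z = 0") (simp_all add: ln_div algebra_simps flip: of_real_add)
  have b: "cmod (z * ln (cmod z / m)) \<le> m" if "cmod z \<le> m" for z
    using abs_ln_scaled_le[OF norm_ge_zero that] by (simp add: norm_mult)
  have "cmod ((s + t) * ln (cmod (s + t)) - s * ln (cmod s) - t * ln (cmod t))
    = cmod ((s + t) * ln (cmod (s + t) / m) - s * ln (cmod s / m) - t * ln (cmod t / m))"
    unfolding e[of "s + t"] e[of s] e[of t] by (simp add: algebra_simps)
  also have "\<dots> \<le> m + m + m"
    using b[of "s + t"] b[of s] b[of t] norm_triangle_ineq[of s t]
    by (intro order_trans[OF norm_triangle_ineq4] add_mono) (auto simp: m_def)
  finally show ?thesis by (simp add: m_def)
qed

abbreviation KP :: "(nat \<Rightarrow> complex) \<Rightarrow> nat \<Rightarrow> complex" where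
  "KP \<equiv> kalton_peck_map"

text \<open>A scale M common to several vectors replaces their individual norms: the first term
  carries the nonlinearity in the coordinate, the second is linear in y, and the third is a multiple
  of y that \<open>abs_ln_scaled_le\<close> controls once norm2 y \<le> M.\<close>

lemma kalton_peck_map_eq:
  fixes y :: "nat \<Rightarrow> complex"
  assumes "y \<in> ell2" "0 < M"
  shows "KP y j = y j * of_real (ln (cmod (y j))) - y j * of_real (ln M) - y j * of_real (ln (norm2 y / M))"
proof (cases "y j = 0")
  case False
  then have "norm2 y > 0" using norm2_pos assms(1) by blast
  then show ?thesis using assms(2) False by (simp add: kalton_peck_map_def ln_div algebra_simps)
qed (simp add: kalton_peck_map_def)

lemma kalton_peck_map_zero [simp]: "KP 0 = 0"
  by (simp add: kalton_peck_map_def fun_eq_iff)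

lemma kalton_peck_map_quasi_additive:
  assumes x: "x \<in> ell2" and y: "y \<in> ell2"
  shows "KP (x + y) - KP x - KP y \<in> ell2"
    and "norm2 (KP (x + y) - KP x - KP y) \<le> 6 * (norm2 x + norm2 y)"
proof -
  define M where "M = norm2 x + norm2 y"
  have "KP (x + y) - KP x - KP y \<in> ell2 \<and> norm2 (KP (x + y) - KP x - KP y) \<le> 6 * M"
  proof (cases "M = 0")
    case True
    then have "norm2 x = 0" "norm2 y = 0"
      using norm2_nonneg[OF x] norm2_nonneg[OF y] by (auto simp: M_def)
    then have "x = 0" "y = 0" using norm2_eq_0_iff x y by auto
    then show ?thesis using True by simp
  next
    case False
    then have M: "M > 0" using norm2_nonneg[OF x] norm2_nonneg[OF y] by (auto simp: M_def)
    \<comment> \<open>The terms with ln M cancel by linearity. There remain D, of norm at most 3 M,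
      and three normalization terms R of norm at most M each, which gives 6 M.\<close>
    define D where "D = (\<lambda>j. (x + y) j * ln (cmod ((x + y) j)) - x j * ln (cmod (x j)) - y j * ln (cmod (y j)))"
    define R where "R z = (\<lambda>j. of_real (ln (norm2 z / M)) * z j)" for z :: "nat \<Rightarrow> complex"
    have xy: "x + y \<in> ell2" "norm2 (x + y) \<le> M" using norm2_add[OF x y] by (auto simp: M_def)
    have R: "R z \<in> ell2" "norm2 (R z) \<le> M" if "z \<in> ell2" "norm2 z \<le> M" for z
      using norm2_scale[OF that(1), of "of_real (ln (norm2 z / M))"]
        abs_ln_scaled_le[OF norm2_nonneg[OF that(1)] that(2)]
      by (simp_all only: R_def norm_of_real) (simp add: mult.commute)
    define m :: "nat \<Rightarrow> complex" where "m = (\<lambda>j. of_real (cmod (x j))) + (\<lambda>j. of_real (cmod (y j)))"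
    have a: "(\<lambda>j. complex_of_real (cmod (z j))) \<in> ell2" "norm2 (\<lambda>j. complex_of_real (cmod (z j))) = norm2 z"
      if "z \<in> ell2" for z using that by (auto simp: ell2_def norm2_def)
    have m: "m \<in> ell2" "norm2 m \<le> M"
      using norm2_add[OF a(1)[OF x] a(1)[OF y]] a(2)[OF x] a(2)[OF y] by (auto simp: m_def M_def)
    have Dm: "cmod (D j) \<le> 3 * cmod (m j)" for j
      using xlnx_quasi_additive[of "x j" "y j"] by (simp add: D_def m_def flip: of_real_add)
    note D = norm2_mono[of m D 3, OF m(1) Dm]
    have eq: "KP (x + y) - KP x - KP y = D - R (x + y) + (R x + R y)"
      by (simp add: fun_eq_iff kalton_peck_map_eq[OF xy(1) M] kalton_peck_map_eq[OF x M]
          kalton_peck_map_eq[OF y M] D_def R_def algebra_simps)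
    have Rx: "R x \<in> ell2" "norm2 (R x) \<le> M" using R[OF x] norm2_nonneg[OF y] by (auto simp: M_def)
    have Ry: "R y \<in> ell2" "norm2 (R y) \<le> M" using R[OF y] norm2_nonneg[OF x] by (auto simp: M_def)
    note 1 = norm2_diff[OF D(1)[OF zero_le_numeral] R(1)[OF xy]]
    note 2 = norm2_add[OF Rx(1) Ry(1)]
    note 3 = norm2_add[OF 1(1) 2(1)]
    show ?thesis unfolding eq
      using 3 1(2) 2(2) D(2)[OF zero_le_numeral] m(2) R(2)[OF xy] Rx(2) Ry(2) by auto
  qed
  then show "KP (x + y) - KP x - KP y \<in> ell2"
    and "norm2 (KP (x + y) - KP x - KP y) \<le> 6 * (norm2 x + norm2 y)" by (auto simp: M_def)
qed

lemma kalton_peck_map_scale: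
  assumes "y \<in> ell2"
  shows "KP (\<lambda>j. c * y j) = (\<lambda>j. c * KP y j)"
  using assms by (cases "c = 0") (auto simp: kalton_peck_map_def norm2_scale norm_mult fun_eq_iff)

text \<open>\<open>KP y\<close> may leave \<open>ell2\<close>, but its coordinates are bounded by
  the norm of y. This makes the coordinates of the first component bounded functionals on
  \<open>Z2\<close>.\<close>

lemma cmod_kalton_peck_map_le:
  assumes "y \<in> ell2"
  shows "cmod (KP y j) \<le> norm2 y"
  using abs_ln_scaled_le[OF norm_ge_zero cmod_le_norm2[OF assms], of j]
  by (simp add: kalton_peck_map_def norm_mult)

text \<open>Unlike the bound M of \<open>abs_ln_scaled_le\<close>, this one tends to 0 with a. It
  results from applying that bound to the geometric mean b of a and M, because ln(a / M) = 2 ln(b /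
  M).\<close>

lemma abs_ln_scaled_le_sqrt:
  fixes a M :: real
  assumes "0 \<le> a" "a \<le> M"
  shows "a * \<bar>ln (a / M)\<bar> \<le> 2 * sqrt (a * M)"
proof (cases "a = 0")
  case False
  then have p: "0 < a" "0 < M" using assms by auto
  define b where "b = sqrt (a * M)"
  have b: "0 < b" "b \<le> M" "b * b = a * M"
    using p assms real_sqrt_le_mono[of "a * M" "M * M"] by (auto simp: b_def)
  have "a / M = (b / M)^2" using b p by (simp add: power2_eq_square field_simps)
  then have ln: "ln (a / M) = 2 * ln (b / M)" using b p by (simp add: ln_realpow)
  have "M * (a * \<bar>ln (a / M)\<bar>) = 2 * b * (b * \<bar>ln (b / M)\<bar>)"
    unfolding ln using b(3) by (simp add: abs_mult algebra_simps)
  also have "\<dots> \<le> 2 * b * M"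
    using b by (intro mult_left_mono abs_ln_scaled_le) auto
  finally show ?thesis using p by (simp add: b_def mult.commute[of M])
qed simp

lemma isCont_xlnx: "isCont (\<lambda>z::complex. z * ln (cmod z)) z"
proof (cases "z = 0")
  case True
  have "((\<lambda>w::complex. w * ln (cmod w)) \<longlongrightarrow> 0) (at 0)"
  proof (rule Lim_null_comparison)
    show "((\<lambda>w::complex. 2 * sqrt (cmod w)) \<longlongrightarrow> 0) (at 0)"
      by (rule tendsto_eq_intros refl | simp)+
    have "\<forall>\<^sub>F w::complex in at 0. dist w 0 < 1"
      by (rule eventually_at_ball'[of 1 0 UNIV, simplified, THEN eventually_mono]) (auto simp: dist_commute)
    then show "\<forall>\<^sub>F w::complex in at 0. cmod (w * ln (cmod w)) \<le> 2 * sqrt (cmod w)"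
    proof eventually_elim
      case (elim w)
      then show ?case using abs_ln_scaled_le_sqrt[of "cmod w" 1] by (simp add: norm_mult)
    qed
  qed
  then show ?thesis by (simp add: True isCont_def)
next
  case False
  then show ?thesis by (intro continuous_intros) auto
qed

text \<open>This is the convergence that Fatou's lemma requires when completeness of
  \<open>Z2\<close> is proved. The limit 0 is separate, since the logarithm of the norm is not
  continuous there; the bound of the coordinates by the norm takes over.\<close>

lemma kalton_peck_map_continuous:
  assumes "\<And>m. w m \<in> ell2" "z \<in> ell2" "(\<lambda>m. norm2 (w m - z)) \<longlonglongrightarrow> 0"
  shows "(\<lambda>m. KP (w m) j) \<longlonglongrightarrow> KP z j"
proof (cases "norm2 z = 0")
  case True
  then have z: "z = 0" using norm2_eq_0_iff assms by blast
  have "(\<lambda>m. KP (w m) j) \<longlonglongrightarrow> 0"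
    by (rule Lim_null_comparison[OF _ assms(3)]) (use z cmod_kalton_peck_map_le assms(1) in auto)
  then show ?thesis by (simp add: z)
next
  case False
  have d: "w m - z \<in> ell2" for m by (intro norm2_diff assms)
  have "(\<lambda>m. (w m - z) j) \<longlonglongrightarrow> 0"
    by (rule Lim_null_comparison[OF _ assms(3)]) (use cmod_le_norm2[OF d] in auto)
  then have wj: "(\<lambda>m. w m j) \<longlonglongrightarrow> z j" by (simp add: LIM_zero_iff)
  have "\<bar>norm2 (w m) - norm2 z\<bar> \<le> norm2 (w m - z)" for m
    using norm2_add(2)[OF d assms(2), of m] norm2_diff(2)[OF assms(1) d, of m m] by simp
  then have "(\<lambda>m. norm2 (w m) - norm2 z) \<longlonglongrightarrow> 0"
    by (intro Lim_null_comparison[OF _ assms(3)]) auto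
  then have nw: "(\<lambda>m. norm2 (w m)) \<longlonglongrightarrow> norm2 z" by (simp add: LIM_zero_iff)
  have eq: "KP y j = y j * ln (cmod (y j)) - y j * ln (norm2 y)" if "y \<in> ell2" for y :: "nat \<Rightarrow> complex"
    using kalton_peck_map_eq[OF that zero_less_one, of j] by simp
  have "(\<lambda>m. w m j * ln (cmod (w m j))) \<longlonglongrightarrow> z j * ln (cmod (z j))"
    by (rule isCont_tendsto_compose[OF isCont_xlnx wj])
  then show ?thesis
    unfolding eq[OF assms(1)] eq[OF assms(2)]
    by (rule tendsto_diff[OF _ tendsto_mult[OF wj tendsto_of_real[OF tendsto_ln[OF nw False]]]])
qed

section \<open>Z_2 as a complete quasi-normed space with a dense subspace of finitely supported
  pairs\<close>

lemma vadd_seq_pair_space: "vadd (seq_pair_space S N) p q = p + q"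
  by (simp add: seq_pair_space_def split_beta prod_eq_iff fun_eq_iff)

lemma vscale_seq_pair_space: "vscale (seq_pair_space S N) c p = (\<lambda>j. c * fst p j, \<lambda>j. c * snd p j)"
  by (simp add: seq_pair_space_def split_beta)

lemma vecs_Z2: "vecs Z2 = {(x, y). y \<in> ell2 \<and> x - KP y \<in> ell2}"
  by (simp add: Z2_def twisted_sum_def seq_pair_space_def fun_diff_def)

lemma vnorm_Z2: "vnorm Z2 (x, y) = norm2 (x - KP y) + norm2 y"
  by (simp add: Z2_def twisted_sum_def seq_pair_space_def fun_diff_def)

text \<open>The constant 7 is 6 from the near additivity of \<open>KP\<close> plus 1 from the
  triangle inequality in the second component.\<close>

interpretation Z2: quasi_normed Z2 7
proof
  fix c and p q :: "(nat \<Rightarrow> complex) \<times> (nat \<Rightarrow> complex)"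
  show "vadd Z2 p q = p + q" by (simp add: Z2_def twisted_sum_def vadd_seq_pair_space)
  show "vscale Z2 (-1) p = - p"
    by (simp add: Z2_def twisted_sum_def vscale_seq_pair_space prod_eq_iff fun_eq_iff)
  show "vscale Z2 c (p + q) = vscale Z2 c p + vscale Z2 c q"
    by (simp add: Z2_def twisted_sum_def vscale_seq_pair_space prod_eq_iff fun_eq_iff algebra_simps)
  show "vnorm Z2 0 = 0" by (simp add: zero_prod_def vnorm_Z2)
  show "0 \<le> vnorm Z2 p" if "p \<in> vecs Z2"
    using that norm2_nonneg by (auto simp: vecs_Z2 vnorm_Z2)
  obtain x y where p: "p = (x, y)" by (cases p)
  obtain x' y' where q: "q = (x', y')" by (cases q)
  {
    assume "p \<in> vecs Z2" "q \<in> vecs Z2"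
    then have y: "y \<in> ell2" "x - KP y \<in> ell2" and y': "y' \<in> ell2" "x' - KP y' \<in> ell2"
      by (auto simp: vecs_Z2 p q)
    have eq: "(x + x') - KP (y + y') = ((x - KP y) + (x' - KP y')) - (KP (y + y') - KP y - KP y')"
      by (simp add: algebra_simps)
    note 1 = norm2_add[OF y(2) y'(2)]
    note 2 = kalton_peck_map_quasi_additive[OF y(1) y'(1)]
    note 3 = norm2_diff[OF 1(1) 2(1), folded eq]
    note 4 = norm2_add[OF y(1) y'(1)]
    show "p + q \<in> vecs Z2" using 3 4 by (simp add: p q vecs_Z2)
    show "vnorm Z2 (p + q) \<le> 7 * (vnorm Z2 p + vnorm Z2 q)"
      using 1(2) 2(2) 3(2) 4(2) norm2_nonneg[OF y(2)] norm2_nonneg[OF y'(2)]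
      by (simp add: p q vnorm_Z2)
  }
  {
    assume "p \<in> vecs Z2"
    then have y: "y \<in> ell2" "x - KP y \<in> ell2" by (auto simp: vecs_Z2 p)
    have eq: "(\<lambda>j. c * x j) - KP (\<lambda>j. c * y j) = (\<lambda>j. c * (x - KP y) j)"
      using kalton_peck_map_scale[OF y(1)] by (simp add: fun_eq_iff algebra_simps)
    have s: "vscale Z2 c p = (\<lambda>j. c * x j, \<lambda>j. c * y j)"
      by (simp add: Z2_def twisted_sum_def vscale_seq_pair_space p)
    note 1 = norm2_scale[OF y(2), of c] norm2_scale[OF y(1), of c]
    show "vscale Z2 c p \<in> vecs Z2" using 1 by (simp add: s vecs_Z2 eq)
    have "0 \<le> cmod c * (norm2 (x - KP y) + norm2 y)"
      using norm2_nonneg[OF y(1)] norm2_nonneg[OF y(2)] by simp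
    moreover have "vnorm Z2 (vscale Z2 c p) = cmod c * (norm2 (x - KP y) + norm2 y)"
      unfolding s vnorm_Z2 eq 1 by (simp add: algebra_simps)
    ultimately show "vnorm Z2 (vscale Z2 c p) \<le> 7 * (cmod c * vnorm Z2 p)"
      by (simp add: p vnorm_Z2)
  }
qed simp

lemma Z2_definite: "p \<in> vecs Z2 \<Longrightarrow> vnorm Z2 p = 0 \<Longrightarrow> p = 0"
proof -
  assume p: "p \<in> vecs Z2" and z: "vnorm Z2 p = 0"
  obtain x y where xy: "p = (x, y)" by (cases p)
  have y: "y \<in> ell2" "x - KP y \<in> ell2" using p by (auto simp: vecs_Z2 xy)
  have "norm2 (x - KP y) = 0" "norm2 y = 0"
    using z norm2_nonneg[OF y(1)] norm2_nonneg[OF y(2)] by (auto simp: xy vnorm_Z2)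
  then have "y = 0" "x - KP y = 0" using norm2_eq_0_iff y by auto
  then show "p = 0" by (simp add: xy zero_prod_def)
qed

text \<open>The coordinates converge, and the distance from \<open>s n\<close> to the coordinatewise
  limit is estimated by Fatou's lemma with n fixed and the second index tending to infinity.\<close>

lemma Z2_complete:
  assumes s: "s \<in> cauchy_seqs Z2"
  shows "\<exists>p\<in>vecs Z2. (\<lambda>n. vdist Z2 (s n) p) \<longlonglongrightarrow> 0"
proof -
  define x y where "x n = fst (s n)" and "y n = snd (s n)" for n
  have dist: "vdist Z2 (s n) (s m) = norm2 ((x n - x m) - KP (y n - y m)) + norm2 (y n - y m)" for n m
    unfolding Z2.vdist_eq x_def y_def by (cases "s n"; cases "s m") (simp add: vnorm_Z2)
  have mem: "y n - y m \<in> ell2" "(x n - x m) - KP (y n - y m) \<in> ell2" for n m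
    using Z2.diff_closed[OF Z2.cauchy_seqsD[OF s] Z2.cauchy_seqsD[OF s], of n m]
    unfolding x_def y_def by (cases "s n"; cases "s m"; simp add: vecs_Z2)+
  have yn: "y n \<in> ell2" for n
    using Z2.cauchy_seqsD[OF s, of n] unfolding y_def by (cases "s n") (simp add: vecs_Z2)
  have cau: "\<exists>M. \<forall>m\<ge>M. \<forall>n\<ge>M. vdist Z2 (s m) (s n) < \<epsilon>" if "\<epsilon> > 0" for \<epsilon>
    using s that by (simp add: cauchy_seqs_def)
  have bx: "cmod (x n j - x m j) \<le> vdist Z2 (s n) (s m)" for n m j
    using norm_triangle_ineq[of "((x n - x m) - KP (y n - y m)) j" "KP (y n - y m) j"]
      cmod_le_norm2[OF mem(2), of n m j] cmod_kalton_peck_map_le[OF mem(1), of n m j]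
    by (simp add: dist)
  have bdy: "cmod (y n j - y m j) \<le> vdist Z2 (s n) (s m)" for n m j
    using cmod_le_norm2[OF mem(1), of n m j] norm2_nonneg[OF mem(2), of n m] by (simp add: dist)
  have "Cauchy (\<lambda>n. x n j)" "Cauchy (\<lambda>n. y n j)" for j
    unfolding Cauchy_def dist_norm using cau bx bdy by (meson le_less_trans)+
  then have "\<forall>j. \<exists>l. (\<lambda>n. x n j) \<longlonglongrightarrow> l" "\<forall>j. \<exists>l. (\<lambda>n. y n j) \<longlonglongrightarrow> l"
    by (auto simp: Cauchy_convergent_iff convergent_def)
  then obtain X Y where X: "\<And>j. (\<lambda>n. x n j) \<longlonglongrightarrow> X j" and Y: "\<And>j. (\<lambda>n. y n j) \<longlonglongrightarrow> Y j"
    by metis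
  have main_y: "y n - Y \<in> ell2 \<and> norm2 (y n - Y) \<le> \<epsilon>"
    if M: "\<forall>m\<ge>M. \<forall>n\<ge>M. vdist Z2 (s m) (s n) < \<epsilon>" and "n \<ge> M" for M n \<epsilon>
  proof -
    have "\<forall>\<^sub>F m in sequentially. y n - y m \<in> ell2 \<and> norm2 (y n - y m) \<le> \<epsilon>"
      using eventually_ge_at_top[of M]
    proof eventually_elim
      case (elim m)
      then have "vdist Z2 (s n) (s m) < \<epsilon>" using M \<open>n \<ge> M\<close> by blast
      then show ?case using mem norm2_nonneg[OF mem(2), of n m] by (simp add: dist)
    qed
    moreover have "(\<lambda>m. (y n - y m) j) \<longlonglongrightarrow> (y n - Y) j" for j
      by (simp add: tendsto_diff Y)
    ultimately show ?thesis using norm2_fatou[of "\<lambda>m. y n - y m" "y n - Y" \<epsilon>] by blast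
  qed
  obtain M0 where M0: "\<forall>m\<ge>M0. \<forall>n\<ge>M0. vdist Z2 (s m) (s n) < 1" using cau[of 1] by auto
  have "y M0 - (y M0 - Y) \<in> ell2"
    using norm2_diff(1)[OF yn[of M0]] main_y[OF M0, of M0] by blast
  then have Yin: "Y \<in> ell2" by simp
  have yY: "(\<lambda>m. norm2 (y m - Y)) \<longlonglongrightarrow> 0"
  proof (rule LIMSEQ_I)
    fix r :: real assume "r > 0"
    then obtain M where M: "\<forall>m\<ge>M. \<forall>n\<ge>M. vdist Z2 (s m) (s n) < r / 2" using cau[of "r / 2"] by auto
    show "\<exists>no. \<forall>n\<ge>no. norm (norm2 (y n - Y) - 0) < r"
      using main_y[OF M] norm2_nonneg \<open>r > 0\<close> by (intro exI[of _ M]) force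
  qed
  have main_x: "(x n - X) - KP (y n - Y) \<in> ell2 \<and> norm2 ((x n - X) - KP (y n - Y)) \<le> \<epsilon>"
    if M: "\<forall>m\<ge>M. \<forall>n\<ge>M. vdist Z2 (s m) (s n) < \<epsilon>" and "n \<ge> M" for M n \<epsilon>
  proof -
    have "\<forall>\<^sub>F m in sequentially. (x n - x m) - KP (y n - y m) \<in> ell2
        \<and> norm2 ((x n - x m) - KP (y n - y m)) \<le> \<epsilon>"
      using eventually_ge_at_top[of M]
    proof eventually_elim
      case (elim m)
      then have "vdist Z2 (s n) (s m) < \<epsilon>" using M \<open>n \<ge> M\<close> by blast
      then show ?case using mem norm2_nonneg[OF mem(1), of n m] by (simp add: dist)
    qed
    moreover have "(\<lambda>m. ((x n - x m) - KP (y n - y m)) j) \<longlonglongrightarrow> ((x n - X) - KP (y n - Y)) j" for j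
    proof -
      have e: "norm2 ((y n - y m) - (y n - Y)) = norm2 (y m - Y)" for m
        using norm2_minus(2)[OF norm2_diff(1)[OF yn Yin], of m] by simp
      have "(\<lambda>m. KP (y n - y m) j) \<longlonglongrightarrow> KP (y n - Y) j"
        by (rule kalton_peck_map_continuous) (simp_all only: e norm2_diff yn Yin yY)
      then show ?thesis by (simp add: tendsto_diff X)
    qed
    ultimately show ?thesis
      using norm2_fatou[of "\<lambda>m. (x n - x m) - KP (y n - y m)" "(x n - X) - KP (y n - Y)" \<epsilon>] by blast
  qed
  have sn: "s n = (x n, y n)" for n by (simp add: x_def y_def)
  \<comment> \<open>The limit is placed in \<open>Z2\<close> indirectly: its difference from one
    term of the sequence lies there, and \<open>Z2\<close> is closed under subtraction.\<close>
  have "s M0 - (X, Y) \<in> vecs Z2"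
    using main_x[OF M0] main_y[OF M0] by (simp add: sn vecs_Z2)
  from Z2.diff_closed[OF Z2.cauchy_seqsD[OF s, of M0] this] have XY: "(X, Y) \<in> vecs Z2" by simp
  have "(\<lambda>n. vdist Z2 (s n) (X, Y)) \<longlonglongrightarrow> 0"
  proof (rule LIMSEQ_I)
    fix r :: real assume "r > 0"
    then obtain M where M: "\<forall>m\<ge>M. \<forall>n\<ge>M. vdist Z2 (s m) (s n) < r / 3" using cau[of "r / 3"] by auto
    have "norm (vdist Z2 (s n) (X, Y) - 0) < r" if "n \<ge> M" for n
    proof -
      have "vdist Z2 (s n) (X, Y) = norm2 ((x n - X) - KP (y n - Y)) + norm2 (y n - Y)"
        by (simp add: Z2.vdist_eq sn vnorm_Z2)
      also have "\<dots> \<le> r / 3 + r / 3"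
        using main_x[OF M that] main_y[OF M that] by (intro add_mono) auto
      finally show ?thesis
        using \<open>r > 0\<close> Z2.vdist_nonneg[OF Z2.cauchy_seqsD[OF s] XY, of n] by simp
    qed
    then show "\<exists>no. \<forall>n\<ge>no. norm (vdist Z2 (s n) (X, Y) - 0) < r" by blast
  qed
  then show ?thesis using XY by blast
qed

lemma c00_subset_Z2: "c00 \<times> c00 \<subseteq> vecs Z2"
proof -
  have "x - KP y \<in> c00" if "x \<in> c00" "y \<in> c00" for x y
  proof -
    have "supp (x - KP y) \<subseteq> supp x \<union> supp y" by (auto simp: supp_def kalton_peck_map_def)
    then show ?thesis using that by (auto simp: c00_def intro: finite_subset)
  qed
  then show ?thesis using c00_subset_ell2 by (auto simp: vecs_Z2)
qed

text \<open>Truncation does the approximation, but it does not commute with \<open>KP\<close>: a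
  tail is normalized by its own norm instead of that of y, which adds the multiple c of the tail. By
  \<open>abs_ln_scaled_le_sqrt\<close> this term tends to 0, although |c| may grow without
  bound.\<close>

lemma c00_dense_Z2:
  assumes p: "p \<in> vecs Z2" and "\<epsilon> > 0"
  shows "\<exists>q\<in>c00 \<times> c00. vdist Z2 q p < \<epsilon>"
proof -
  obtain x y where xy: "p = (x, y)" by (cases p)
  have y: "y \<in> ell2" "x - KP y \<in> ell2" using p by (auto simp: vecs_Z2 xy)
  define tl where "tl n z = (\<lambda>j. if j < n then 0 else z j)" for n and z :: "nat \<Rightarrow> complex"
  have tl: "tl n z \<in> ell2" "norm2 (tl n z) \<le> norm2 z" if "z \<in> ell2" for n z
    using norm2_mono[of z "tl n z" 1] that by (auto simp: tl_def)
  define q where "q n = p - (tl n x, tl n y)" for n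
  have "z - tl n z \<in> c00" for z n
  proof -
    have "supp (z - tl n z) \<subseteq> {..<n}" by (auto simp: supp_def tl_def split: if_splits)
    then show ?thesis by (auto simp: c00_def intro: finite_subset)
  qed
  then have q: "q n \<in> c00 \<times> c00" for n by (simp add: q_def xy)
  have bound: "vdist Z2 p (q n) \<le> norm2 (tl n (x - KP y)) + 2 * sqrt (norm2 (tl n y) * norm2 y) + norm2 (tl n y)" for n
  proof -
    define c where "c = complex_of_real (ln (norm2 (tl n y) / norm2 y))"
    have "tl n x - KP (tl n y) = tl n (x - KP y) + (\<lambda>j. c * tl n y j)"
    proof
      fix j
      show "(tl n x - KP (tl n y)) j = (tl n (x - KP y) + (\<lambda>j. c * tl n y j)) j"
      proof (cases "j < n \<or> y j = 0")
        case False
        then have "tl n y j = y j" "y j \<noteq> 0" by (auto simp: tl_def)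
        then have "norm2 (tl n y) > 0" "norm2 y > 0"
          using norm2_pos[OF y(1), of j] norm2_pos[OF tl(1)[OF y(1)], of n j] by auto
        then show ?thesis using False
          by (simp add: c_def kalton_peck_map_def tl_def ln_div algebra_simps)
      qed (auto simp: kalton_peck_map_def tl_def)
    qed
    then have "norm2 (tl n x - KP (tl n y)) \<le> norm2 (tl n (x - KP y)) + norm2 (\<lambda>j. c * tl n y j)"
      using norm2_add(2)[OF tl(1)[OF y(2)] norm2_scale(1)[OF tl(1)[OF y(1)]]] by simp
    also have "norm2 (\<lambda>j. c * tl n y j) = norm2 (tl n y) * \<bar>ln (norm2 (tl n y) / norm2 y)\<bar>"
      unfolding norm2_scale(2)[OF tl(1)[OF y(1)]] by (simp add: c_def)
    also have "\<dots> \<le> 2 * sqrt (norm2 (tl n y) * norm2 y)"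
      by (intro abs_ln_scaled_le_sqrt tl norm2_nonneg y)
    finally have "norm2 (tl n x - KP (tl n y)) \<le> norm2 (tl n (x - KP y)) + 2 * sqrt (norm2 (tl n y) * norm2 y)"
      by (simp add: fun_diff_def)
    moreover have "p - q n = (tl n x, tl n y)" by (simp add: q_def)
    ultimately show ?thesis unfolding Z2.vdist_eq by (simp only: vnorm_Z2)
  qed
  have t0: "(\<lambda>n. norm2 (tl n z)) \<longlonglongrightarrow> 0" if "z \<in> ell2" for z
    using norm2_tail_tendsto_0[OF that] by (simp add: tl_def)
  \<comment> \<open>The factor 7 pays for reversing the arguments of \<open>vdist\<close>.\<close>
  have "(\<lambda>n. 7 * (norm2 (tl n (x - KP y)) + 2 * sqrt (norm2 (tl n y) * norm2 y) + norm2 (tl n y)))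
      \<longlonglongrightarrow> 7 * (0 + 2 * sqrt (0 * norm2 y) + 0)"
    by (intro tendsto_intros t0 y)
  then have "(\<lambda>n. 7 * (norm2 (tl n (x - KP y)) + 2 * sqrt (norm2 (tl n y) * norm2 y) + norm2 (tl n y))) \<longlonglongrightarrow> 0"
    by simp
  from order_tendstoD(2)[OF this \<open>\<epsilon> > 0\<close>] obtain n where
    n: "7 * (norm2 (tl n (x - KP y)) + 2 * sqrt (norm2 (tl n y) * norm2 y) + norm2 (tl n y)) < \<epsilon>"
    by (auto simp: eventually_sequentially)
  have "vdist Z2 (q n) p \<le> 7 * vdist Z2 p (q n)"
    using q[of n] c00_subset_Z2 by (intro Z2.vdist_commute p) auto
  then have "vdist Z2 (q n) p < \<epsilon>" using n bound[of n] by simp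
  then show ?thesis using q by blast
qed

section \<open>Spreading models\<close>

lemma scaleC_one [simp]: "1 *\<^sub>C x = (x::'a::complex_banach)"
  using scaleR_scaleC[of 1 x] by simp

lemma scaleC_zero_left [simp]: "0 *\<^sub>C x = (0::'a::complex_banach)"
  using scaleR_scaleC[of 0 x] by simp

lemma scaleC_minus_left: "(- c) *\<^sub>C x = - (c *\<^sub>C (x::'a::complex_banach))"
  using scaleC_add_left[of c "-c" x] by (simp add: eq_neg_iff_add_eq_0 add.commute)

lemma scaleC_diff_left: "(c - d) *\<^sub>C x = c *\<^sub>C x - d *\<^sub>C (x::'a::complex_banach)"
  using scaleC_add_left[of c "-d" x] by (simp add: scaleC_minus_left)

lemma bounded_linear_scaleC: "bounded_linear (\<lambda>x::'a::complex_banach. c *\<^sub>C x)"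
proof (rule bounded_linear_intro[where K = "cmod c"])
  fix r and x :: 'a
  show "c *\<^sub>C (r *\<^sub>R x) = r *\<^sub>R (c *\<^sub>C x)"
    by (simp add: scaleR_scaleC scaleC_scaleC mult.commute)
qed (auto simp: scaleC_add_right norm_scaleC mult.commute)

lemma scaleC_sum_right: "c *\<^sub>C (\<Sum>j\<in>A. f j) = (\<Sum>j\<in>A. c *\<^sub>C (f j :: 'a::complex_banach))"
  using linear_sum[OF bounded_linear.linear[OF bounded_linear_scaleC]] .

section \<open>Existence of spreading models\<close>

lemma sorted_list_of_set_image_strict_mono:
  assumes "strict_mono_on {..<n} k" "j < n"
  shows "sorted_list_of_set (k ` {..<n}) ! j = (k j :: nat)"
proof -
  have "sorted_list_of_set (k ` {..<n}) = map k [0..<n]"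
  proof (rule sorted_distinct_set_unique)
    show "sorted (map k [0..<n])"
      using assms(1) by (auto simp: sorted_iff_nth_mono le_less strict_mono_on_def)
    show "distinct (map k [0..<n])"
      using strict_mono_on_imp_inj_on[OF assms(1)] by (simp add: distinct_map atLeast0LessThan)
  qed (auto simp: atLeast0LessThan)
  then show ?thesis using assms(2) by simp
qed

text \<open>An n-set is coloured by the integer part of f / \<open>\<epsilon>\<close> at its
  increasing enumeration; boundedness of f leaves finitely many colours. On a homogeneous infinite
  set all values share an interval of length \<open>\<epsilon>\<close>, and r enumerates that set.
  Since list entries are meaningful only below n, \<open>local\<close> is what identifies the
  enumeration with the given tuple.\<close>

lemma ramsey_small_oscillation:
  fixes f :: "(nat \<Rightarrow> nat) \<Rightarrow> real"
  assumes local: "\<And>k k'. (\<And>j. j < n \<Longrightarrow> k j = k' j) \<Longrightarrow> f k = f k'"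
    and bounds: "\<And>k. 0 \<le> f k" "\<And>k. f k \<le> C" and "0 < \<epsilon>"
  shows "\<exists>r::nat\<Rightarrow>nat. strict_mono r \<and> (\<forall>k k'. strict_mono_on {..<n} k \<longrightarrow> strict_mono_on {..<n} k' \<longrightarrow>
    \<bar>f (r \<circ> k) - f (r \<circ> k')\<bar> < \<epsilon>)"
proof -
  define c where "c X = nat \<lfloor>f (\<lambda>j. sorted_list_of_set X ! j) / \<epsilon>\<rfloor>" for X
  have "c X < nat \<lfloor>C / \<epsilon>\<rfloor> + 1" for X
  proof -
    have "\<lfloor>f (\<lambda>j. sorted_list_of_set X ! j) / \<epsilon>\<rfloor> \<le> \<lfloor>C / \<epsilon>\<rfloor>"
      using bounds \<open>0 < \<epsilon>\<close> by (intro floor_mono divide_right_mono) auto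
    then show ?thesis by (simp add: c_def less_Suc_eq_le nat_mono)
  qed
  then have "\<exists>Y t. Y \<subseteq> UNIV \<and> infinite Y \<and> t < nat \<lfloor>C / \<epsilon>\<rfloor> + 1 \<and>
      (\<forall>X. X \<subseteq> Y \<and> finite X \<and> card X = n \<longrightarrow> c X = t)"
    by (intro Ramsey) auto
  then obtain Y t where Y: "infinite Y" "\<forall>X. X \<subseteq> Y \<and> finite X \<and> card X = n \<longrightarrow> c X = t"
    by (elim exE conjE) (rule that)
  define r where "r = enumerate Y"
  have r: "strict_mono r" using strict_mono_enumerate[OF Y(1)] by (simp add: r_def)
  have col: "\<lfloor>f (r \<circ> k) / \<epsilon>\<rfloor> = int t" if "strict_mono_on {..<n} k" for k
  proof -
    have m: "strict_mono_on {..<n} (r \<circ> k)"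
      using that r by (auto simp: strict_mono_on_def strict_mono_def)
    have "c ((r \<circ> k) ` {..<n}) = t"
      using card_image[OF strict_mono_on_imp_inj_on[OF m]] Y(1)
      by (intro Y(2)[rule_format]) (auto simp: r_def enumerate_in_set)
    moreover have "f (\<lambda>j. sorted_list_of_set ((r \<circ> k) ` {..<n}) ! j) = f (r \<circ> k)"
      by (intro local sorted_list_of_set_image_strict_mono m)
    ultimately show ?thesis using bounds(1)[of "r \<circ> k"] \<open>0 < \<epsilon>\<close> by (auto simp: c_def)
  qed
  have "\<bar>f (r \<circ> k) - f (r \<circ> k')\<bar> < \<epsilon>" if "strict_mono_on {..<n} k" "strict_mono_on {..<n} k'" for k k'
  proof -
    have "\<bar>f (r \<circ> k) / \<epsilon> - f (r \<circ> k') / \<epsilon>\<bar> < 1"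
      using col[OF that(1)] col[OF that(2)] by linarith
    then have "\<bar>f (r \<circ> k) - f (r \<circ> k')\<bar> / \<epsilon> < 1"
      using \<open>0 < \<epsilon>\<close> by (simp flip: diff_divide_distrib)
    then show ?thesis using \<open>0 < \<epsilon>\<close> by simp
  qed
  then show ?thesis using r by blast
qed

lemma complex_rat_dense:
  assumes "0 < \<delta>"
  shows "\<exists>p q::rat. cmod (z - Complex (of_rat p) (of_rat q)) < \<delta>"
proof -
  have "\<exists>p::rat. \<bar>t - of_rat p\<bar> < \<delta> / 2" for t :: real
  proof -
    obtain p :: rat where "t < of_rat p" "of_rat p < t + \<delta> / 2"
      using of_rat_dense[of t "t + \<delta> / 2"] assms by auto
    then show ?thesis by (intro exI[of _ p]) auto
  qed
  then obtain p q :: rat where "\<bar>Re z - of_rat p\<bar> < \<delta> / 2" "\<bar>Im z - of_rat q\<bar> < \<delta> / 2" by metis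
  then have "cmod (z - Complex (of_rat p) (of_rat q)) < \<delta>"
    using cmod_le[of "z - Complex (of_rat p) (of_rat q)"] by simp
  then show ?thesis by blast
qed

definition combination_norm :: "(nat \<Rightarrow> 'a::complex_banach) \<Rightarrow> nat \<Rightarrow> (nat \<Rightarrow> nat) \<Rightarrow> (nat \<Rightarrow> complex) \<Rightarrow> real" where
  "combination_norm x n k a = norm (\<Sum>j<n. a j *\<^sub>C x (k j))"

lemma combination_norm_diff:
  assumes "\<And>i. norm (x i) \<le> D"
  shows "\<bar>combination_norm x n k a - combination_norm x n k b\<bar> \<le> (\<Sum>j<n. cmod (a j - b j) * D)"
proof -
  have "\<bar>combination_norm x n k a - combination_norm x n k b\<bar>
      \<le> norm ((\<Sum>j<n. a j *\<^sub>C x (k j)) - (\<Sum>j<n. b j *\<^sub>C x (k j)))"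
    unfolding combination_norm_def by (rule norm_triangle_ineq3)
  also have "\<dots> = norm (\<Sum>j<n. (a j - b j) *\<^sub>C x (k j))"
    by (simp add: scaleC_diff_left sum_subtractf)
  also have "\<dots> \<le> (\<Sum>j<n. cmod (a j - b j) * D)"
    by (rule sum_norm_le) (auto simp: norm_scaleC intro: mult_left_mono assms)
  finally show ?thesis .
qed

lemma combination_norm_zeros:
  assumes "supp a \<subseteq> {..<n}" "n \<le> m"
  shows "combination_norm x m k a = combination_norm x n k a"
proof -
  have "(\<Sum>j<n. a j *\<^sub>C x (k j)) = (\<Sum>j<m. a j *\<^sub>C x (k j))"
    using assms by (intro sum.mono_neutral_left) (force simp: supp_def)+
  then show ?thesis by (simp add: combination_norm_def)
qed

text \<open>Ramsey's theorem settles one coefficient vector at one tolerance. Countably many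
  rational cases are diagonalized; density and the bound D extend the oscillation estimate to all
  coefficients, and Cauchy's criterion supplies L.\<close>

theorem brunel_sucheston:
  fixes x :: "nat \<Rightarrow> 'a::complex_banach"
  assumes "bounded (range x)"
  shows "\<exists>r L. strict_mono (r::nat\<Rightarrow>nat) \<and>
    spreading_limit (\<lambda>n k a. norm (\<Sum>j<n. a j *\<^sub>C x (r (k j)))) (\<lambda>n. {a. supp a \<subseteq> {..<n}}) L"
proof -
  obtain D where D: "\<And>i. norm (x i) \<le> D" "0 < D"
    using assms unfolding bounded_pos by auto
  define coef :: "(rat \<times> rat) list \<Rightarrow> nat \<Rightarrow> complex" where
    "coef qs j = Complex (of_rat (fst (qs ! j))) (of_rat (snd (qs ! j)))" for qs j
  \<comment> \<open>A natural number codes a list of rational complex coefficients together with a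
    tolerance 1 / (m + 1).\<close>
  define P :: "nat \<Rightarrow> (nat \<Rightarrow> nat) \<Rightarrow> bool" where
    "P i s = (case from_nat i :: (rat \<times> rat) list \<times> nat of (qs, m) \<Rightarrow>
      (\<forall>k k'. strict_mono_on {..<length qs} k \<longrightarrow> strict_mono_on {..<length qs} k' \<longrightarrow>
        \<bar>combination_norm x (length qs) (s \<circ> k) (coef qs) -
         combination_norm x (length qs) (s \<circ> k') (coef qs)\<bar> < 1 / Suc m))" for i s
  interpret subseqs P
  proof
    fix i and s :: "nat \<Rightarrow> nat" assume "strict_mono s"
    obtain qs m where i: "from_nat i = (qs :: (rat \<times> rat) list, m :: nat)" by fastforce
    define n where "n = length qs"
    have "combination_norm x n (s \<circ> k) (coef qs) \<le> (\<Sum>j<n. cmod (coef qs j) * D)" for k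
      using combination_norm_diff[OF D(1), where n = n and k = "s \<circ> k" and a = "coef qs" and b = "\<lambda>_. 0"]
      by (simp add: combination_norm_def)
    then have "\<exists>r'::nat\<Rightarrow>nat. strict_mono r' \<and> (\<forall>k k'. strict_mono_on {..<n} k \<longrightarrow> strict_mono_on {..<n} k' \<longrightarrow>
      \<bar>combination_norm x n (s \<circ> (r' \<circ> k)) (coef qs) - combination_norm x n (s \<circ> (r' \<circ> k')) (coef qs)\<bar> < 1 / Suc m)"
      by (intro ramsey_small_oscillation[where C = "\<Sum>j<n. cmod (coef qs j) * D"])
        (auto simp: combination_norm_def)
    then show "\<exists>r'. strict_mono r' \<and> P i (s \<circ> r')"
      by (simp add: P_def i n_def comp_assoc)
  qed
  have stable: "P i (s \<circ> r)" if "strict_mono r" "P i s" for i r s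
  proof -
    obtain qs m where i: "from_nat i = (qs :: (rat \<times> rat) list, m :: nat)" by fastforce
    have "strict_mono_on {..<n} (r \<circ> k)" if "strict_mono_on {..<n} k" for n k
      using that \<open>strict_mono r\<close> by (auto simp: strict_mono_on_def strict_mono_def)
    then show ?thesis using that(2) unfolding P_def i comp_assoc prod.case by blast
  qed
  define r where "r = diagseq"
  have r: "strict_mono r" by (simp add: r_def subseq_diagseq)
  let ?\<Phi> = "\<lambda>n k a. combination_norm x n (r \<circ> k) a"
  have osc: "\<exists>\<nu>. \<forall>k k'. strict_mono_on {..<n} k \<longrightarrow> strict_mono_on {..<n} k' \<longrightarrow>
      (\<forall>j<n. \<nu> \<le> k j) \<longrightarrow> (\<forall>j<n. \<nu> \<le> k' j) \<longrightarrow> \<bar>?\<Phi> n k a - ?\<Phi> n k' a\<bar> < \<epsilon>"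
    if "\<epsilon> > 0" for n a \<epsilon>
  proof -
    \<comment> \<open>One third of \<open>\<epsilon>\<close> goes to each of the two rational
      approximations and one third to the oscillation. The summand 1 keeps w positive for n =
      0.\<close>
    define w where "w = real n * D + 1"
    define \<delta> where "\<delta> = \<epsilon> / (3 * w)"
    have w: "w > 0" using D by (simp add: w_def add_nonneg_pos)
    then have "\<delta> > 0" using that by (simp add: \<delta>_def)
    have "\<forall>j. \<exists>pq::rat\<times>rat. cmod (a j - Complex (of_rat (fst pq)) (of_rat (snd pq))) < \<delta>"
      using complex_rat_dense[OF \<open>\<delta> > 0\<close>] by force
    then obtain q :: "nat \<Rightarrow> rat \<times> rat"
      where q: "\<And>j. cmod (a j - Complex (of_rat (fst (q j))) (of_rat (snd (q j)))) < \<delta>" by metis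
    define qs where "qs = map q [0..<n]"
    have len: "length qs = n" by (simp add: qs_def)
    have near: "\<bar>?\<Phi> n k a - ?\<Phi> n k (coef qs)\<bar> \<le> \<epsilon> / 3" for k
    proof -
      have "\<bar>?\<Phi> n k a - ?\<Phi> n k (coef qs)\<bar> \<le> (\<Sum>j<n. cmod (a j - coef qs j) * D)"
        by (rule combination_norm_diff[OF D(1)])
      also have "\<dots> \<le> (\<Sum>j<n. \<delta> * D)"
        using q D(2) by (intro sum_mono mult_right_mono) (auto simp: coef_def qs_def less_imp_le)
      also have "\<dots> = \<delta> * (real n * D)" by simp
      also have "\<dots> \<le> \<delta> * w" using \<open>\<delta> > 0\<close> by (intro mult_left_mono) (auto simp: w_def)
      also have "\<dots> = \<epsilon> / 3" using w by (simp add: \<delta>_def)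
      finally show ?thesis .
    qed
    have "\<epsilon> / 3 > 0" using that by simp
    then obtain m where m: "1 / real (Suc m) < \<epsilon> / 3" by (rule nat_approx_posE)
    define i where "i = to_nat (qs, m)"
    \<comment> \<open>The diagonal sequence satisfies condition i only after its first i + 1 terms.
      Late tuples are therefore shifted down by \<open>Suc i\<close> before the condition is
      applied.\<close>
    have "P i (diagseq \<circ> (+) (Suc i))" by (rule diagseq_holds[OF stable])
    then have Pi: "\<bar>?\<Phi> n ((+) (Suc i) \<circ> k) (coef qs) - ?\<Phi> n ((+) (Suc i) \<circ> k') (coef qs)\<bar> < 1 / Suc m"
      if "strict_mono_on {..<n} k" "strict_mono_on {..<n} k'" for k k'
      using that by (simp add: P_def i_def len r_def comp_assoc)
    have "\<bar>?\<Phi> n k a - ?\<Phi> n k' a\<bar> < \<epsilon>"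
      if k: "strict_mono_on {..<n} k" "\<forall>j<n. Suc i \<le> k j" and k': "strict_mono_on {..<n} k'" "\<forall>j<n. Suc i \<le> k' j" for k k'
    proof -
      have shift: "strict_mono_on {..<n} (\<lambda>j. l j - Suc i)" "?\<Phi> n ((+) (Suc i) \<circ> (\<lambda>j. l j - Suc i)) b = ?\<Phi> n l b"
        if l: "strict_mono_on {..<n} l" "\<forall>j<n. Suc i \<le> l j" for l b
      proof -
        show "strict_mono_on {..<n} (\<lambda>j. l j - Suc i)"
          using l by (auto simp: strict_mono_on_def intro!: diff_less_mono)
        show "?\<Phi> n ((+) (Suc i) \<circ> (\<lambda>j. l j - Suc i)) b = ?\<Phi> n l b"
          using l(2) by (auto simp: combination_norm_def intro!: arg_cong[where f = norm] sum.cong)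
      qed
      have "\<bar>?\<Phi> n k (coef qs) - ?\<Phi> n k' (coef qs)\<bar> < 1 / Suc m"
        using Pi[OF shift(1)[OF k] shift(1)[OF k']] unfolding shift(2)[OF k] shift(2)[OF k'] .
      then show ?thesis using near[of k] near[of k'] m by linarith
    qed
    then show ?thesis by blast
  qed
  \<comment> \<open>The tuples \<open>\<nu>\<close>, \<open>\<nu>\<close> + 1, ... are one choice of
    late indices, and the least admissible length makes L a function of a alone.\<close>
  define L where "L a = lim (\<lambda>\<nu>. ?\<Phi> (LEAST n. supp a \<subseteq> {..<n}) ((+) \<nu>) a)" for a
  have "\<exists>\<nu>. \<forall>k. strict_mono_on {..<n} k \<and> (\<forall>j<n. \<nu> \<le> k j) \<longrightarrow> \<bar>?\<Phi> n k a - L a\<bar> < \<epsilon>"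
    if a: "supp a \<subseteq> {..<n}" and "\<epsilon> > 0" for n a \<epsilon>
  proof -
    define n0 where "n0 = (LEAST n. supp a \<subseteq> {..<n})"
    have n0: "supp a \<subseteq> {..<n0}" "n0 \<le> n"
      unfolding n0_def using LeastI[of "\<lambda>n. supp a \<subseteq> {..<n}", OF a] Least_le[of "\<lambda>n. supp a \<subseteq> {..<n}", OF a] by auto
    define g where "g = (\<lambda>\<nu>. ?\<Phi> n0 ((+) \<nu>) a)"
    have sm: "strict_mono_on {..<m} ((+) \<nu>)" for m \<nu> :: nat
      by (auto simp: strict_mono_on_def)
    have "Cauchy g"
      unfolding Cauchy_def dist_real_def
    proof (intro allI impI)
      fix e :: real assume "e > 0"
      from osc[OF this, of n0 a] obtain \<nu> where \<nu>: "\<forall>k k'. strict_mono_on {..<n0} k \<longrightarrow> strict_mono_on {..<n0} k' \<longrightarrow>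
        (\<forall>j<n0. \<nu> \<le> k j) \<longrightarrow> (\<forall>j<n0. \<nu> \<le> k' j) \<longrightarrow> \<bar>?\<Phi> n0 k a - ?\<Phi> n0 k' a\<bar> < e" by blast
      then show "\<exists>M. \<forall>m\<ge>M. \<forall>n\<ge>M. \<bar>g m - g n\<bar> < e"
        using sm unfolding g_def by (intro exI[of _ \<nu>]) auto
    qed
    then have "convergent g" by (simp add: Cauchy_convergent_iff)
    then have lim: "g \<longlonglongrightarrow> L a" unfolding L_def g_def n0_def by (simp add: convergent_LIMSEQ_iff)
    have "\<epsilon> / 2 > 0" using \<open>\<epsilon> > 0\<close> by simp
    from osc[OF this, of n a] obtain \<nu> where \<nu>: "\<And>k k'. strict_mono_on {..<n} k \<Longrightarrow> strict_mono_on {..<n} k' \<Longrightarrow>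
        (\<forall>j<n. \<nu> \<le> k j) \<Longrightarrow> (\<forall>j<n. \<nu> \<le> k' j) \<Longrightarrow> \<bar>?\<Phi> n k a - ?\<Phi> n k' a\<bar> < \<epsilon> / 2" by blast
    have "\<bar>?\<Phi> n k a - L a\<bar> < \<epsilon>" if k: "strict_mono_on {..<n} k" "\<forall>j<n. \<nu> \<le> k j" for k
    proof -
      obtain M where M: "\<And>m. m \<ge> M \<Longrightarrow> \<bar>g m - L a\<bar> < \<epsilon> / 2"
        using LIMSEQ_D[OF lim \<open>\<epsilon> / 2 > 0\<close>] by auto
      define m where "m = max M \<nu>"
      have "\<bar>?\<Phi> n k a - ?\<Phi> n ((+) m) a\<bar> < \<epsilon> / 2"
        by (rule \<nu>[OF k(1) sm k(2)]) (auto simp: m_def)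
      moreover have "?\<Phi> n ((+) m) a = g m"
        unfolding g_def by (rule combination_norm_zeros[OF n0])
      moreover have "\<bar>g m - L a\<bar> < \<epsilon> / 2" by (rule M) (simp add: m_def)
      ultimately show ?thesis by linarith
    qed
    then show ?thesis by blast
  qed
  then have "spreading_limit (\<lambda>n k a. norm (\<Sum>j<n. a j *\<^sub>C x (r (k j)))) (\<lambda>n. {a. supp a \<subseteq> {..<n}}) L"
    by (simp add: spreading_limit_def combination_norm_def)
  then show ?thesis using r by blast
qed

section \<open>Spreading models isomorphic to c_0\<close>

abbreviation chi :: "nat set \<Rightarrow> nat \<Rightarrow> complex" where
  "chi A \<equiv> \<lambda>j. of_bool (j \<in> A)"

lemma supp_chi: "supp (chi A) = A"
  by (auto simp: supp_def)

lemma chi_in_c00: "finite A \<Longrightarrow> chi A \<in> c00"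
  by (simp add: c00_def supp_chi)

lemma c00_add: "a \<in> c00 \<Longrightarrow> b \<in> c00 \<Longrightarrow> a + b \<in> c00"
  and c00_diff: "a \<in> c00 \<Longrightarrow> b \<in> c00 \<Longrightarrow> a - b \<in> c00"
  and c00_scale: "a \<in> c00 \<Longrightarrow> (\<lambda>j. c * a j) \<in> c00"
proof -
  have s: "supp (a + b) \<subseteq> supp a \<union> supp b" "supp (a - b) \<subseteq> supp a \<union> supp b" "supp (\<lambda>j. c * a j) \<subseteq> supp a"
    by (auto simp: supp_def)
  show "a \<in> c00 \<Longrightarrow> b \<in> c00 \<Longrightarrow> a + b \<in> c00" and "a \<in> c00 \<Longrightarrow> b \<in> c00 \<Longrightarrow> a - b \<in> c00"
    and "a \<in> c00 \<Longrightarrow> (\<lambda>j. c * a j) \<in> c00"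
    using s[THEN finite_subset] by (auto simp: c00_def)
qed

lemma seq_space_simps:
  "vecs (seq_space S N) = S" "vadd (seq_space S N) x y = x + y"
  "vscale (seq_space S N) c x = (\<lambda>j. c * x j)" "vnorm (seq_space S N) = N"
  by (auto simp: seq_space_def fun_eq_iff)

text \<open>If the unit vectors \<open>e\<^sub>j\<close> span a copy of \<open>c\<^sub>0\<close>, their images \<open>y\<^sub>j\<close> have pointwise small
  differences \<open>y\<^sub>p - y\<^sub>q\<close>, which can be made almost disjoint; unconditionality and spreading
  carry the resulting bound on \<open>\<Sum>\<^sub>i (e\<^bsub>p(i)\<^esub> - e\<^bsub>q(i)\<^esub>)\<close> over to \<open>\<Sum>\<^sub>i e\<^sub>i\<close>.\<close>

theorem spreading_norm_bounded_if_c0: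
  fixes L :: "(nat \<Rightarrow> complex) \<Rightarrow> real"
  assumes nonneg: "\<And>a. a \<in> c00 \<Longrightarrow> 0 \<le> L a"
    and add: "\<And>a b. a \<in> c00 \<Longrightarrow> b \<in> c00 \<Longrightarrow> L (a + b) \<le> L a + L b"
    and scale: "\<And>c a. a \<in> c00 \<Longrightarrow> L (\<lambda>j. c * a j) = cmod c * L a"
    and "0 \<le> D"
    and uncond: "\<And>a b. a \<in> c00 \<Longrightarrow> b \<in> c00 \<Longrightarrow> (\<And>j. cmod (a j) \<le> cmod (b j)) \<Longrightarrow> L a \<le> D * L b"
    and spread: "\<And>A. finite A \<Longrightarrow> L (chi A) = L (chi {..<card A})"
    and iso: "isomorphic (completion (seq_space c00 L)) c0_space"
  shows "\<exists>K. \<forall>n. L (chi {..<n}) \<le> K"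
proof -
  let ?E = "seq_space c00 L"
  have z: "0 \<in> c00" by (simp add: c00_def supp_def)
  have zero: "L 0 = 0" using scale[OF z, of 0] by (simp add: zero_fun_def)
  interpret E: quasi_normed ?E 1
    by unfold_locales
      (auto simp: seq_space_simps fun_eq_iff algebra_simps c00_add c00_scale nonneg add scale zero)
  obtain T c C where T: "bij_betw T (vecs (completion ?E)) (vecs c0_space)"
    and T_add: "\<And>x y. x \<in> vecs (completion ?E) \<Longrightarrow> y \<in> vecs (completion ?E) \<Longrightarrow>
      T (vadd (completion ?E) x y) = vadd c0_space (T x) (T y)"
    and T_scale: "\<And>c x. x \<in> vecs (completion ?E) \<Longrightarrow> T (vscale (completion ?E) c x) = vscale c0_space c (T x)"
    and "0 < c" "0 < C"
    and T_lower: "\<And>x. x \<in> vecs (completion ?E) \<Longrightarrow> c * vnorm (completion ?E) x \<le> vnorm c0_space (T x)"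
    and T_upper: "\<And>x. x \<in> vecs (completion ?E) \<Longrightarrow> vnorm c0_space (T x) \<le> C * vnorm (completion ?E) x"
    using iso unfolding isomorphic_def by auto
  have vE: "vecs ?E = c00" "vnorm ?E = L" by (simp_all add: seq_space_simps)
  have cst: "(\<lambda>n. a) \<in> cauchy_seqs ?E" if "a \<in> c00" for a
    using E.const_cauchy that by (simp add: vE)
  \<comment> \<open>The isomorphism is restricted to \<open>c00\<close>, embedded by constant
    sequences. As the constant of E is 1, the bounds of T carry over to S and L without
    loss.\<close>
  define S where "S a = T (E.cls (\<lambda>n. a))" for a
  have S_in: "S a \<longlonglongrightarrow> 0" if "a \<in> c00" for a
    using bij_betw_apply[OF T E.cls_in_completion[OF cst[OF that]]]
    by (simp add: S_def c0_space_def seq_space_simps)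
  have S_add: "S (a + b) = S a + S b" if "a \<in> c00" "b \<in> c00" for a b
    using T_add[OF E.cls_in_completion[OF cst[OF that(1)]] E.cls_in_completion[OF cst[OF that(2)]]]
    unfolding E.vadd_cls[OF cst[OF that(1)] cst[OF that(2)]]
    by (simp add: S_def E.vadd_eq c0_space_def seq_space_simps)
  have S_scale: "S (\<lambda>j. k * a j) = (\<lambda>j. k * S a j)" if "a \<in> c00" for a k
    using T_scale[OF E.cls_in_completion[OF cst[OF that]]]
    unfolding E.vscale_cls[OF cst[OF that]]
    by (simp add: S_def c0_space_def seq_space_simps)
  have S_diff: "S (a - b) = S a - S b" if "a \<in> c00" "b \<in> c00" for a b
    using S_add[OF c00_diff[OF that] that(2)] by simp
  have S_zero: "S 0 = 0" using S_diff[OF z z] by simp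
  have c0_norm: "vnorm c0_space s = (SUP j. cmod (s j))" for s
    by (simp add: c0_space_def seq_space_simps)
  have S_upper: "cmod (S a i) \<le> C * L a" if a: "a \<in> c00" for a i
  proof -
    have "Bseq (S a)" using S_in[OF a] by (intro convergent_imp_Bseq convergentI)
    then have "bdd_above (range (\<lambda>i. cmod (S a i)))" by (auto simp: Bseq_def intro: bdd_aboveI)
    then have "cmod (S a i) \<le> vnorm c0_space (S a)" unfolding c0_norm by (rule cSUP_upper2) auto
    also have "\<dots> \<le> C * vnorm (completion ?E) (E.cls (\<lambda>n. a))"
      unfolding S_def by (rule T_upper[OF E.cls_in_completion[OF cst[OF a]]])
    also have "\<dots> \<le> C * L a"
      using E.vnorm_cls_const_le[of a] a \<open>0 < C\<close> by (intro mult_left_mono) (auto simp: vE)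
    finally show ?thesis .
  qed
  have S_lower: "c * L a \<le> K" if a: "a \<in> c00" and K: "\<And>i. cmod (S a i) \<le> K" for a K
  proof -
    have "c * L a \<le> c * vnorm (completion ?E) (E.cls (\<lambda>n. a))"
      using E.vnorm_cls_const_ge[of a] a \<open>0 < c\<close> by (intro mult_left_mono) (auto simp: vE)
    also have "\<dots> \<le> vnorm c0_space (S a)"
      unfolding S_def by (rule T_lower[OF E.cls_in_completion[OF cst[OF a]]])
    also have "\<dots> \<le> K" unfolding c0_norm using K by (intro cSUP_least) auto
    finally show ?thesis .
  qed
  define B where "B = C * L (chi {..<1})"
  have y_bound: "cmod (S (chi {j}) i) \<le> B" for i j
    using S_upper[OF chi_in_c00[of "{j}"], of i] spread[of "{j}"] by (simp add: B_def)
  \<comment> \<open>The images of the unit vectors are bounded in every coordinate, so a subsequence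
    converges coordinatewise. Its limit l need not be 0, which is why differences of two late terms
    are formed.\<close>
  obtain r where r: "strict_mono (r :: nat \<Rightarrow> nat)"
    and "\<And>i. i \<in> (UNIV::nat set) \<Longrightarrow> \<exists>l. (\<lambda>n. S (chi {r n}) i) \<longlonglongrightarrow> l"
    using function_convergent_subsequence[of "UNIV::nat set" "\<lambda>j i. S (chi {j}) i" B] y_bound by auto
  then obtain l where l: "\<And>i. (\<lambda>n. S (chi {r n}) i) \<longlonglongrightarrow> l i" by auto metis
  have step: "\<exists>p q. N < p \<and> p < q \<and> (\<forall>i<M. cmod (S (chi {p}) i - S (chi {q}) i) \<le> \<epsilon>)"
    if "\<epsilon> > 0" for N M \<epsilon>
  proof -
    have "\<forall>\<^sub>F n in sequentially. \<forall>i\<in>{..<M}. dist (S (chi {r n}) i) (l i) < \<epsilon> / 2"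
      using that by (intro eventually_ball_finite ballI tendstoD[OF l]) auto
    then obtain n0 where n0: "\<And>n i. n \<ge> n0 \<Longrightarrow> i < M \<Longrightarrow> dist (S (chi {r n}) i) (l i) < \<epsilon> / 2"
      by (auto simp: eventually_sequentially)
    define n where "n = max n0 (Suc N)"
    have "cmod (S (chi {r n}) i - S (chi {r (Suc n)}) i) \<le> \<epsilon>" if "i < M" for i
    proof -
      have ge: "n \<ge> n0" "Suc n \<ge> n0" by (auto simp: n_def)
      show ?thesis
        using n0[OF ge(1) that] n0[OF ge(2) that]
          dist_triangle2[of "S (chi {r n}) i" "S (chi {r (Suc n)}) i" "l i"]
        unfolding dist_norm by linarith
    qed
    moreover have "N < r n" using seq_suble[OF r, of n] by (simp add: n_def)
    moreover have "r n < r (Suc n)" using r by (simp add: strict_mono_def)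
    ultimately show ?thesis by blast
  qed
  \<comment> \<open>Gliding hump. The constant 2 B does not grow with n: below M the new difference
    is at most \<open>\<epsilon>\<close> / 2, and from M on the old vector is below
    \<open>\<epsilon>\<close> / 2 while the new difference is at most 2 B.\<close>
  have blocks: "\<exists>P Q. finite P \<and> finite Q \<and> P \<inter> Q = {} \<and> card P = n \<and> (\<forall>i. cmod (S (chi P - chi Q) i) \<le> 2 * B + \<epsilon>)"
    if "\<epsilon> > 0" for n \<epsilon>
    using that
  proof (induction n arbitrary: \<epsilon>)
    case 0
    have "0 \<le> B" using y_bound[of 0 0] norm_ge_zero order_trans by blast
    then show ?case using 0
      by (intro exI[of _ "{}"]) (auto simp: S_zero[unfolded zero_fun_def] fun_diff_def)
  next
    case (Suc n)
    then have "\<epsilon> / 2 > 0" by simp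
    from Suc.IH[OF this] obtain P Q where PQ: "finite P" "finite Q" "P \<inter> Q = {}" "card P = n"
      and bd: "\<And>i. cmod (S (chi P - chi Q) i) \<le> 2 * B + \<epsilon> / 2" by blast
    have zin: "chi P - chi Q \<in> c00" by (intro c00_diff chi_in_c00 PQ)
    obtain M where M: "\<And>i. i \<ge> M \<Longrightarrow> cmod (S (chi P - chi Q) i) < \<epsilon> / 2"
      using LIMSEQ_D[OF S_in[OF zin] \<open>\<epsilon> / 2 > 0\<close>] by auto
    obtain N where N: "\<And>j. j \<in> P \<union> Q \<Longrightarrow> j \<le> N"
      using PQ(1,2) finite_nat_set_iff_bounded_le[of "P \<union> Q"] by auto
    obtain p q where pq: "N < p" "p < q" "\<And>i. i < M \<Longrightarrow> cmod (S (chi {p}) i - S (chi {q}) i) \<le> \<epsilon> / 2"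
      using step[OF \<open>\<epsilon> / 2 > 0\<close>, of N M] by blast
    have new: "p \<notin> P" "p \<notin> Q" "q \<notin> P" "q \<notin> Q" using N pq(1,2) by force+
    have eq: "chi (insert p P) - chi (insert q Q) = (chi P - chi Q) + (chi {p} - chi {q})"
      using new pq(2) by (auto simp: fun_eq_iff)
    have S_eq: "S (chi (insert p P) - chi (insert q Q)) i = S (chi P - chi Q) i + (S (chi {p}) i - S (chi {q}) i)" for i
    proof -
      have c: "chi {p} \<in> c00" "chi {q} \<in> c00" by (rule chi_in_c00, simp)+
      show ?thesis unfolding eq S_add[OF zin c00_diff[OF c]] S_diff[OF c] by simp
    qed
    have "cmod (S (chi (insert p P) - chi (insert q Q)) i) \<le> 2 * B + \<epsilon>" for i
    proof -
      have "cmod (S (chi (insert p P) - chi (insert q Q)) i)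
          \<le> cmod (S (chi P - chi Q) i) + cmod (S (chi {p}) i - S (chi {q}) i)"
        unfolding S_eq by (rule norm_triangle_ineq)
      also have "\<dots> \<le> 2 * B + \<epsilon>"
      proof (cases "i < M")
        case True
        then show ?thesis using bd[of i] pq(3)[of i] by simp
      next
        case False
        then show ?thesis
          using M[of i] norm_triangle_ineq4[of "S (chi {p}) i" "S (chi {q}) i"] y_bound[of p i] y_bound[of q i] Suc.prems
          by simp
      qed
      finally show ?thesis .
    qed
    moreover have "finite (insert p P)" "finite (insert q Q)" "insert p P \<inter> insert q Q = {}" "card (insert p P) = Suc n"
      using PQ new pq(2) by auto
    ultimately show ?case by blast
  qed
  have "L (chi {..<n}) \<le> D * ((2 * B + 1) / c)" for n
  proof -
    obtain P Q where PQ: "finite P" "finite Q" "P \<inter> Q = {}" "card P = n"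
      and bd: "\<And>i. cmod (S (chi P - chi Q) i) \<le> 2 * B + 1" using blocks[OF zero_less_one, of n] by blast
    have zin: "chi P - chi Q \<in> c00" by (intro c00_diff chi_in_c00 PQ)
    have "L (chi {..<n}) = L (chi P)" using spread[OF PQ(1)] PQ(4) by simp
    \<comment> \<open>As P and Q are disjoint, \<open>chi P - chi Q\<close> dominates
      \<open>chi P\<close> in modulus.\<close>
    also have "\<dots> \<le> D * L (chi P - chi Q)"
      using PQ(3) by (intro uncond zin chi_in_c00 PQ) auto
    also have "\<dots> \<le> D * ((2 * B + 1) / c)"
      using S_lower[OF zin bd] \<open>0 < c\<close> \<open>0 \<le> D\<close> by (intro mult_left_mono) (auto simp: field_simps)
    finally show ?thesis .
  qed
  then show ?thesis by blast
qed

lemma spreading_limitD: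
  assumes "spreading_limit \<Phi> V L" "a \<in> V n" "\<epsilon> > 0"
  obtains \<nu> where "\<And>k. strict_mono_on {..<n} k \<Longrightarrow> (\<And>j. j < n \<Longrightarrow> \<nu> \<le> k j) \<Longrightarrow> \<bar>\<Phi> n k a - L a\<bar> < \<epsilon>"
  using assms unfolding spreading_limit_def by blast

text \<open>The seminorm properties and the unconditionality of L are limits of the corresponding
  inequalities for x. The final bound exceeds the one for L by 1, the tolerance at which the limit
  is approximated.\<close>

theorem c0_spreading_model_upper_bound:
  fixes x :: "nat \<Rightarrow> 'a::complex_banach"
  assumes SL: "spreading_limit (\<lambda>n k a. norm (\<Sum>j<n. a j *\<^sub>C x (k j))) (\<lambda>n. {a. supp a \<subseteq> {..<n}}) L"
    and "0 \<le> D"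
    and uncond: "\<And>(n::nat) k a b. strict_mono_on {..<n} k \<Longrightarrow> (\<And>j. cmod (a j) \<le> cmod (b j)) \<Longrightarrow>
      norm (\<Sum>j<n. a j *\<^sub>C x (k j)) \<le> D * norm (\<Sum>j<n. b j *\<^sub>C x (k j))"
    and iso: "isomorphic (completion (seq_space c00 L)) c0_space"
  shows "\<exists>K. \<forall>n::nat. \<exists>\<nu>. \<forall>k. strict_mono_on {..<n} k \<and> (\<forall>j<n. \<nu> \<le> k j) \<longrightarrow> norm (\<Sum>j<n. x (k j)) \<le> K"
proof -
  have lim: "(\<lambda>\<nu>. norm (\<Sum>j<n. a j *\<^sub>C x (k j + \<nu>))) \<longlonglongrightarrow> L a"
    if km: "strict_mono_on {..<n} k" and a: "supp a \<subseteq> {..<n}" for n k a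
  proof (rule LIMSEQ_I)
    fix e :: real assume "e > 0"
    have "a \<in> {a. supp a \<subseteq> {..<n}}" using a by simp
    from spreading_limitD[where V = "\<lambda>n. {a. supp a \<subseteq> {..<n}}", OF SL this \<open>e > 0\<close>]
    obtain \<nu> where \<nu>: "\<And>k. strict_mono_on {..<n} k \<Longrightarrow> (\<And>j. j < n \<Longrightarrow> \<nu> \<le> k j) \<Longrightarrow>
        \<bar>norm (\<Sum>j<n. a j *\<^sub>C x (k j)) - L a\<bar> < e"
      by blast
    have "norm (norm (\<Sum>j<n. a j *\<^sub>C x (k j + m)) - L a) < e" if "m \<ge> \<nu>" for m
      unfolding real_norm_def by (rule \<nu>) (use km that in \<open>auto simp: strict_mono_on_def\<close>)
    then show "\<exists>no. \<forall>m\<ge>no. norm (norm (\<Sum>j<n. a j *\<^sub>C x (k j + m)) - L a) < e" by blast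
  qed
  have sm: "strict_mono_on {..<n} (\<lambda>j. j + \<nu>)" for n \<nu> :: nat by (auto simp: strict_mono_on_def)
  have lim_id: "(\<lambda>\<nu>. norm (\<Sum>j<n. a j *\<^sub>C x (j + \<nu>))) \<longlonglongrightarrow> L a"
    if "supp a \<subseteq> {..<n}" for n a
    using lim[OF sm[of n 0] that] by simp
  have ex: "\<exists>n. supp a \<subseteq> {..<n}" if "a \<in> c00" for a
    using that finite_nat_iff_bounded by (auto simp: c00_def)
  have ex2: "\<exists>n. supp a \<subseteq> {..<n} \<and> supp b \<subseteq> {..<n}" if ab: "a \<in> c00" "b \<in> c00" for a b
  proof -
    have "finite (supp a \<union> supp b)" using ab by (simp add: c00_def)
    then show ?thesis using finite_nat_iff_bounded[of "supp a \<union> supp b"] by auto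
  qed
  have "\<exists>K. \<forall>n. L (chi {..<n}) \<le> K"
  proof (rule spreading_norm_bounded_if_c0[OF _ _ _ \<open>0 \<le> D\<close> _ _ iso])
    fix a b assume a: "a \<in> c00"
    show "0 \<le> L a" using LIMSEQ_le_const[OF lim_id] ex[OF a] by (metis norm_ge_zero)
    show "L (\<lambda>j. c * a j) = cmod c * L a" for c
    proof -
      obtain n where n: "supp a \<subseteq> {..<n}" using ex[OF a] by blast
      then have "supp (\<lambda>j. c * a j) \<subseteq> {..<n}" by (auto simp: supp_def)
      from lim_id[OF this]
      have "(\<lambda>\<nu>. cmod c * norm (\<Sum>j<n. a j *\<^sub>C x (j + \<nu>))) \<longlonglongrightarrow> L (\<lambda>j. c * a j)"
        by (simp add: scaleC_scaleC[symmetric] scaleC_sum_right[symmetric] norm_scaleC)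
      moreover have "(\<lambda>\<nu>. cmod c * norm (\<Sum>j<n. a j *\<^sub>C x (j + \<nu>))) \<longlonglongrightarrow> cmod c * L a"
        by (intro tendsto_intros lim_id n)
      ultimately show ?thesis by (rule LIMSEQ_unique)
    qed
    {
      assume b: "b \<in> c00"
      obtain n where n: "supp a \<subseteq> {..<n}" "supp b \<subseteq> {..<n}" using ex2[OF a b] by blast
      then have ab: "supp (a + b) \<subseteq> {..<n}" by (force simp: supp_def)
      show "L (a + b) \<le> L a + L b"
      proof (rule LIMSEQ_le[OF lim_id[OF ab] tendsto_add[OF lim_id[OF n(1)] lim_id[OF n(2)]]])
        show "\<exists>N. \<forall>m\<ge>N. norm (\<Sum>j<n. (a + b) j *\<^sub>C x (j + m)) \<le>
          norm (\<Sum>j<n. a j *\<^sub>C x (j + m)) + norm (\<Sum>j<n. b j *\<^sub>C x (j + m))"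
          by (simp add: scaleC_add_left sum.distrib norm_triangle_ineq)
      qed
      show "L a \<le> D * L b" if le: "\<And>j. cmod (a j) \<le> cmod (b j)"
      proof (rule LIMSEQ_le[OF lim_id[OF n(1)] tendsto_mult_left[OF lim_id[OF n(2)]]])
        show "\<exists>N. \<forall>m\<ge>N. norm (\<Sum>j<n. a j *\<^sub>C x (j + m)) \<le> D * norm (\<Sum>j<n. b j *\<^sub>C x (j + m))"
          by (intro exI allI impI, rule uncond[OF sm], rule le)
      qed
    }
  next
    fix A :: "nat set" assume A: "finite A"
    define k where "k j = sorted_list_of_set A ! j" for j
    have bij: "bij_betw k {..<card A} A"
      unfolding k_def using A by (intro bij_betw_nth) auto
    have k: "strict_mono_on {..<card A} k"
      unfolding k_def using A strict_sorted_list_of_set[of A]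
      by (auto simp: strict_mono_on_def intro!: sorted_wrt_nth_less[of "(<)"])
    obtain n where n: "A \<subseteq> {..<n}" using A finite_nat_iff_bounded by blast
    have "(\<Sum>j<n. chi A j *\<^sub>C x (j + \<nu>)) = (\<Sum>j<card A. chi {..<card A} j *\<^sub>C x (k j + \<nu>))" for \<nu>
    proof -
      have "(\<Sum>j<n. chi A j *\<^sub>C x (j + \<nu>)) = (\<Sum>j\<in>A. x (j + \<nu>))"
        using n by (intro sum.mono_neutral_cong_right) auto
      also have "\<dots> = (\<Sum>j<card A. x (k j + \<nu>))"
        by (rule sum.reindex_bij_betw[OF bij, symmetric])
      finally show ?thesis by simp
    qed
    then have "(\<lambda>\<nu>. norm (\<Sum>j<n. chi A j *\<^sub>C x (j + \<nu>))) \<longlonglongrightarrow> L (chi {..<card A})"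
      using lim[OF k, of "chi {..<card A}"] by (simp only: supp_chi order_refl)
    then show "L (chi A) = L (chi {..<card A})"
      using lim_id[of "chi A" n] n LIMSEQ_unique by (simp only: supp_chi) blast
  qed
  then obtain K where K: "\<And>n. L (chi {..<n}) \<le> K" by blast
  have "\<exists>\<nu>. \<forall>k. strict_mono_on {..<n} k \<and> (\<forall>j<n. \<nu> \<le> k j) \<longrightarrow> norm (\<Sum>j<n. x (k j)) \<le> K + 1" for n :: nat
  proof -
    have "chi {..<n} \<in> {a. supp a \<subseteq> {..<n}}" unfolding mem_Collect_eq supp_chi ..
    from spreading_limitD[where V = "\<lambda>n. {a. supp a \<subseteq> {..<n}}", OF SL this zero_less_one]
    obtain \<nu> where \<nu>: "\<And>k. strict_mono_on {..<n} k \<Longrightarrow> (\<And>j. j < n \<Longrightarrow> \<nu> \<le> k j) \<Longrightarrow>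
        \<bar>norm (\<Sum>j<n. chi {..<n} j *\<^sub>C x (k j)) - L (chi {..<n})\<bar> < 1"
      by blast
    have "norm (\<Sum>j<n. x (k j)) \<le> K + 1" if "strict_mono_on {..<n} k \<and> (\<forall>j<n. \<nu> \<le> k j)" for k
      using \<nu>[of k] that K[of n] by simp
    then show ?thesis by blast
  qed
  then show ?thesis by blast
qed

section \<open>Lozanovskii factorizations\<close>

definition basis_vec :: "(nat \<Rightarrow> 'a::complex_banach) \<Rightarrow> (nat \<Rightarrow> complex) \<Rightarrow> 'a" where
  "basis_vec e a = (\<Sum>j\<in>supp a. a j *\<^sub>C e j)"

lemma basis_vec_eq_sum:
  assumes "finite A" "supp a \<subseteq> A"
  shows "basis_vec e a = (\<Sum>j\<in>A. a j *\<^sub>C e j)"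
  unfolding basis_vec_def using assms by (intro sum.mono_neutral_left) (auto simp: supp_def)

lemma basis_vec_sums:
  assumes "a \<in> c00"
  shows "(\<lambda>j. a j *\<^sub>C e j) sums basis_vec e a"
  unfolding basis_vec_def using assms by (intro sums_finite) (auto simp: supp_def c00_def)

lemma basis_vec_add:
  assumes "a \<in> c00" "b \<in> c00"
  shows "basis_vec e (a + b) = basis_vec e a + basis_vec e b"
  using sums_unique2[OF basis_vec_sums[OF c00_add[OF assms], of e]]
    sums_add[OF basis_vec_sums[OF assms(1), of e] basis_vec_sums[OF assms(2), of e]]
  by (simp add: scaleC_add_left)

lemma basis_vec_diff:
  assumes "a \<in> c00" "b \<in> c00"
  shows "basis_vec e (a - b) = basis_vec e a - basis_vec e b"
  using basis_vec_add[OF c00_diff[OF assms] assms(2), of e] by simp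

lemma basis_vec_scale: "a \<in> c00 \<Longrightarrow> basis_vec e (\<lambda>j. c * a j) = c *\<^sub>C basis_vec e a"
  using basis_vec_eq_sum[of "supp a" "\<lambda>j. c * a j" e]
  by (auto simp: basis_vec_def scaleC_sum_right scaleC_scaleC c00_def supp_def)

lemma c00_sum: "(\<And>i. i \<in> I \<Longrightarrow> a i \<in> c00) \<Longrightarrow> (\<lambda>j. \<Sum>i\<in>I. a i j) \<in> c00"
proof (induction I rule: infinite_finite_induct)
  case (insert i I)
  then show ?case using c00_add[of "a i" "\<lambda>j. \<Sum>i\<in>I. a i j"] by (simp add: plus_fun_def)
qed (auto simp: c00_def supp_def)

lemma basis_vec_sum:
  "(\<And>i. i \<in> I \<Longrightarrow> a i \<in> c00) \<Longrightarrow> basis_vec e (\<lambda>j. \<Sum>i\<in>I. a i j) = (\<Sum>i\<in>I. basis_vec e (a i))"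
proof (induction I rule: infinite_finite_induct)
  case (insert i I)
  then show ?case using basis_vec_add[of "a i" "\<lambda>j. \<Sum>i\<in>I. a i j" e] c00_sum[of I a]
    by (simp add: plus_fun_def)
qed (auto simp: basis_vec_def supp_def)

lemma schauder_basis_coord_sums:
  assumes "schauder_basis e"
  shows "(\<lambda>j. coord e x j *\<^sub>C e j) sums x"
  unfolding coord_def using assms theI'[of "\<lambda>a. (\<lambda>j. a j *\<^sub>C e j) sums x"]
  by (auto simp: schauder_basis_def)

lemma coord_basis_vec:
  assumes "schauder_basis e" "a \<in> c00"
  shows "coord e (basis_vec e a) = a"
  using assms schauder_basis_coord_sums[OF assms(1)] basis_vec_sums[OF assms(2)]
  unfolding schauder_basis_def by blast

text \<open>A functional is determined by its values on the basis, so the supremum in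
  \<open>dual_seq_space\<close> involves only one functional.\<close>

lemma bounded_clinear_determined:
  assumes "schauder_basis e" "bounded_clinear f"
  shows "(\<lambda>j. coord e x j * f (e j)) sums f x"
proof -
  have "(\<lambda>j. f (coord e x j *\<^sub>C e j)) sums f x"
    using assms(2) by (intro bounded_linear.sums[OF _ schauder_basis_coord_sums[OF assms(1)]])
      (simp add: bounded_clinear_def)
  then show ?thesis using assms(2) by (simp add: bounded_clinear_def)
qed

section \<open>The renormed basis and the duality pairing\<close>

locale renormed_basis =
  fixes e :: "nat \<Rightarrow> 'a::complex_banach" and N :: "'a \<Rightarrow> real"
  assumes basis: "schauder_basis e" and renorming: "unconditional_renorming e N"
begin

lemma N_scale: "N (c *\<^sub>C x) = cmod c * N x"
  using renorming by (auto simp: unconditional_renorming_def)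

lemma N_equiv: obtains c C where "0 < c" "0 < C" "\<And>x. c * norm x \<le> N x" "\<And>x. N x \<le> C * norm x"
  using renorming by (auto simp: unconditional_renorming_def)

lemma N_nonneg: "0 \<le> N x"
proof -
  obtain c C where "0 < c" "\<And>x. c * norm x \<le> N x" using N_equiv by metis
  then show ?thesis by (meson mult_nonneg_nonneg norm_ge_zero order_less_imp_le order_trans)
qed

lemma N_mono:
  assumes "a \<in> c00" "b \<in> c00" "\<And>j. cmod (a j) \<le> cmod (b j)"
  shows "N (basis_vec e a) \<le> N (basis_vec e b)"
  using renorming assms by (simp add: unconditional_renorming_def coord_basis_vec[OF basis])

lemma vnorm_basis_seq_space: "a \<in> c00 \<Longrightarrow> vnorm (basis_seq_space e N) a = N (basis_vec e a)"
  using sums_unique[OF basis_vec_sums, of a e] by (simp add: basis_seq_space_def seq_space_simps)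

text \<open>The dual norm gives |f x| \<le> N x. Unconditionality upgrades this to a sum of moduli:
  the phases of a are changed so that all terms of f become nonnegative, which does not increase
  N.\<close>

lemma dual_pairing_le:
  assumes w: "w \<in> vecs (dual_seq_space e N)" "vnorm (dual_seq_space e N) w \<le> 1" and a: "a \<in> c00"
  shows "(\<Sum>j\<in>supp a. cmod (a j) * cmod (w j)) \<le> N (basis_vec e a)"
proof -
  obtain c C where c: "0 < c" "\<And>x. c * norm x \<le> N x" using N_equiv by metis
  obtain f where f: "bounded_clinear f" "\<And>j. f (e j) = w j"
    using w(1) by (auto simp: dual_seq_space_def seq_space_simps)
  let ?S = "{cmod (g x) |g x. bounded_clinear g \<and> (\<forall>j. g (e j) = w j) \<and> N x \<le> 1}"
  obtain K where K: "0 < K" "\<And>x. norm (f x) \<le> norm x * K"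
    using bounded_linear.pos_bounded[of f] f(1) unfolding bounded_clinear_def by blast
  \<comment> \<open>A supremum bounds its members only for a set bounded above. All competitors g
    coincide with f, so the boundedness of f suffices.\<close>
  have bdd: "bdd_above ?S"
  proof (rule bdd_aboveI[of _ "1 / c * K"])
    fix y assume "y \<in> ?S"
    then obtain g x where g: "y = cmod (g x)" "bounded_clinear g" "\<And>j. g (e j) = w j" "N x \<le> 1" by blast
    have "g x = f x"
      using sums_unique2[OF bounded_clinear_determined[OF basis g(2)] bounded_clinear_determined[OF basis f(1), of x, unfolded f(2) g(3)[symmetric]]] .
    moreover have "norm x \<le> 1 / c" using c(2)[of x] g(4) c(1) by (simp add: field_simps)
    ultimately show "y \<le> 1 / c * K"
      using g(1) K(2)[of x] mult_right_mono[of "norm x" "1 / c" K] K(1) by simp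
  qed
  have unit: "cmod (f x) \<le> 1" if "N x \<le> 1" for x
  proof -
    have "cmod (f x) \<in> ?S" using f that by blast
    then have "cmod (f x) \<le> Sup ?S" by (rule cSup_upper[OF _ bdd])
    then show ?thesis using w(2) by (simp add: dual_seq_space_def seq_space_simps)
  qed
  \<comment> \<open>Scaling by a number R strictly above N x avoids a division by N x = 0.\<close>
  have f_le: "cmod (f x) \<le> N x" for x
  proof (rule dense_ge)
    fix R assume R: "N x < R"
    then have R0: "0 < R" using N_nonneg[of x] by simp
    have c: "cmod (of_real (inverse R)) = inverse R" using R0 unfolding norm_of_real by simp
    have "N (of_real (inverse R) *\<^sub>C x) \<le> 1" using R R0 unfolding N_scale c by (simp add: field_simps)
    then have "cmod (f (of_real (inverse R) *\<^sub>C x)) \<le> 1" by (rule unit)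
    moreover have "f (of_real (inverse R) *\<^sub>C x) = of_real (inverse R) * f x"
      using f(1) by (simp only: bounded_clinear_def)
    ultimately have "inverse R * cmod (f x) \<le> 1" by (simp only: norm_mult c)
    then show "cmod (f x) \<le> R" using R0 by (simp add: field_simps)
  qed
  define b where "b j = of_real (cmod (a j)) * cnj (sgn (w j))" for j
  have b: "b \<in> c00" "supp b \<subseteq> supp a"
    using a by (auto simp: c00_def b_def supp_def elim!: rev_finite_subset)
  have bw: "b j * w j = of_real (cmod (a j) * cmod (w j))" for j
  proof -
    have "cnj (sgn (w j)) * w j = of_real (cmod (w j))"
      using complex_norm_square[of "w j"]
      by (cases "w j = 0") (simp_all add: sgn_eq power2_eq_square field_simps)
    then show ?thesis by (simp add: b_def)
  qed
  have "f (basis_vec e b) = (\<Sum>j\<in>supp a. f (b j *\<^sub>C e j))"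
  proof -
    have "linear f" using f(1) by (simp add: bounded_clinear_def bounded_linear.linear)
    moreover have "basis_vec e b = (\<Sum>j\<in>supp a. b j *\<^sub>C e j)"
      using a b(2) by (intro basis_vec_eq_sum) (auto simp: c00_def)
    ultimately show ?thesis by (simp only: linear_sum)
  qed
  also have "\<dots> = of_real (\<Sum>j\<in>supp a. cmod (a j) * cmod (w j))"
    using f by (simp add: bounded_clinear_def bw)
  finally have fb: "f (basis_vec e b) = of_real (\<Sum>j\<in>supp a. cmod (a j) * cmod (w j))" .
  have "(\<Sum>j\<in>supp a. cmod (a j) * cmod (w j)) \<le> cmod (f (basis_vec e b))"
    unfolding fb norm_of_real by (rule abs_ge_self)
  also have "\<dots> \<le> N (basis_vec e b)" by (rule f_le)
  also have "\<dots> \<le> N (basis_vec e a)"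
    by (intro N_mono a b) (simp add: b_def norm_mult norm_sgn)
  finally show ?thesis .
qed

end

text \<open>At 1/2 both powers equal 1, so only the derivatives of the exponents remain, with
  opposite signs.\<close>

lemma has_field_derivative_lozanovskii:
  fixes u v w :: complex
  assumes "v \<noteq> 0" "w \<noteq> 0"
  shows "((\<lambda>z. u * of_real (cmod v) powr (1/2 - z) * of_real (cmod w) powr (z - 1/2))
     has_field_derivative u * of_real (ln (cmod w) - ln (cmod v))) (at (1/2))"
proof -
  define V W where "V = complex_of_real (cmod v)" and "W = complex_of_real (cmod w)"
  have VW: "V \<noteq> 0" "W \<noteq> 0" "Ln V = of_real (ln (cmod v))" "Ln W = of_real (ln (cmod w))"
    using assms by (simp_all add: V_def W_def Ln_of_real)
  have "((\<lambda>z. V powr (1/2 - z)) has_field_derivative Ln V * V powr (1/2 - 1/2) * (- 1)) (at (1/2))"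
    by (rule DERIV_chain2[OF has_field_derivative_powr_right[OF VW(1)]]) (auto intro!: derivative_eq_intros)
  moreover have "((\<lambda>z. W powr (z - 1/2)) has_field_derivative Ln W * W powr (1/2 - 1/2) * 1) (at (1/2))"
    by (rule DERIV_chain2[OF has_field_derivative_powr_right[OF VW(2)]]) (auto intro!: derivative_eq_intros)
  ultimately have "((\<lambda>z. u * V powr (1/2 - z) * W powr (z - 1/2)) has_field_derivative
      u * (Ln V * V powr (1/2 - 1/2) * (- 1)) * W powr (1/2 - 1/2)
      + Ln W * W powr (1/2 - 1/2) * 1 * (u * V powr (1/2 - 1/2))) (at (1/2))"
    by (intro DERIV_mult DERIV_cmult)
  then show ?thesis using VW by (simp add: V_def[symmetric] W_def[symmetric] algebra_simps)
qed

locale lozanovskii = renormed_basis +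
  fixes B :: "(nat \<Rightarrow> complex) \<Rightarrow> complex \<Rightarrow> nat \<Rightarrow> complex"
  assumes selection: "lozanovskii_selection (basis_seq_space e N) (dual_seq_space e N) B"
begin

text \<open>Membership of w in the dual unit ball is recorded by its pairing inequality, the form in
  which duality is applied. The derivative formula is kept for all multiples of u because
  combinations of blocks are not normalized.\<close>

definition factorization :: "(nat \<Rightarrow> complex) \<Rightarrow> (nat \<Rightarrow> complex) \<Rightarrow> (nat \<Rightarrow> complex) \<Rightarrow> bool" where
  "factorization u v w \<longleftrightarrow> v \<in> c00 \<and> supp v = supp u \<and> supp w = supp u \<and> N (basis_vec e v) \<le> 1 \<and>
     (\<forall>a\<in>c00. (\<Sum>j\<in>supp a. cmod (a j) * cmod (w j)) \<le> N (basis_vec e a)) \<and>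
     (\<forall>j. (cmod (u j))\<^sup>2 = cmod (v j) * cmod (w j)) \<and>
     (\<forall>c j. derivation B (\<lambda>j. c * u j) j = c * u j * of_real (ln (cmod (w j)) - ln (cmod (v j))))"

lemma factorization_exists:
  assumes u: "u \<in> c00" "norm2 u = 1"
  shows "\<exists>v w. factorization u v w"
proof -
  obtain v w where v: "v \<in> vecs (basis_seq_space e N)" "vnorm (basis_seq_space e N) v \<le> 1" "supp v = supp u"
    and w: "w \<in> vecs (dual_seq_space e N)" "vnorm (dual_seq_space e N) w \<le> 1" "supp w = supp u"
    and uvw: "\<And>j. (cmod (u j))\<^sup>2 = cmod (v j) * cmod (w j)"
    and B: "\<And>z j. z \<in> strip \<Longrightarrow> B u z j = u j * of_real (cmod (v j)) powr (1/2 - z) * of_real (cmod (w j)) powr (z - 1/2)"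
    using selection u unfolding lozanovskii_selection_def by metis
  have u2: "u \<in> ell2" using u c00_subset_ell2 by blast
  have scale: "B (\<lambda>j. c * u j) z j = c * B u z j" if "z \<in> strip" for c z j
    using selection u2 that unfolding lozanovskii_selection_def by metis
  have v00: "v \<in> c00" using u v(3) by (simp add: c00_def)
  have "derivation B (\<lambda>j. c * u j) j = c * u j * of_real (ln (cmod (w j)) - ln (cmod (v j)))" for c j
  proof -
    have "((\<lambda>z. c * u j * of_real (cmod (v j)) powr (1/2 - z) * of_real (cmod (w j)) powr (z - 1/2))
        has_field_derivative c * u j * of_real (ln (cmod (w j)) - ln (cmod (v j)))) (at (1/2))"
    proof (cases "u j = 0")
      case False
      then have "v j \<noteq> 0" "w j \<noteq> 0" using v(3) w(3) by (auto simp: supp_def)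
      then show ?thesis by (rule has_field_derivative_lozanovskii)
    qed simp
    \<comment> \<open>The formula for B is available on the strip, whose open interior contains 1/2;
      this determines the derivative there.\<close>
    moreover have "open {z. 0 < Re z \<and> Re z < 1}"
      by (intro open_Collect_conj open_halfspace_Re_gt open_halfspace_Re_lt)
    ultimately have "((\<lambda>z. B (\<lambda>j. c * u j) z j) has_field_derivative
        c * u j * of_real (ln (cmod (w j)) - ln (cmod (v j)))) (at (1/2))"
      by (rule has_field_derivative_transform_within_open) (auto simp: scale B strip_def)
    then show ?thesis unfolding derivation_def by (rule DERIV_imp_deriv)
  qed
  then have "factorization u v w"
    unfolding factorization_def
    using v00 v w uvw dual_pairing_le[OF w(1,2)] vnorm_basis_seq_space[OF v00] by auto
  then show ?thesis by blast
qed

end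

text \<open>For t \<ge> 1 one has ln t = 2 ln(sqrt t) \<le> 2 sqrt t. Both sides of the claim are
  invariant under s \<mapsto> 1 / s, which covers s < 1.\<close>

lemma ln_square_le:
  fixes s :: real
  assumes "0 < s"
  shows "(ln s)\<^sup>2 \<le> 4 * (s + 1 / s)"
proof -
  have ge1: "(ln t)\<^sup>2 \<le> 4 * t" if "1 \<le> t" for t :: real
  proof -
    have "ln t = 2 * ln (sqrt t)" using that by (simp add: ln_sqrt)
    also have "\<dots> \<le> 2 * sqrt t" using ln_le_minus_one[of "sqrt t"] that by simp
    finally have "(ln t)\<^sup>2 \<le> (2 * sqrt t)\<^sup>2" using that by (intro power_mono) auto
    then show ?thesis using that by (simp add: power_mult_distrib)
  qed
  show ?thesis
  proof (cases "1 \<le> s")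
    case True
    then show ?thesis using ge1[of s] by (simp add: add_increasing2)
  next
    case False
    then have "(ln (1 / s))\<^sup>2 \<le> 4 * (1 / s)" using assms by (intro ge1) simp
    moreover have "(ln (1 / s))\<^sup>2 = (ln s)\<^sup>2" using assms by (simp add: ln_div)
    ultimately show ?thesis using assms by simp
  qed
qed

lemma sum_eq_single:
  assumes "finite J" "j0 \<in> J" "\<And>j. j \<in> J \<Longrightarrow> j \<noteq> j0 \<Longrightarrow> f j = 0"
  shows "sum f J = (f j0 :: 'b::comm_monoid_add)"
  using sum.mono_neutral_right[of J "{j0}" f] assms by simp

section \<open>Combinations of disjointly supported unit vectors\<close>

locale disjoint_blocks =
  fixes n :: nat and y :: "nat \<Rightarrow> nat \<Rightarrow> complex"
  assumes y_c00: "\<And>j. j < n \<Longrightarrow> y j \<in> c00"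
    and y_norm: "\<And>j. j < n \<Longrightarrow> norm2 (y j) = 1"
    and disjoint: "\<And>i j. i < n \<Longrightarrow> j < n \<Longrightarrow> i \<noteq> j \<Longrightarrow> supp (y i) \<inter> supp (y j) = {}"
begin

definition comb :: "(nat \<Rightarrow> complex) \<Rightarrow> nat \<Rightarrow> complex" where
  "comb c = (\<lambda>i. \<Sum>j<n. c j * y j i)"

lemma y_zero: "j < n \<Longrightarrow> y j i \<noteq> 0 \<Longrightarrow> j' < n \<Longrightarrow> j' \<noteq> j \<Longrightarrow> y j' i = 0"
  using disjoint[of j j'] by (auto simp: supp_def)

lemma sum_block:
  assumes "j < n" "y j i \<noteq> 0" "\<And>j'. j' < n \<Longrightarrow> y j' i = 0 \<Longrightarrow> f j' = 0"
  shows "(\<Sum>j'<n. f j') = (f j :: 'b::comm_monoid_add)"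
proof (rule sum_eq_single)
  show "f j' = 0" if "j' \<in> {..<n}" "j' \<noteq> j" for j'
    using y_zero[OF assms(1,2), of j'] assms(3)[of j'] that by simp
qed (use assms(1) in auto)

lemma comb_eq: "j < n \<Longrightarrow> y j i \<noteq> 0 \<Longrightarrow> comb c i = c j * y j i"
  unfolding comb_def by (rule sum_block) auto

lemma comb_in_c00: "comb c \<in> c00"
  unfolding comb_def by (rule c00_sum) (simp add: c00_scale y_c00)

lemma norm2_comb:
  assumes "supp c \<subseteq> {..<n}"
  shows "norm2 (comb c) = norm2 c"
proof -
  define A where "A = (\<Union>j<n. supp (y j))"
  have A: "finite A" using y_c00 by (auto simp: A_def c00_def)
  have "comb c i = 0" if "i \<notin> A" for i using that by (auto simp: comb_def A_def supp_def)
  then have suppA: "supp (comb c) \<subseteq> A" by (auto simp: supp_def)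
  have sq: "(cmod (comb c i))\<^sup>2 = (\<Sum>j<n. (cmod (c j))\<^sup>2 * (cmod (y j i))\<^sup>2)" if i: "i \<in> A" for i
  proof -
    obtain j where j: "j < n" "y j i \<noteq> 0" using i by (auto simp: A_def supp_def)
    have "(\<Sum>j<n. (cmod (c j))\<^sup>2 * (cmod (y j i))\<^sup>2) = (cmod (c j))\<^sup>2 * (cmod (y j i))\<^sup>2"
      by (rule sum_block[OF j]) auto
    then show ?thesis using comb_eq[OF j, of c] by (simp add: norm_mult power_mult_distrib)
  qed
  have one: "(\<Sum>i\<in>A. (cmod (y j i))\<^sup>2) = 1" if "j < n" for j
  proof -
    have "norm2 (y j) = L2_set (\<lambda>i. cmod (y j i)) A"
      using A that by (intro norm2_finite_supp) (auto simp: A_def)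
    then show ?thesis using y_norm[OF that] by (simp add: L2_set_def)
  qed
  have "(\<Sum>i\<in>A. (cmod (comb c i))\<^sup>2) = (\<Sum>i\<in>A. \<Sum>j<n. (cmod (c j))\<^sup>2 * (cmod (y j i))\<^sup>2)"
    by (intro sum.cong refl sq)
  also have "\<dots> = (\<Sum>j<n. (cmod (c j))\<^sup>2 * (\<Sum>i\<in>A. (cmod (y j i))\<^sup>2))"
    by (subst sum.swap) (simp add: sum_distrib_left)
  also have "\<dots> = (\<Sum>j<n. (cmod (c j))\<^sup>2)" by (intro sum.cong) (auto simp: one)
  finally show ?thesis
    using norm2_finite_supp(2)[OF A suppA] norm2_finite_supp(2)[OF finite_lessThan assms]
    by (simp add: L2_set_def)
qed

end

context lozanovskii begin

lemma factorizationD: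
  assumes "factorization u v w"
  shows "v \<in> c00" "supp v = supp u" "supp w = supp u" "N (basis_vec e v) \<le> 1"
    "\<And>a. a \<in> c00 \<Longrightarrow> (\<Sum>j\<in>supp a. cmod (a j) * cmod (w j)) \<le> N (basis_vec e a)"
    "\<And>j. (cmod (u j))\<^sup>2 = cmod (v j) * cmod (w j)"
    "\<And>c j. derivation B (\<lambda>j. c * u j) j = c * u j * of_real (ln (cmod (w j)) - ln (cmod (v j)))"
  using assms by (simp_all add: factorization_def)

lemma factorization_nz:
  assumes "factorization u v w" "u i \<noteq> 0"
  shows "v i \<noteq> 0" "w i \<noteq> 0"
  using factorizationD(2,3)[OF assms(1)] assms(2) by (auto simp: supp_def)

text \<open>The factorization formula is prescribed on unit vectors; zero is reached as the multiple
  0 of one of them.\<close>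

lemma derivation_zero: "derivation B 0 = 0"
proof -
  have c: "chi {0} \<in> c00" by (rule chi_in_c00) simp
  have "norm2 (chi {0}) = L2_set (\<lambda>j. cmod (chi {0} j)) {0}"
    by (rule norm2_finite_supp(2)[OF _ eq_refl[OF supp_chi]]) simp
  also have "\<dots> = 1" by simp
  finally obtain v w where "factorization (chi {0}) v w"
    using factorization_exists[OF c] by blast
  from factorizationD(7)[OF this, of 0] have "derivation B (\<lambda>j. 0) j = 0" for j by simp
  then show ?thesis unfolding zero_fun_def by (rule ext)
qed

text \<open>If the \<open>v j\<close> span \<open>c\<^sub>0\<close> uniformly, then \<open>vv = \<Sum> v j\<close> is, up to the constant \<open>K\<close>, the first
  factor of a Lozanovskii factorization of the combination of the blocks. Comparing it with the factor \<open>v'\<close>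
  used by the selection through \<open>s = \<bar>vv\<bar> / \<bar>v'\<bar>\<close>, both \<open>\<Sum> \<bar>u\<bar>\<^sup>2 s\<close> and \<open>\<Sum> \<bar>u\<bar>\<^sup>2 / s\<close> are
  bounded by duality, and these dominate \<open>\<Sum> \<bar>u\<bar>\<^sup>2 (ln s)\<^sup>2\<close>.\<close>

theorem derivation_block_estimate:
  assumes blocks: "disjoint_blocks n y"
    and fact: "\<And>j. j < n \<Longrightarrow> factorization (y j) (v j) (w j)"
    and K: "N (basis_vec e (\<lambda>i. \<Sum>j<n. v j i)) \<le> K"
    and b: "supp b \<subseteq> {..<n}"
  shows "\<exists>d\<in>ell2. norm2 d \<le> 4 * sqrt (K + 1) * norm2 b \<and>
    (\<forall>i. derivation B (\<lambda>i. \<Sum>j<n. b j * y j i) i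
      = (\<Sum>j<n. b j * derivation B (y j) i) + 2 * (\<Sum>j<n. KP b j * y j i) + d i)"
proof -
  interpret disjoint_blocks n y by fact
  let ?\<Delta> = "\<lambda>i. derivation B (\<lambda>i. \<Sum>j<n. b j * y j i) i - (\<Sum>j<n. b j * derivation B (y j) i)
            - 2 * (\<Sum>j<n. KP b j * y j i)"
  have bell: "b \<in> ell2" using norm2_finite_supp(1)[OF finite_lessThan b] .
  have "?\<Delta> \<in> ell2 \<and> norm2 ?\<Delta> \<le> 4 * sqrt (K + 1) * norm2 b"
  proof (cases "norm2 b = 0")
    case True
    then have "b = 0" using norm2_eq_0_iff[OF bell] by simp
    then have "?\<Delta> = (\<lambda>i. 0)" using derivation_zero unfolding zero_fun_def by (simp add: kalton_peck_map_def)
    then show ?thesis using True norm2_zero zero_in_ell2 unfolding zero_fun_def by simp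
  next
    case False
    define \<beta> where "\<beta> = norm2 b"
    have \<beta>: "\<beta> > 0" using False norm2_nonneg[OF bell] by (simp add: \<beta>_def)
    \<comment> \<open>Factorizations are available for unit vectors, hence the division by
      \<open>\<beta>\<close>; the factor returns through the derivative formula for multiples of
      h.\<close>
    define h where "h = (\<lambda>i. of_real (inverse \<beta>) * comb b i)"
    have h: "h \<in> c00" unfolding h_def by (intro c00_scale comb_in_c00)
    have "norm2 h = cmod (of_real (inverse \<beta>)) * norm2 (comb b)"
      unfolding h_def using comb_in_c00 c00_subset_ell2 by (intro norm2_scale) blast
    also have "\<dots> = 1" unfolding norm2_comb[OF b] norm_of_real using \<beta> by (simp add: \<beta>_def)
    finally obtain v' w' where f': "factorization h v' w'" using factorization_exists[OF h] by blast
    have fin: "finite (supp h)" using h by (simp add: c00_def)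
    define vv where "vv = (\<lambda>i. \<Sum>j<n. v j i)"
    define s where "s i = cmod (vv i) / cmod (v' i)" for i
    have v_zero: "v j i = 0" if "j < n" "y j i = 0" for i j
      using factorizationD(2)[OF fact[OF that(1)]] that(2) by (auto simp: supp_def)
    have vv_c00: "vv \<in> c00" unfolding vv_def using factorizationD(1)[OF fact] by (intro c00_sum) simp
    have vv_eq: "vv i = v j i" if "j < n" "y j i \<noteq> 0" for i j
      unfolding vv_def by (rule sum_block[OF that]) (rule v_zero)
    have y0: "derivation B (y j) i = y j i * of_real (ln (cmod (w j i)) - ln (cmod (v j i)))" if "j < n" for i j
      using factorizationD(7)[OF fact[OF that], of 1] by simp
    have comb_h: "comb b = (\<lambda>i. of_real \<beta> * h i)" using \<beta> by (simp add: h_def fun_eq_iff)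
    have hn0: "cmod (h i) = cmod (comb b i) / \<beta>" for i
      unfolding h_def norm_mult norm_of_real using \<beta> by (simp add: divide_inverse)
    have dcomb: "derivation B (comb b) i = of_real \<beta> * h i * of_real (ln (cmod (w' i)) - ln (cmod (v' i)))" for i
      unfolding comb_h by (rule factorizationD(7)[OF f'])
    have ex_j: "\<exists>j<n. y j i \<noteq> 0 \<and> b j \<noteq> 0" if "h i \<noteq> 0" for i
    proof (rule ccontr)
      assume "\<not> ?thesis"
      then have "comb b i = 0" unfolding comb_def by (intro sum.neutral) auto
      then show False using that by (simp add: h_def)
    qed
    have nz: "vv i \<noteq> 0" "v' i \<noteq> 0" "w' i \<noteq> 0" if hi: "h i \<noteq> 0" for i
    proof -
      obtain j where j: "j < n" "y j i \<noteq> 0" using ex_j[OF hi] by blast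
      show "vv i \<noteq> 0" unfolding vv_eq[OF j] by (rule factorization_nz[OF fact[OF j(1)] j(2)])
    qed (use factorization_nz[OF f' hi] in auto)
    \<comment> \<open>Outside the blocks, and on a block with b j = 0, both sides vanish. On the
      others |v'| |w'| = t^2 |v j| |w j| with t = |b j| / \<open>\<beta>\<close>. After taking
      logarithms, t^2 contributes 2 ln t, which the term with \<open>KP b\<close> cancels, and 2 ln
      s is left.\<close>
    have \<Delta>: "?\<Delta> i = of_real (2 * \<beta>) * (h i * of_real (ln (s i)))" for i
    proof -
      have D: "?\<Delta> i = derivation B (comb b) i - (\<Sum>j<n. b j * derivation B (y j) i) - 2 * (\<Sum>j<n. KP b j * y j i)"
        by (simp add: comb_def)
      show ?thesis
      proof (cases "\<exists>j<n. y j i \<noteq> 0")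
        case False
        then have "comb b i = 0" by (simp add: comb_def)
        then have "h i = 0" by (simp add: h_def)
        then show ?thesis using False unfolding D unfolding dcomb by (simp add: y0)
      next
        case True
        then obtain j where j: "j < n" "y j i \<noteq> 0" by blast
        have c: "comb b i = b j * y j i" by (rule comb_eq[OF j])
        have 1: "(\<Sum>j<n. b j * derivation B (y j) i) = b j * derivation B (y j) i"
          by (rule sum_block[OF j]) (simp add: y0)
        have 2: "(\<Sum>j<n. KP b j * y j i) = KP b j * y j i"
          by (rule sum_block[OF j]) simp
        show ?thesis
        proof (cases "b j = 0")
          case True
          then have "h i = 0" using c by (simp add: h_def)
          then show ?thesis unfolding D unfolding dcomb 1 2 using True by (simp add: kalton_peck_map_def)
        next
          case False
          define t where "t = cmod (b j) / \<beta>"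
          have t: "t > 0" using False \<beta> by (simp add: t_def)
          have hi: "h i \<noteq> 0" using c False j \<beta> by (simp add: h_def)
          note nzj = factorization_nz[OF fact[OF j(1)] j(2)]
          have hb: "of_real \<beta> * h i = b j * y j i" using c \<beta> by (simp add: h_def)
          have hn: "cmod (h i) = t * cmod (y j i)"
            unfolding hn0 c t_def norm_mult by simp
          have "cmod (v' i) * cmod (w' i) = t\<^sup>2 * (cmod (v j i) * cmod (w j i))"
            using factorizationD(6)[OF f', of i] factorizationD(6)[OF fact[OF j(1)], of i]
            unfolding hn by (simp add: power_mult_distrib)
          then have "ln (cmod (v' i) * cmod (w' i)) = ln (t\<^sup>2 * (cmod (v j i) * cmod (w j i)))" by simp
          then have ln: "ln (cmod (v' i)) + ln (cmod (w' i)) = 2 * ln t + (ln (cmod (v j i)) + ln (cmod (w j i)))"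
            using nz[OF hi] nzj t by (simp add: ln_mult ln_realpow)
          have lns: "ln (s i) = ln (cmod (v j i)) - ln (cmod (v' i))"
            using nz[OF hi] nzj by (simp add: s_def vv_eq[OF j] ln_div)
          have kp: "KP b j = b j * of_real (ln t)" by (simp add: kalton_peck_map_def t_def \<beta>_def)
          have r: "ln (cmod (w' i)) - ln (cmod (v' i)) - (ln (cmod (w j i)) - ln (cmod (v j i))) - 2 * ln t = 2 * ln (s i)"
            using ln unfolding lns by (simp add: algebra_simps)
          have "?\<Delta> i = b j * y j i * of_real (ln (cmod (w' i)) - ln (cmod (v' i)) - (ln (cmod (w j i)) - ln (cmod (v j i))) - 2 * ln t)"
            unfolding D unfolding dcomb 1 2 hb kp y0[OF j(1)] by (simp add: algebra_simps)
          also have "\<dots> = of_real (2 * \<beta>) * (h i * of_real (ln (s i)))"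
            unfolding r hb[symmetric] by simp
          finally show ?thesis .
        qed
      qed
    qed
    have s_pos: "s i > 0" if "h i \<noteq> 0" for i using nz[OF that] by (simp add: s_def)
    \<comment> \<open>Here |h|^2 s = |vv| |w'|, so the sum is a pairing of vv with the dual factor
      w' and is at most N of vv.\<close>
    have a: "(\<Sum>i\<in>supp h. (cmod (h i))\<^sup>2 * s i) \<le> K"
    proof -
      have "(\<Sum>i\<in>supp h. (cmod (h i))\<^sup>2 * s i) = (\<Sum>i\<in>supp h. cmod (vv i) * cmod (w' i))"
        using nz by (intro sum.cong) (auto simp: factorizationD(6)[OF f'] s_def supp_def)
      also have "\<dots> \<le> (\<Sum>i\<in>supp vv. cmod (vv i) * cmod (w' i))"
        using vv_c00 nz by (intro sum_mono2) (auto simp: c00_def supp_def)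
      also have "\<dots> \<le> K"
        using factorizationD(5)[OF f' vv_c00] K unfolding vv_def by linarith
      finally show ?thesis .
    qed
    \<comment> \<open>On block j, |h|^2 / s = (|b j| / \<open>\<beta>\<close>)^2 |v'| |w j|. Each w
      j pairs with v' to at most 1, and the squared weights add up to 1.\<close>
    have bb: "(\<Sum>i\<in>supp h. (cmod (h i))\<^sup>2 / s i) \<le> 1"
    proof -
      have "(cmod (h i))\<^sup>2 / s i \<le> (\<Sum>j<n. (cmod (b j) / \<beta>)\<^sup>2 * (cmod (v' i) * cmod (w j i)))" if i: "i \<in> supp h" for i
      proof -
        have hi: "h i \<noteq> 0" using i by (simp add: supp_def)
        obtain j where j: "j < n" "y j i \<noteq> 0" using ex_j[OF hi] by blast
        note nzj = factorization_nz[OF fact[OF j(1)] j(2)]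
        have hn: "cmod (h i) = cmod (b j) / \<beta> * cmod (y j i)"
          unfolding hn0 comb_eq[OF j] norm_mult by simp
        have "(cmod (h i))\<^sup>2 / s i = (cmod (b j) / \<beta>)\<^sup>2 * (cmod (v' i) * cmod (w j i))"
          unfolding hn power_mult_distrib factorizationD(6)[OF fact[OF j(1)]] s_def vv_eq[OF j]
          using nzj nz[OF hi] by simp
        also have "\<dots> \<le> (\<Sum>j<n. (cmod (b j) / \<beta>)\<^sup>2 * (cmod (v' i) * cmod (w j i)))"
          using j(1) by (intro member_le_sum[of j "{..<n}" "\<lambda>j. (cmod (b j) / \<beta>)\<^sup>2 * (cmod (v' i) * cmod (w j i))"]) auto
        finally show ?thesis .
      qed
      then have "(\<Sum>i\<in>supp h. (cmod (h i))\<^sup>2 / s i)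
          \<le> (\<Sum>i\<in>supp h. \<Sum>j<n. (cmod (b j) / \<beta>)\<^sup>2 * (cmod (v' i) * cmod (w j i)))"
        by (rule sum_mono)
      also have "\<dots> = (\<Sum>j<n. (cmod (b j) / \<beta>)\<^sup>2 * (\<Sum>i\<in>supp v'. cmod (v' i) * cmod (w j i)))"
        unfolding factorizationD(2)[OF f'] by (subst sum.swap) (simp add: sum_distrib_left)
      also have "\<dots> \<le> (\<Sum>j<n. (cmod (b j) / \<beta>)\<^sup>2 * 1)"
      proof (intro sum_mono mult_left_mono)
        fix j assume "j \<in> {..<n}"
        then have "(\<Sum>i\<in>supp v'. cmod (v' i) * cmod (w j i)) \<le> N (basis_vec e v')"
          by (intro factorizationD(5)[OF fact] factorizationD(1)[OF f']) simp
        then show "(\<Sum>i\<in>supp v'. cmod (v' i) * cmod (w j i)) \<le> 1"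
          using factorizationD(4)[OF f'] by linarith
      qed simp
      also have "\<dots> = (\<Sum>j<n. (cmod (b j))\<^sup>2) / \<beta>\<^sup>2"
        by (simp add: power_divide sum_divide_distrib)
      also have "(\<Sum>j<n. (cmod (b j))\<^sup>2) = \<beta>\<^sup>2"
        unfolding \<beta>_def norm2_finite_supp(2)[OF finite_lessThan b] L2_set_def by (simp add: sum_nonneg)
      finally show ?thesis using \<beta> by simp
    qed
    define g where "g = (\<lambda>i. h i * of_real (ln (s i)))"
    have gsupp: "supp g \<subseteq> supp h" by (auto simp: g_def supp_def)
    have "(\<Sum>i\<in>supp h. (cmod (g i))\<^sup>2) \<le> (\<Sum>i\<in>supp h. 4 * ((cmod (h i))\<^sup>2 * s i + (cmod (h i))\<^sup>2 / s i))"
    proof (rule sum_mono)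
      fix i assume "i \<in> supp h"
      then have "s i > 0" by (intro s_pos) (simp add: supp_def)
      then have "(cmod (h i))\<^sup>2 * (ln (s i))\<^sup>2 \<le> (cmod (h i))\<^sup>2 * (4 * (s i + 1 / s i))"
        by (intro mult_left_mono ln_square_le) auto
      then show "(cmod (g i))\<^sup>2 \<le> 4 * ((cmod (h i))\<^sup>2 * s i + (cmod (h i))\<^sup>2 / s i)"
        by (simp add: g_def norm_mult power_mult_distrib algebra_simps)
    qed
    also have "\<dots> = 4 * ((\<Sum>i\<in>supp h. (cmod (h i))\<^sup>2 * s i) + (\<Sum>i\<in>supp h. (cmod (h i))\<^sup>2 / s i))"
      by (simp add: sum_distrib_left sum.distrib)
    also have "\<dots> \<le> 4 * (K + 1)" using a bb by simp
    finally have "norm2 g \<le> sqrt (4 * (K + 1))"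
      unfolding norm2_finite_supp(2)[OF fin gsupp] L2_set_def by (rule real_sqrt_le_mono)
    also have "\<dots> = 2 * sqrt (K + 1)" by (simp only: real_sqrt_mult real_sqrt_four)
    finally have g: "norm2 g \<le> 2 * sqrt (K + 1)" .
    have \<Delta>g: "?\<Delta> = (\<lambda>i. of_real (2 * \<beta>) * g i)" using \<Delta> by (simp add: fun_eq_iff g_def)
    have "norm2 ?\<Delta> = cmod (of_real (2 * \<beta>)) * norm2 g"
      unfolding \<Delta>g by (rule norm2_scale(2)[OF norm2_finite_supp(1)[OF fin gsupp]])
    also have "\<dots> = 2 * \<beta> * norm2 g" unfolding norm_of_real using \<beta> by simp
    also have "\<dots> \<le> 2 * \<beta> * (2 * sqrt (K + 1))" using \<beta> g by (intro mult_left_mono) auto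
    finally have "norm2 ?\<Delta> \<le> 4 * sqrt (K + 1) * norm2 b" by (simp add: \<beta>_def algebra_simps)
    moreover have "?\<Delta> \<in> ell2"
      unfolding \<Delta>g by (rule norm2_scale(1)[OF norm2_finite_supp(1)[OF fin gsupp]])
    ultimately show ?thesis by blast
  qed
  then show ?thesis by (intro bexI[of _ ?\<Delta>]) (auto simp: algebra_simps)
qed

end

section \<open>Twisted spreading models\<close>

lemma consecutive_blocks_less:
  assumes "consecutive_blocks u" "i < j"
  shows "Max (supp (u i)) < Min (supp (u j))"
  using assms(2)
proof (induction j)
  case (Suc j)
  have b: "finite (supp (u j))" "supp (u j) \<noteq> {}" "Max (supp (u j)) < Min (supp (u (Suc j)))"
    using assms(1) by (auto simp: consecutive_blocks_def)
  show ?case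
  proof (cases "i = j")
    case False
    then have "Max (supp (u i)) < Min (supp (u j))" using Suc by simp
    also have "\<dots> \<le> Max (supp (u j))" using b(1,2) by simp
    also note b(3)
    finally show ?thesis .
  qed (use b in simp)
qed simp

lemma consecutive_blocks_disjoint:
  assumes u: "consecutive_blocks u" and "i \<noteq> j"
  shows "supp (u i) \<inter> supp (u j) = {}"
proof -
  have "supp (u i) \<inter> supp (u j) = {}" if "i < j" for i j
  proof -
    have f: "finite (supp (u i))" "finite (supp (u j))" using u by (auto simp: consecutive_blocks_def)
    show ?thesis using consecutive_blocks_less[OF u that] Max_ge[OF f(1)] Min_le[OF f(2)] by fastforce
  qed
  then show ?thesis using \<open>i \<noteq> j\<close> by (metis Int_commute nat_neq_iff)
qed

lemma disjoint_blocks_subsequence: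
  assumes u: "consecutive_blocks u" and norm: "\<And>j. norm2 (u j) = 1" and k: "strict_mono_on {..<n} k"
  shows "disjoint_blocks n (\<lambda>j. u (k j))"
proof
  show "u (k j) \<in> c00" for j using u by (simp add: consecutive_blocks_def c00_def)
  show "supp (u (k i)) \<inter> supp (u (k j)) = {}" if "i < n" "j < n" "i \<noteq> j" for i j
    using strict_mono_on_imp_inj_on[OF k] that
    by (intro consecutive_blocks_disjoint[OF u]) (auto simp: inj_on_def)
qed (rule norm)

context lozanovskii begin

text \<open>A spreading model needs a bounded sequence without convergent subsequences. The pairing
  of \<open>V j\<close> with \<open>W j\<close> equals the squared norm of \<open>u j\<close>, so N
  is at least 1 on each vector, and disjointness of supports keeps different vectors apart.\<close>

lemma block_sums_bounded:
  assumes c0: "\<forall>x. block_basic_sequence e x \<longrightarrow> (\<forall>M\<in>spreading_models x. isomorphic M c0_space)"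
    and u: "consecutive_blocks u" and norm: "\<And>j. norm2 (u j) = 1"
    and fact: "\<And>j. factorization (u j) (V j) (W j)"
  shows "\<exists>(r::nat\<Rightarrow>nat) K. strict_mono r \<and> (\<forall>n::nat. \<exists>\<nu>. \<forall>k. strict_mono_on {..<n} k \<and> (\<forall>j<n. \<nu> \<le> k j) \<longrightarrow>
    N (basis_vec e (\<lambda>i. \<Sum>j<n. V (r (k j)) i)) \<le> K)"
proof -
  obtain c C where c: "0 < c" and C: "0 < C" and eq: "\<And>x. c * norm x \<le> N x" "\<And>x. N x \<le> C * norm x"
    using N_equiv by metis
  define x where "x j = basis_vec e (V j)" for j
  have V: "V j \<in> c00" "supp (V j) = supp (u j)" for j using factorizationD[OF fact] by auto
  have V_zero: "V j i = 0" if "u j i = 0" for i j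
    using V(2)[of j] that by (auto simp: supp_def)
  have block: "block_basic_sequence e x"
    using u by (simp add: block_basic_sequence_def x_def coord_basis_vec[OF basis V(1)] consecutive_blocks_def V(2))
  have N_ge: "1 \<le> N (x j)" for j
  proof -
    have fin: "finite (supp (u j))" using u by (simp add: consecutive_blocks_def)
    have "1 = (norm2 (u j))\<^sup>2" by (simp add: norm)
    also have "\<dots> = (\<Sum>i\<in>supp (V j). cmod (V j i) * cmod (W j i))"
      unfolding norm2_finite_supp(2)[OF fin order_refl] V(2) L2_set_def
      by (simp add: sum_nonneg factorizationD(6)[OF fact])
    also have "\<dots> \<le> N (x j)" unfolding x_def by (rule factorizationD(5)[OF fact V(1)])
    finally show ?thesis .
  qed
  have "norm (x j) \<le> 1 / c" for j
    using eq(1)[of "x j"] factorizationD(4)[OF fact, of j] c by (simp add: x_def field_simps)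
  then have bdd: "bounded (range x)" by (auto simp: bounded_iff)
  have far: "1 / C \<le> norm (x i - x j)" if "i \<noteq> j" for i j
  proof -
    have "1 \<le> N (x i)" by (rule N_ge)
    also have "\<dots> \<le> N (basis_vec e (V i - V j))" unfolding x_def
    proof (intro N_mono V c00_diff)
      fix l show "cmod (V i l) \<le> cmod ((V i - V j) l)"
      proof (cases "V i l = 0")
        case False
        then have "l \<in> supp (u i)" using V(2)[of i] by (auto simp: supp_def)
        then have "l \<notin> supp (u j)" using consecutive_blocks_disjoint[OF u that] by blast
        then show ?thesis using V_zero by (simp add: supp_def)
      qed simp
    qed
    also have "\<dots> \<le> C * norm (x i - x j)"
      unfolding basis_vec_diff[OF V(1) V(1)] x_def by (rule eq(2))
    finally show ?thesis using C by (simp add: field_simps)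
  qed
  have nconv: "\<not> convergent (x \<circ> r)" if r: "strict_mono r" for r :: "nat \<Rightarrow> nat"
  proof
    assume "convergent (x \<circ> r)"
    then have "Cauchy (x \<circ> r)" by (rule convergent_Cauchy)
    moreover have "1 / C > 0" using C by simp
    ultimately obtain M where "\<forall>m\<ge>M. \<forall>n\<ge>M. norm ((x \<circ> r) m - (x \<circ> r) n) < 1 / C"
      unfolding Cauchy_iff by blast
    then have "norm (x (r M) - x (r (Suc M))) < 1 / C" by simp
    moreover have "r M \<noteq> r (Suc M)" using r strict_mono_eq by fastforce
    ultimately show False using far by (metis not_le)
  qed
  obtain r L where r: "strict_mono (r::nat\<Rightarrow>nat)"
    and L: "spreading_limit (\<lambda>n k a. norm (\<Sum>j<n. a j *\<^sub>C x (r (k j)))) (\<lambda>n. {a. supp a \<subseteq> {..<n}}) L"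
    using brunel_sucheston[OF bdd] by blast
  have "completion (seq_space c00 L) \<in> spreading_models x"
    unfolding spreading_models_def using bdd nconv r L by blast
  then have iso: "isomorphic (completion (seq_space c00 L)) c0_space" using c0 block by blast
  have "\<exists>K. \<forall>n::nat. \<exists>\<nu>. \<forall>k. strict_mono_on {..<n} k \<and> (\<forall>j<n. \<nu> \<le> k j) \<longrightarrow> norm (\<Sum>j<n. x (r (k j))) \<le> K"
  \<comment> \<open>The spreading model is formed in the original norm, whereas monotonicity belongs
    to N; passing there and back costs C / c.\<close>
  proof (rule c0_spreading_model_upper_bound[where x = "\<lambda>j. x (r j)" and D = "C / c", OF L _ _ iso])
    show "0 \<le> C / c" using c C by simp
    fix n :: nat and k :: "nat \<Rightarrow> nat" and a b :: "nat \<Rightarrow> complex"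
    assume k: "strict_mono_on {..<n} k" and ab: "\<And>j. cmod (a j) \<le> cmod (b j)"
    have "strict_mono_on {..<n} (\<lambda>j. r (k j))"
      using k r by (auto simp: strict_mono_on_def strict_mono_def)
    then interpret disjoint_blocks n "\<lambda>j. u (r (k j))" by (rule disjoint_blocks_subsequence[OF u norm])
    have c00: "(\<lambda>i. \<Sum>j<n. a j * V (r (k j)) i) \<in> c00" for a :: "nat \<Rightarrow> complex"
      by (rule c00_sum) (simp add: c00_scale V)
    have vec: "(\<Sum>j<n. a j *\<^sub>C x (r (k j))) = basis_vec e (\<lambda>i. \<Sum>j<n. a j * V (r (k j)) i)" for a :: "nat \<Rightarrow> complex"
      unfolding x_def by (subst basis_vec_sum) (simp_all add: c00_scale V basis_vec_scale)
    have le: "cmod (\<Sum>j<n. a j * V (r (k j)) i) \<le> cmod (\<Sum>j<n. b j * V (r (k j)) i)" for i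
    proof (cases "\<exists>j<n. u (r (k j)) i \<noteq> 0")
      case True
      then obtain j where j: "j < n" "u (r (k j)) i \<noteq> 0" by blast
      have "(\<Sum>j<n. d j * V (r (k j)) i) = d j * V (r (k j)) i" for d :: "nat \<Rightarrow> complex"
        by (rule sum_block[OF j]) (simp add: V_zero)
      then show ?thesis by (simp add: norm_mult mult_right_mono ab)
    next
      case False
      then show ?thesis by (simp add: V_zero)
    qed
    have "c * norm (\<Sum>j<n. a j *\<^sub>C x (r (k j))) \<le> N (\<Sum>j<n. a j *\<^sub>C x (r (k j)))" by (rule eq)
    also have "\<dots> \<le> N (\<Sum>j<n. b j *\<^sub>C x (r (k j)))" unfolding vec by (intro N_mono c00 le)
    also have "\<dots> \<le> C * norm (\<Sum>j<n. b j *\<^sub>C x (r (k j)))" by (rule eq)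
    finally show "norm (\<Sum>j<n. a j *\<^sub>C x (r (k j))) \<le> C / c * norm (\<Sum>j<n. b j *\<^sub>C x (r (k j)))"
      using c by (simp add: field_simps)
  qed
  then obtain K where K: "\<And>n::nat. \<exists>\<nu>. \<forall>k. strict_mono_on {..<n} k \<and> (\<forall>j<n. \<nu> \<le> k j) \<longrightarrow> norm (\<Sum>j<n. x (r (k j))) \<le> K"
    by blast
  have "\<exists>\<nu>. \<forall>k. strict_mono_on {..<n} k \<and> (\<forall>j<n. \<nu> \<le> k j) \<longrightarrow> N (basis_vec e (\<lambda>i. \<Sum>j<n. V (r (k j)) i)) \<le> C * K" for n :: nat
  proof -
    obtain \<nu> where \<nu>: "\<forall>k. strict_mono_on {..<n} k \<and> (\<forall>j<n. \<nu> \<le> k j) \<longrightarrow> norm (\<Sum>j<n. x (r (k j))) \<le> K"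
      using K[of n] by blast
    have vec: "basis_vec e (\<lambda>i. \<Sum>j<n. V (r (k j)) i) = (\<Sum>j<n. x (r (k j)))" for k
      unfolding x_def by (rule basis_vec_sum) (rule V)
    have "N (basis_vec e (\<lambda>i. \<Sum>j<n. V (r (k j)) i)) \<le> C * K"
      if k: "strict_mono_on {..<n} k \<and> (\<forall>j<n. \<nu> \<le> k j)" for k
    proof -
      have "norm (\<Sum>j<n. x (r (k j))) \<le> K" using \<nu> k by blast
      then have "C * norm (\<Sum>j<n. x (r (k j))) \<le> C * K" using C by simp
      then show ?thesis unfolding vec using eq(2) order_trans by blast
    qed
    then show ?thesis by blast
  qed
  then show ?thesis using r by blast
qed

text \<open>The comparison is exact up to a multiple of norm2 b. The lower bound of Q by norm2 b is
  included so that this error can later be absorbed in both directions.\<close>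

theorem twisted_spreading_norm_equiv:
  assumes c0: "\<forall>x. block_basic_sequence e x \<longrightarrow> (\<forall>M\<in>spreading_models x. isomorphic M c0_space)"
    and u: "consecutive_blocks u" and norm: "\<And>j. norm2 (u j) = 1"
    and Q: "spreading_limit
         (\<lambda>n k (a, b). vnorm (twisted_sum (derivation B))
            (\<lambda>i. (\<Sum>j<n. a j * u (k j) i) + (\<Sum>j<n. b j * derivation B (u (k j)) i),
             \<lambda>i. \<Sum>j<n. b j * u (k j) i))
         (\<lambda>n. {a. supp a \<subseteq> {..<n}} \<times> {b. supp b \<subseteq> {..<n}}) Q"
  shows "\<exists>C\<ge>0. \<forall>a\<in>c00. \<forall>b\<in>c00.
    \<bar>Q (a, b) - (norm2 (\<lambda>j. a j - 2 * KP b j) + norm2 b)\<bar> \<le> C * norm2 b \<and> norm2 b \<le> Q (a, b)"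
proof -
  have "\<forall>j. \<exists>v w. factorization (u j) v w"
    using factorization_exists norm u by (simp add: consecutive_blocks_def c00_def)
  then obtain V W where fact: "\<And>j. factorization (u j) (V j) (W j)" by metis
  obtain r K where r: "strict_mono (r::nat\<Rightarrow>nat)"
    and K: "\<And>n::nat. \<exists>\<nu>. \<forall>k. strict_mono_on {..<n} k \<and> (\<forall>j<n. \<nu> \<le> k j) \<longrightarrow>
      N (basis_vec e (\<lambda>i. \<Sum>j<n. V (r (k j)) i)) \<le> K"
    using block_sums_bounded[OF c0 u norm fact] by blast
  define C where "C = 4 * sqrt (max K 0 + 1)"
  have est: "\<bar>Q (a, b) - (norm2 (\<lambda>j. a j - 2 * KP b j) + norm2 b)\<bar> \<le> C * norm2 b + \<epsilon> \<and> norm2 b \<le> Q (a, b) + \<epsilon>"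
    if ab: "a \<in> c00" "b \<in> c00" and "\<epsilon> > 0" for a b \<epsilon>
  proof -
    have "finite (supp a \<union> supp b)" using ab by (simp add: c00_def)
    then obtain n where n: "supp a \<subseteq> {..<n}" "supp b \<subseteq> {..<n}"
      using finite_nat_iff_bounded[of "supp a \<union> supp b"] by auto
    have "(a, b) \<in> {a. supp a \<subseteq> {..<n}} \<times> {b. supp b \<subseteq> {..<n}}" using n by simp
    from spreading_limitD[where V = "\<lambda>n. {a. supp a \<subseteq> {..<n}} \<times> {b. supp b \<subseteq> {..<n}}", OF Q this \<open>\<epsilon> > 0\<close>]
    obtain \<nu>1 where \<nu>1: "\<And>k. strict_mono_on {..<n} k \<Longrightarrow> (\<And>j. j < n \<Longrightarrow> \<nu>1 \<le> k j) \<Longrightarrow>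
      \<bar>vnorm (twisted_sum (derivation B))
            (\<lambda>i. (\<Sum>j<n. a j * u (k j) i) + (\<Sum>j<n. b j * derivation B (u (k j)) i),
             \<lambda>i. \<Sum>j<n. b j * u (k j) i) - Q (a, b)\<bar> < \<epsilon>" by auto
    obtain \<nu>2 where \<nu>2: "\<forall>k. strict_mono_on {..<n} k \<and> (\<forall>j<n. \<nu>2 \<le> k j) \<longrightarrow>
      N (basis_vec e (\<lambda>i. \<Sum>j<n. V (r (k j)) i)) \<le> K" using K by blast
    \<comment> \<open>Q is a limit along the whole sequence, so one late tuple tests it. The tuple
      is taken inside the subsequence r, where the sums of V are bounded, beyond both thresholds; r
      does not decrease indices, so \<open>\<nu>1\<close> is still respected.\<close>
    define k' where "k' j = max \<nu>1 \<nu>2 + j" for j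
    define k where "k j = r (k' j)" for j
    have k': "strict_mono_on {..<n} k'" by (auto simp: strict_mono_on_def k'_def)
    have k: "strict_mono_on {..<n} k" using r by (auto simp: strict_mono_on_def strict_mono_def k_def k'_def)
    have "\<nu>1 \<le> k j" for j
    proof -
      have "\<nu>1 \<le> k' j" by (auto simp: k'_def max_def)
      also have "\<dots> \<le> k j" unfolding k_def by (rule seq_suble[OF r])
      finally show ?thesis .
    qed
    note lim = \<nu>1[OF k this]
    have "N (basis_vec e (\<lambda>i. \<Sum>j<n. V (k j) i)) \<le> K"
    proof -
      have "\<forall>j<n. \<nu>2 \<le> k' j" by (auto simp: k'_def max_def)
      then show ?thesis using \<nu>2 k' unfolding k_def by blast
    qed
    then have VK: "N (basis_vec e (\<lambda>i. \<Sum>j<n. V (k j) i)) \<le> max K 0" by simp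
    have blocks: "disjoint_blocks n (\<lambda>j. u (k j))" by (rule disjoint_blocks_subsequence[OF u norm k])
    interpret disjoint_blocks n "\<lambda>j. u (k j)" by (rule blocks)
    obtain d where d: "d \<in> ell2" "norm2 d \<le> C * norm2 b"
      and \<Omega>: "\<And>i. derivation B (\<lambda>i. \<Sum>j<n. b j * u (k j) i) i
      = (\<Sum>j<n. b j * derivation B (u (k j)) i) + 2 * (\<Sum>j<n. KP b j * u (k j) i) + d i"
      using derivation_block_estimate[OF blocks fact VK n(2)] unfolding C_def by blast
    \<comment> \<open>With these coefficients the first component is the image of p under the
      isometry \<open>comb\<close>, up to the error d.\<close>
    define p where "p = (\<lambda>j. a j - 2 * KP b j)"
    have p: "supp p \<subseteq> {..<n}" 
    proof -
      have "supp p \<subseteq> supp a \<union> supp b" by (auto simp: p_def supp_def kalton_peck_map_def)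
      then show ?thesis using n by blast
    qed
    have "(\<Sum>j<n. p j * u (k j) i) = (\<Sum>j<n. a j * u (k j) i) - 2 * (\<Sum>j<n. KP b j * u (k j) i)" for i
      by (simp add: p_def algebra_simps sum_subtractf sum_distrib_left)
    then have eq: "(\<lambda>i. (\<Sum>j<n. a j * u (k j) i) + (\<Sum>j<n. b j * derivation B (u (k j)) i)
        - derivation B (\<lambda>i. \<Sum>j<n. b j * u (k j) i) i) = comb p - d"
      unfolding \<Omega> by (simp add: fun_eq_iff comb_def)
    have "vnorm (twisted_sum (derivation B))
            (\<lambda>i. (\<Sum>j<n. a j * u (k j) i) + (\<Sum>j<n. b j * derivation B (u (k j)) i),
             \<lambda>i. \<Sum>j<n. b j * u (k j) i) = norm2 (comb p - d) + norm2 (comb b)"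
      unfolding eq[symmetric] by (simp add: twisted_sum_def seq_pair_space_def comb_def)
    note lim' = lim[unfolded this norm2_comb[OF n(2)]]
    have cp: "comb p \<in> ell2" using comb_in_c00 c00_subset_ell2 by blast
    have "norm2 (comb p - d) \<le> norm2 p + norm2 d"
      using norm2_diff(2)[OF cp d(1)] by (simp only: norm2_comb[OF p])
    moreover have "norm2 p \<le> norm2 (comb p - d) + norm2 d"
      using norm2_add(2)[OF norm2_diff(1)[OF cp d(1)] d(1)] by (simp add: norm2_comb[OF p])
    moreover have "0 \<le> norm2 (comb p - d)" by (intro norm2_nonneg norm2_diff cp d)
    ultimately show ?thesis using lim' d(2) unfolding p_def by linarith
  qed
  have "\<bar>Q (a, b) - (norm2 (\<lambda>j. a j - 2 * KP b j) + norm2 b)\<bar> \<le> C * norm2 b" "norm2 b \<le> Q (a, b)"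
    if "a \<in> c00" "b \<in> c00" for a b
    using est[OF that] by (auto intro: field_le_epsilon)
  moreover have "C \<ge> 0" by (simp add: C_def)
  ultimately show ?thesis by blast
qed

end

section \<open>Equivalence with the quasi-norm of Z_2\<close>

lemma quasi_normed_transfer:
  fixes J :: "'v::ab_group_add \<Rightarrow> 'w::ab_group_add"
  assumes "quasi_normed F \<mu>"
    and "\<And>x y. vadd E x y = x + y" "\<And>x. vscale E (-1) x = - x"
    and "\<And>c x y. vscale E c (x + y) = vscale E c x + vscale E c y"
    and add_closed: "\<And>x y. x \<in> vecs E \<Longrightarrow> y \<in> vecs E \<Longrightarrow> x + y \<in> vecs E"
    and scale_closed: "\<And>c x. x \<in> vecs E \<Longrightarrow> vscale E c x \<in> vecs E" and zero: "0 \<in> vecs E"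
    and J_in: "\<And>x. x \<in> vecs E \<Longrightarrow> J x \<in> vecs F"
    and J_add: "\<And>x y. x \<in> vecs E \<Longrightarrow> y \<in> vecs E \<Longrightarrow> J (x + y) = J x + J y"
    and J_scale: "\<And>c x. x \<in> vecs E \<Longrightarrow> J (vscale E c x) = vscale F c (J x)"
    and m: "0 < m" and lower: "\<And>x. x \<in> vecs E \<Longrightarrow> m * vnorm E x \<le> vnorm F (J x)"
    and M: "0 < M" and upper: "\<And>x. x \<in> vecs E \<Longrightarrow> vnorm F (J x) \<le> M * vnorm E x"
  shows "quasi_normed E (1 + \<mu> * M / m)"
proof -
  interpret F: quasi_normed F \<mu> by fact
  have \<kappa>: "\<mu> * M / m > 0" using F.kappa_pos m M by simp
  have nonneg: "0 \<le> vnorm E x" if "x \<in> vecs E" for x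
    using F.vnorm_nonneg[OF J_in[OF that]] upper[OF that] M by (meson order_trans zero_le_mult_iff not_le)
  \<comment> \<open>The transported inequalities hold with \<open>\<mu> * M / m\<close>; adding 1
    makes the constant at least 1, as the locale requires.\<close>
  have enlarge: "a \<le> (1 + \<mu> * M / m) * b" if "a \<le> \<mu> * M / m * b" "0 \<le> b" for a b
    using that by (simp add: algebra_simps)
  show ?thesis
  proof
    have "J 0 = 0" using J_add[OF zero zero] by simp
    then show "vnorm E 0 = 0"
      using lower[OF zero] nonneg[OF zero] F.vnorm_zero m by (simp add: mult_le_0_iff)
    show "1 \<le> 1 + \<mu> * M / m" using \<kappa> by simp
    fix x y c
    {
      assume x: "x \<in> vecs E"
      have "m * vnorm E (vscale E c x) \<le> vnorm F (vscale F c (J x))"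
        using lower[OF scale_closed[OF x]] J_scale[OF x] by simp
      also have "\<dots> \<le> \<mu> * (cmod c * vnorm F (J x))" by (rule F.vnorm_scale[OF J_in[OF x]])
      also have "\<dots> \<le> \<mu> * (cmod c * (M * vnorm E x))"
        using F.kappa_pos upper[OF x] by (intro mult_left_mono) auto
      finally have "vnorm E (vscale E c x) \<le> \<mu> * M / m * (cmod c * vnorm E x)"
        using m by (simp add: field_simps)
      then show "vnorm E (vscale E c x) \<le> (1 + \<mu> * M / m) * (cmod c * vnorm E x)"
        using nonneg[OF x] by (intro enlarge) auto
      assume y: "y \<in> vecs E"
      have "m * vnorm E (x + y) \<le> vnorm F (J x + J y)"
        using lower[OF add_closed[OF x y]] J_add[OF x y] by simp
      also have "\<dots> \<le> \<mu> * (vnorm F (J x) + vnorm F (J y))" by (intro F.vnorm_add J_in x y)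
      also have "\<dots> \<le> \<mu> * (M * vnorm E x + M * vnorm E y)"
        using F.kappa_pos upper[OF x] upper[OF y] by (intro mult_left_mono add_mono) auto
      finally have "vnorm E (x + y) \<le> \<mu> * M / m * (vnorm E x + vnorm E y)"
        using m by (simp add: field_simps)
      then show "vnorm E (x + y) \<le> (1 + \<mu> * M / m) * (vnorm E x + vnorm E y)"
        using nonneg[OF x] nonneg[OF y] by (intro enlarge) auto
    }
  qed (use assms nonneg in auto)
qed

theorem isomorphic_Z2:
  fixes Q :: "(nat \<Rightarrow> complex) \<times> (nat \<Rightarrow> complex) \<Rightarrow> real"
  assumes "0 \<le> C" and Q: "\<And>a b. a \<in> c00 \<Longrightarrow> b \<in> c00 \<Longrightarrow>
    \<bar>Q (a, b) - (norm2 (\<lambda>j. a j - 2 * KP b j) + norm2 b)\<bar> \<le> C * norm2 b \<and> norm2 b \<le> Q (a, b)"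
  shows "isomorphic (completion (seq_pair_space (c00 \<times> c00) Q)) Z2"
proof -
  let ?E = "seq_pair_space (c00 \<times> c00) Q"
  \<comment> \<open>Halving absorbs the factor 2, since a - 2 KP b = 2 (a / 2 - KP b).\<close>
  define J :: "(nat \<Rightarrow> complex) \<times> (nat \<Rightarrow> complex) \<Rightarrow> (nat \<Rightarrow> complex) \<times> (nat \<Rightarrow> complex)" where
    "J p = (\<lambda>j. fst p j / 2, snd p)" for p
  have E: "vecs ?E = c00 \<times> c00" "vnorm ?E = Q" by (simp_all add: seq_pair_space_def)
  have half: "(\<lambda>j. a j / 2) \<in> c00" if "a \<in> c00" for a using c00_scale[OF that, of "1/2"] by simp
  have J_in: "J p \<in> c00 \<times> c00" if "p \<in> c00 \<times> c00" for p using that half by (auto simp: J_def)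
  have J_Z2: "J p \<in> vecs Z2" if "p \<in> vecs ?E" for p using J_in that c00_subset_Z2 by (auto simp: E)
  have J_add: "J (p + q) = J p + J q" for p q
    by (simp add: J_def prod_eq_iff fun_eq_iff add_divide_distrib)
  have J_scale: "J (vscale ?E c p) = vscale Z2 c (J p)" for c p
    by (simp add: J_def vscale_seq_pair_space Z2_def twisted_sum_def)
  have bounds: "1 / (2 * (1 + C)) * vnorm ?E p \<le> vnorm Z2 (J p) \<and> vnorm Z2 (J p) \<le> (1 + C) * vnorm ?E p"
    if pE: "p \<in> vecs ?E" for p
  proof -
    obtain a b where p: "p = (a, b)" "a \<in> c00" "b \<in> c00" using pE by (auto simp: E)
    define A where "A = norm2 ((\<lambda>j. a j / 2) - KP b)"
    define \<beta> where "\<beta> = norm2 b"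
    have Jp: "J p \<in> vecs Z2" by (rule J_Z2[OF pE])
    then have z: "(\<lambda>j. a j / 2) - KP b \<in> ell2" by (simp add: J_def p vecs_Z2)
    have "(\<lambda>j. a j - 2 * KP b j) = (\<lambda>j. 2 * ((\<lambda>j. a j / 2) - KP b) j)"
      by (simp add: fun_eq_iff algebra_simps)
    then have "norm2 (\<lambda>j. a j - 2 * KP b j) = 2 * A" using norm2_scale(2)[OF z, of 2] by (simp add: A_def)
    with Q[OF p(2,3)] have q: "\<bar>Q p - (2 * A + \<beta>)\<bar> \<le> C * \<beta>" "\<beta> \<le> Q p" by (auto simp: p \<beta>_def)
    have pos: "0 \<le> A" "0 \<le> \<beta>"
      using norm2_nonneg[OF z] norm2_nonneg c00_subset_ell2 p(3) by (auto simp: A_def \<beta>_def)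
    have v: "vnorm Z2 (J p) = A + \<beta>" by (simp add: J_def p vnorm_Z2 A_def \<beta>_def)
    \<comment> \<open>The constant 2 (1 + C) combines the doubling of A with the error C
      \<open>\<beta>\<close>. In the opposite estimate the error is absorbed through
      \<open>\<beta>\<close> \<le> Q p.\<close>
    have "Q p \<le> 2 * A + \<beta> + C * \<beta>" using q by linarith
    also have "\<dots> \<le> 2 * (1 + C) * (A + \<beta>)"
      using pos mult_nonneg_nonneg[OF \<open>0 \<le> C\<close> pos(1)] mult_nonneg_nonneg[OF \<open>0 \<le> C\<close> pos(2)]
      by (simp add: algebra_simps)
    finally have 1: "1 / (2 * (1 + C)) * Q p \<le> A + \<beta>" using \<open>0 \<le> C\<close> by (simp add: field_simps)
    have "A + \<beta> \<le> Q p + C * \<beta>" using q pos by linarith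
    also have "\<dots> \<le> (1 + C) * Q p" using mult_left_mono[OF q(2) \<open>0 \<le> C\<close>] by (simp add: algebra_simps)
    finally show ?thesis using 1 by (simp add: v E)
  qed
  note lower = conjunct1[OF bounds] and upper = conjunct2[OF bounds]
  have m: "0 < 1 / (2 * (1 + C))" and M: "0 < 1 + C" using \<open>0 \<le> C\<close> by auto
  have "quasi_normed ?E (1 + 7 * (1 + C) / (1 / (2 * (1 + C))))"
  proof (rule quasi_normed_transfer[OF Z2.quasi_normed_axioms _ _ _ _ _ _ J_Z2 J_add J_scale m lower M upper])
    show "0 \<in> vecs ?E" unfolding E by (simp add: zero_prod_def) (simp add: c00_def supp_def)
  qed (auto simp: E vadd_seq_pair_space vscale_seq_pair_space c00_add c00_scale prod_eq_iff fun_eq_iff algebra_simps)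
  then show ?thesis
  proof (rule completion_isomorphic[OF _ Z2.quasi_normed_axioms J_Z2 J_add J_scale m lower M upper])
    fix p and \<epsilon> :: real assume "p \<in> vecs Z2" "\<epsilon> > 0"
    then obtain c d where cd: "c \<in> c00" "d \<in> c00" "vdist Z2 (c, d) p < \<epsilon>" using c00_dense_Z2 by blast
    have "J (\<lambda>j. 2 * c j, d) = (c, d)" by (simp add: J_def)
    then show "\<exists>q\<in>vecs ?E. vdist Z2 (J q) p < \<epsilon>"
      using cd c00_scale[of c 2] by (intro bexI[of _ "(\<lambda>j. 2 * c j, d)"]) (auto simp: E)
  qed (use Z2_complete Z2_definite in auto)
qed

theorem proposition9:
  fixes e :: "nat \<Rightarrow> 'a::complex_banach"
    and N :: "'a \<Rightarrow> real"
    and B :: "(nat \<Rightarrow> complex) \<Rightarrow> complex \<Rightarrow> nat \<Rightarrow> complex"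
    and S :: "(nat \<Rightarrow> (nat \<Rightarrow> complex) \<times> (nat \<Rightarrow> complex)) set qspace"
  assumes "unconditional_basis e" and "shrinking_basis e"
    and "\<And>x M. block_basic_sequence e x \<Longrightarrow> M \<in> spreading_models x \<Longrightarrow> isomorphic M c0_space"
    and "unconditional_renorming e N"
    and "lozanovskii_selection (basis_seq_space e N) (dual_seq_space e N) B"
    and "S \<in> twisted_spreading_models (derivation B)"
  shows "isomorphic S Z2"
proof -
  interpret lozanovskii e N B
    using assms(1,4,5) by unfold_locales (simp_all add: unconditional_basis_def)
  obtain Q u where S: "S = completion (seq_pair_space (c00 \<times> c00) Q)"
    and u: "consecutive_blocks u" "\<And>j. norm2 (u j) = 1"
    and Q: "spreading_limit
         (\<lambda>n k (a, b). vnorm (twisted_sum (derivation B))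
            (\<lambda>i. (\<Sum>j<n. a j * u (k j) i) + (\<Sum>j<n. b j * derivation B (u (k j)) i),
             \<lambda>i. \<Sum>j<n. b j * u (k j) i))
         (\<lambda>n. {a. supp a \<subseteq> {..<n}} \<times> {b. supp b \<subseteq> {..<n}}) Q"
    using assms(6) unfolding twisted_spreading_models_def by blast
  obtain C where "0 \<le> C" "\<forall>a\<in>c00. \<forall>b\<in>c00.
    \<bar>Q (a, b) - (norm2 (\<lambda>j. a j - 2 * KP b j) + norm2 b)\<bar> \<le> C * norm2 b \<and> norm2 b \<le> Q (a, b)"
    using twisted_spreading_norm_equiv[OF _ u Q] assms(3) by blast
  then show ?thesis unfolding S by (intro isomorphic_Z2[of C]) auto
qed

end
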